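(* Let $p$ be a prime and let $K$ be a free pro-$p$ group with $d(K) = 2$. If $\mathrm{Out}(K)$ contains a free pro-$p$ non-procyclic (closed) subgroup, then $\mathrm{Aut}_0(K)$ is incoherent (in the category of pro-$p$ groups).
   Context: A "pro-$p$ subgroup" means a closed subgroup; generation is topological; $d(G)$ denotes the minimal number of (topological) generators of $G$. For a finitely generated pro-$p$ group $G$, $\mathrm{Aut}(G)$ is the profinite group of continuous automorphisms of $G$, $\mathrm{Inn}(G)$ is the group of inner automorphisms, $\mathrm{Out}(G)=\mathrm{Aut}(G)/\mathrm{Inn}(G)$, $G^*$ is the Frattini subgroup of $G$ (the intersection of all maximal open subgroups), and $\mathrm{Aut}_0(G)=\mathrm{Ker}(\mathrm{Aut}(G)\to \mathrm{Aut}(G/G^* ))$, which is a pro-$p$ subgroup of finite index in $\mathrm{Aut}(G)$. A pro-$p$ group is finitely presented (as a pro-$p$ group) if it is isomorphic to $F/R$ with $F$ a free pro-$p$ group on a finite basis and $R$ the smallest closed normal subgroup of $F$ containing some finite set. A pro-$p$ group is coherent (in the category of pro-$p$ groups) if each of its finitely generated pro-$p$ subgroups is finitely presented as a pro-$p$ group; otherwise it is incoherent. *)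

theory Defs
  imports
    "HOL-Analysis.Analysis"
    "HOL-Algebra.Bij"
    "HOL-Algebra.Coset"
    "HOL-Algebra.Generated_Groups"
    "HOL-Computational_Algebra.Primes"
    "HOL-Library.Extended_Nat"
begin

section \<open>Topological groups\<close>

record 'a tgroup = "'a monoid" +
  topo :: "'a topology"

definition topological_group :: "'a tgroup \<Rightarrow> bool" where
  "topological_group G \<longleftrightarrow>
     group G \<and> topspace (topo G) = carrier G \<and>
     continuous_map (prod_topology (topo G) (topo G)) (topo G) (\<lambda>(x, y). x \<otimes>\<^bsub>G\<^esub> y) \<and>
     continuous_map (topo G) (topo G) (\<lambda>x. inv\<^bsub>G\<^esub> x)"

definition tg_isomorphic :: "'a tgroup \<Rightarrow> 'b tgroup \<Rightarrow> bool" where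
  "tg_isomorphic G H \<longleftrightarrow> (\<exists>h \<in> iso G H. homeomorphic_map (topo G) (topo H) h)"

definition tsub :: "'a tgroup \<Rightarrow> 'a set \<Rightarrow> 'a tgroup" where
  "tsub G H = G\<lparr>carrier := H, topo := subtopology (topo G) H\<rparr>"

definition closed_subgroup :: "'a set \<Rightarrow> 'a tgroup \<Rightarrow> bool" where
  "closed_subgroup H G \<longleftrightarrow> subgroup H G \<and> closedin (topo G) H"

definition quotient_topo :: "'a tgroup \<Rightarrow> 'a set \<Rightarrow> 'a set topology" where
  "quotient_topo G N = topology (\<lambda>\<U>. \<U> \<subseteq> rcosets\<^bsub>G\<^esub> N \<and> openin (topo G) (\<Union>\<U>))"

definition tquot :: "'a tgroup \<Rightarrow> 'a set \<Rightarrow> 'a set tgroup" where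
  "tquot G N = monoid.extend (G Mod N) \<lparr>topo = quotient_topo G N\<rparr>"

definition top_generates :: "'a tgroup \<Rightarrow> 'a set \<Rightarrow> bool" where
  "top_generates G S \<longleftrightarrow>
     S \<subseteq> carrier G \<and> topo G closure_of generate G S = carrier G"

definition top_fin_gen :: "'a tgroup \<Rightarrow> bool" where
  "top_fin_gen G \<longleftrightarrow> (\<exists>S. finite S \<and> top_generates G S)"

text \<open>The value is \<open>\<infinity>\<close> if \<open>G\<close> is not topologically finitely generated.\<close>

definition min_gens :: "'a tgroup \<Rightarrow> enat" where
  "min_gens G = (INF S \<in> {S. finite S \<and> top_generates G S}. enat (card S))"

definition procyclic :: "'a tgroup \<Rightarrow> bool" where
  "procyclic G \<longleftrightarrow> (\<exists>x. top_generates G {x})"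

definition closed_normal_closure :: "'a tgroup \<Rightarrow> 'a set \<Rightarrow> 'a set" where
  "closed_normal_closure G S = \<Inter>{N. N \<lhd> G \<and> closedin (topo G) N \<and> S \<subseteq> N}"

section \<open>Pro-p groups\<close>

definition profinite_group :: "'a tgroup \<Rightarrow> bool" where
  "profinite_group G \<longleftrightarrow>
     topological_group G \<and> compact_space (topo G) \<and> Hausdorff_space (topo G) \<and>
     (\<forall>C. connectedin (topo G) C \<longrightarrow> (\<exists>a. C \<subseteq> {a}))"

definition pro_p_group :: "nat \<Rightarrow> 'a tgroup \<Rightarrow> bool" where
  "pro_p_group p G \<longleftrightarrow>
     profinite_group G \<and>
     (\<forall>N. N \<lhd> G \<and> openin (topo G) N \<longrightarrow> (\<exists>k. card (rcosets\<^bsub>G\<^esub> N) = p ^ k))"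

definition converges_to_one :: "'x set \<Rightarrow> ('x \<Rightarrow> 'a) \<Rightarrow> 'a tgroup \<Rightarrow> bool" where
  "converges_to_one X \<phi> G \<longleftrightarrow>
     (\<forall>U. openin (topo G) U \<and> \<one>\<^bsub>G\<^esub> \<in> U \<longrightarrow> finite {x \<in> X. \<phi> x \<notin> U})"

text \<open>
  The free pro-p group on a set \<open>X\<close> converging to 1, by its universal property; for finite
  \<open>X\<close> both convergence conditions are vacuous.  Uniqueness of \<open>h\<close> follows from
  \<open>top_generates F X\<close>.

  HOL cannot quantify over the types of the test groups \<open>H\<close> inside a definition.  Nothing is
  lost by fixing the type \<open>'a + nat\<close>: it is infinite, so every finite p-group has a copy on
  it, and the universal property for finite p-groups yields the one for all pro-p groups, of any
  type, on passing to inverse limits.  (The summand \<open>nat\<close> matters only when \<open>'a\<close> is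
  finite.)
\<close>

definition free_pro_p_on :: "nat \<Rightarrow> 'a tgroup \<Rightarrow> 'a set \<Rightarrow> bool" where
  "free_pro_p_on p F X \<longleftrightarrow>
     pro_p_group p F \<and> top_generates F X \<and> converges_to_one X (\<lambda>x. x) F \<and>
     (\<forall>(H :: ('a + nat) tgroup) \<phi>.
        pro_p_group p H \<and> \<phi> \<in> X \<rightarrow> carrier H \<and> converges_to_one X \<phi> H \<longrightarrow>
        (\<exists>h \<in> hom F H. continuous_map (topo F) (topo H) h \<and> (\<forall>x \<in> X. h x = \<phi> x)))"

definition free_pro_p :: "nat \<Rightarrow> 'a tgroup \<Rightarrow> bool" where
  "free_pro_p p F \<longleftrightarrow> (\<exists>X. free_pro_p_on p F X)"

text \<open>
  A free pro-p group on a finite basis has at most the cardinality of the continuum, so it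
  always has a copy whose elements are of type \<open>nat set\<close>.
\<close>

definition fin_presented_pro_p :: "nat \<Rightarrow> 'a tgroup \<Rightarrow> bool" where
  "fin_presented_pro_p p G \<longleftrightarrow>
     (\<exists>(F :: nat set tgroup) X S.
        finite X \<and> free_pro_p_on p F X \<and> finite S \<and> S \<subseteq> carrier F \<and>
        tg_isomorphic G (tquot F (closed_normal_closure F S)))"

definition coherent_pro_p :: "nat \<Rightarrow> 'a tgroup \<Rightarrow> bool" where
  "coherent_pro_p p G \<longleftrightarrow>
     pro_p_group p G \<and>
     (\<forall>H. closed_subgroup H G \<and> top_fin_gen (tsub G H) \<longrightarrow> fin_presented_pro_p p (tsub G H))"

definition incoherent_pro_p :: "nat \<Rightarrow> 'a tgroup \<Rightarrow> bool" where
  "incoherent_pro_p p G \<longleftrightarrow> pro_p_group p G \<and> \<not> coherent_pro_p p G"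

section \<open>Automorphism groups\<close>

definition cont_auto :: "'a tgroup \<Rightarrow> ('a \<Rightarrow> 'a) set" where
  "cont_auto G = {f \<in> auto G. continuous_map (topo G) (topo G) f}"

text \<open>
  The congruence topology: for a profinite group \<open>G\<close>, a base of neighbourhoods of the
  automorphism \<open>f\<close> is given by the sets of those automorphisms that agree with \<open>f\<close>
  modulo \<open>N\<close>, for the open normal subgroups \<open>N\<close> of \<open>G\<close>.
\<close>

definition aut_topo :: "'a tgroup \<Rightarrow> ('a \<Rightarrow> 'a) topology" where
  "aut_topo G = topology (\<lambda>U. U \<subseteq> cont_auto G \<and>
     (\<forall>f \<in> U. \<exists>N. N \<lhd> G \<and> openin (topo G) N \<and>
        {g \<in> cont_auto G. \<forall>x \<in> carrier G. g x \<otimes>\<^bsub>G\<^esub> inv\<^bsub>G\<^esub> (f x) \<in> N} \<subseteq> U))"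

definition Aut :: "'a tgroup \<Rightarrow> ('a \<Rightarrow> 'a) tgroup" where
  "Aut G = monoid.extend ((AutoGroup G)\<lparr>carrier := cont_auto G\<rparr>) \<lparr>topo = aut_topo G\<rparr>"

definition Inn :: "'a tgroup \<Rightarrow> ('a \<Rightarrow> 'a) set" where
  "Inn G = (\<lambda>g. \<lambda>x \<in> carrier G. g \<otimes>\<^bsub>G\<^esub> x \<otimes>\<^bsub>G\<^esub> inv\<^bsub>G\<^esub> g) ` carrier G"

definition Out :: "'a tgroup \<Rightarrow> ('a \<Rightarrow> 'a) set tgroup" where
  "Out G = tquot (Aut G) (Inn G)"

definition maximal_open_subgroup :: "'a set \<Rightarrow> 'a tgroup \<Rightarrow> bool" where
  "maximal_open_subgroup M G \<longleftrightarrow>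
     subgroup M G \<and> openin (topo G) M \<and> M \<noteq> carrier G \<and>
     (\<forall>L. subgroup L G \<and> openin (topo G) L \<and> M \<subseteq> L \<longrightarrow> L = M \<or> L = carrier G)"

text \<open>Intersecting with the carrier matters only for the trivial group.\<close>

definition frattini :: "'a tgroup \<Rightarrow> 'a set" where
  "frattini G = carrier G \<inter> \<Inter>{M. maximal_open_subgroup M G}"

text \<open>The natural map from \<open>Aut G\<close> to \<open>Aut (G/N)\<close>, for \<open>N\<close> characteristic.\<close>

definition induced_auto :: "'a tgroup \<Rightarrow> 'a set \<Rightarrow> ('a \<Rightarrow> 'a) \<Rightarrow> 'a set \<Rightarrow> 'a set" where
  "induced_auto G N f = (\<lambda>C \<in> rcosets\<^bsub>G\<^esub> N. f ` C)"

definition Aut0 :: "'a tgroup \<Rightarrow> ('a \<Rightarrow> 'a) tgroup" where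
  "Aut0 G = tsub (Aut G)
     (kernel (Aut G) (Aut (tquot G (frattini G))) (induced_auto G (frattini G)))"

section \<open>The topologies above are well defined\<close>

lemma tsub_simps [simp]:
  "carrier (tsub G H) = H" "mult (tsub G H) = mult G" "one (tsub G H) = one G"
  "topo (tsub G H) = subtopology (topo G) H"
  by (simp_all add: tsub_def)

lemma tquot_simps [simp]:
  "carrier (tquot G N) = rcosets\<^bsub>G\<^esub> N" "mult (tquot G N) = set_mult G" "one (tquot G N) = N"
  "topo (tquot G N) = quotient_topo G N"
  by (simp_all add: tquot_def monoid.extend_def FactGroup_def)

lemma Aut_simps [simp]:
  "carrier (Aut G) = cont_auto G" "mult (Aut G) = mult (BijGroup (carrier G))"
  "one (Aut G) = (\<lambda>x \<in> carrier G. x)" "topo (Aut G) = aut_topo G"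
  by (simp_all add: Aut_def monoid.extend_def AutoGroup_def BijGroup_def)

lemma openin_quotient_topo:
  assumes "group G" "subgroup N G"
  shows "openin (quotient_topo G N) \<U> \<longleftrightarrow> \<U> \<subseteq> rcosets\<^bsub>G\<^esub> N \<and> openin (topo G) (\<Union>\<U>)"
proof -
  have disj: "A = B" if "A \<in> rcosets\<^bsub>G\<^esub> N" "B \<in> rcosets\<^bsub>G\<^esub> N" "x \<in> A" "x \<in> B" for A B x
    using group.rcos_disjoint[OF assms] that by (auto simp: pairwise_def disjnt_iff)
  have int: "\<Union>(S \<inter> T) = \<Union>S \<inter> \<Union>T" if "S \<subseteq> rcosets\<^bsub>G\<^esub> N" "T \<subseteq> rcosets\<^bsub>G\<^esub> N" for S T
  proof (intro equalityI subsetI)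
    fix x assume "x \<in> \<Union>S \<inter> \<Union>T"
    then obtain A B where "A \<in> S" "B \<in> T" "x \<in> A" "x \<in> B" by blast
    with that disj[of A B x] show "x \<in> \<Union>(S \<inter> T)" by blast
  qed blast
  have "istopology (\<lambda>\<U>. \<U> \<subseteq> rcosets\<^bsub>G\<^esub> N \<and> openin (topo G) (\<Union>\<U>))"
    unfolding istopology_def
  proof (intro conjI allI impI)
    fix \<K> assume *: "\<forall>K\<in>\<K>. K \<subseteq> rcosets\<^bsub>G\<^esub> N \<and> openin (topo G) (\<Union>K)"
    then show "\<Union>\<K> \<subseteq> rcosets\<^bsub>G\<^esub> N" by blast
    have "\<Union>(\<Union>\<K>) = \<Union>(Union ` \<K>)" by blast
    also have "openin (topo G) \<dots>" using * by (intro openin_Union) blast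
    finally show "openin (topo G) (\<Union>(\<Union>\<K>))" .
  qed (use int in \<open>auto simp: openin_Int\<close>)
  then show ?thesis by (simp add: quotient_topo_def topology_inverse')
qed

lemma openin_aut_topo:
  assumes "group G"
  shows "openin (aut_topo G) U \<longleftrightarrow> U \<subseteq> cont_auto G \<and>
    (\<forall>f \<in> U. \<exists>N. N \<lhd> G \<and> openin (topo G) N \<and>
       {g \<in> cont_auto G. \<forall>x \<in> carrier G. g x \<otimes>\<^bsub>G\<^esub> inv\<^bsub>G\<^esub> (f x) \<in> N} \<subseteq> U)"
proof -
  define nb where "nb f N = {g \<in> cont_auto G. \<forall>x \<in> carrier G. g x \<otimes>\<^bsub>G\<^esub> inv\<^bsub>G\<^esub> (f x) \<in> N}" for f N
  define P where "P U \<longleftrightarrow> U \<subseteq> cont_auto G \<and>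
    (\<forall>f \<in> U. \<exists>N. N \<lhd> G \<and> openin (topo G) N \<and> nb f N \<subseteq> U)" for U
  have "P (S \<inter> T)" if S: "P S" and T: "P T" for S T
    unfolding P_def
  proof (intro conjI ballI)
    show "S \<inter> T \<subseteq> cont_auto G" using S by (auto simp: P_def)
    fix f assume "f \<in> S \<inter> T"
    then obtain M N where M: "M \<lhd> G" "openin (topo G) M" "nb f M \<subseteq> S"
      and N: "N \<lhd> G" "openin (topo G) N" "nb f N \<subseteq> T"
      using S T unfolding P_def by blast
    have "(M \<inter> N) \<lhd> G" using M N assms by (simp add: group.normal_subgroup_intersect)
    moreover have "nb f (M \<inter> N) \<subseteq> S \<inter> T" using M N by (auto simp: nb_def)
    ultimately show "\<exists>N. N \<lhd> G \<and> openin (topo G) N \<and> nb f N \<subseteq> S \<inter> T"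
      using M N by (blast intro: openin_Int)
  qed
  moreover have "P (\<Union>\<K>)" if K: "\<forall>K\<in>\<K>. P K" for \<K>
    unfolding P_def
  proof (intro conjI ballI)
    show "\<Union>\<K> \<subseteq> cont_auto G" using K by (auto simp: P_def)
    fix f assume "f \<in> \<Union>\<K>"
    then obtain K where "K \<in> \<K>" "f \<in> K" by blast
    with K obtain N where "N \<lhd> G" "openin (topo G) N" "nb f N \<subseteq> K" unfolding P_def by blast
    with \<open>K \<in> \<K>\<close> show "\<exists>N. N \<lhd> G \<and> openin (topo G) N \<and> nb f N \<subseteq> \<Union>\<K>" by blast
  qed
  ultimately have "istopology P" by (simp add: istopology_def)
  moreover have "aut_topo G = topology P"
    unfolding aut_topo_def P_def nb_def ..
  ultimately have "openin (aut_topo G) U = P U" by (simp add: topology_inverse')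
  then show ?thesis by (simp add: P_def nb_def)
qed

end

theory Submission
  imports Defs "HOL-Algebra.Group_Action" "HOL-Algebra.Elementary_Groups" "HOL-Number_Theory.Cong"
begin

text \<open>
  Let \<open>K\<close> be free on \<open>x, y\<close>, put \<open>x\<^sub>k = y\<^sup>k x y\<^sup>-\<^sup>k\<close>, and let \<open>s\<close> and \<open>t\<close> be the automorphisms of \<open>K\<close> that fix
  \<open>y\<close> and send \<open>x\<close> to \<open>x\<^sup>2 x\<^sub>1\<^sup>-\<^sup>1\<close> and to \<open>x [x, x\<^sub>1]\<close>.  Let \<open>N\<close> be the closed subgroup of \<open>Aut\<^sub>0(K)\<close>
  generated by \<open>s\<close>, \<open>t\<close> and conjugation by \<open>x\<close>.  As \<open>s\<close> sends \<open>x\<^sub>k\<close> to \<open>x\<^sub>k\<^sup>2 x\<^sub>k\<^sub>+\<^sub>1\<^sup>-\<^sup>1\<close>, conjugation by each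
  \<open>x\<^sub>k\<close> lies in \<open>N\<close>, and \<open>t(x\<^sub>k) = x\<^sub>k [x\<^sub>k, x\<^sub>k\<^sub>+\<^sub>1]\<close> gives the relations
  \<open>t x\<^sub>k t\<^sup>-\<^sup>1 = x\<^sub>k [x\<^sub>k, x\<^sub>k\<^sub>+\<^sub>1]\<close> of \<open>N\<close>.  No finite set of relators implies all of these.

  To see this, fix a prime power \<open>m\<close> and units \<open>Y\<^sub>1, Y\<^sub>2 = 1 (mod p)\<close> with \<open>(2 - Y\<^sub>1) (2 - Y\<^sub>2) = 1 (mod m)\<close>, and
  put \<open>Y\<^sub>3 = Y\<^sub>1 Y\<^sub>2\<close>.  The action of \<open>N\<close> on matrix representations of \<open>K\<close> modulo \<open>m\<close> yields a homomorphism from \<open>N\<close> to a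
  finite p-group \<open>E / C\<close>, where \<open>E\<close> consists of matrices with rows \<open>(1, z, c), (0, d, v), (0, 0, 1)\<close> and
  \<open>C\<close> is the central subgroup of the entries \<open>c\<close>.  Lifting it to a homomorphism from a free pro-p group \<open>F\<close> covering \<open>N\<close> to \<open>E\<close> gives
  an \<open>F\<close>-invariant homomorphism from the relators to \<open>C\<close>, whose value at the \<open>k\<close>-th relation above is a nonzero constant
  times \<open>Y\<^sub>3\<^sup>k\<close>.  If \<open>r\<close> relators sufficed, then a nontrivial combination of these homomorphisms for
  \<open>r + 1\<close> choices of \<open>(Y\<^sub>1, Y\<^sub>2)\<close> would vanish on all relators, contradicting the independence of the sequences \<open>Y\<^sub>3\<^sup>k\<close>.
\<close>

section \<open>Topological groups\<close>

text \<open>The representations of \<open>K\<close> carry two cocycles \<open>w1\<close>,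
  \<open>w2\<close> with characters \<open>A1\<close>, \<open>A2\<close>, a corner entry
  \<open>q\<close> whose coboundary is, up to sign, their cup product, and a cocycle
  \<open>w\<close> with character \<open>A1 * A2\<close>. An automorphism that multiplies
  \<open>w1\<close>, \<open>w2\<close> by \<open>d1\<close>, \<open>d2\<close> respects
  \<open>q\<close> when \<open>d1 * d2 = 1\<close>. For \<open>s\<close> these factors are
  \<open>2 - Y1\<close> and \<open>2 - Y2\<close>, hence the condition on the two units. The
  character of \<open>w\<close> is that of the corner, so a multiple \<open>z\<close> of
  \<open>w\<close> can be added to \<open>q\<close>: this is what \<open>t\<close> does, with
  \<open>z = Y2 - Y1\<close>, while conjugation by \<open>x\<^sub>k\<close> changes \<open>w\<close>
  by a coboundary with parameter \<open>v\<close>. Composing the two in the order that matters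
  produces \<open>z * v\<close>, the entry \<open>c\<close> of \<open>E\<close>. In \<open>E\<close>
  the images of the \<open>x\<^sub>k\<close> commute with each other, but not with that of
  \<open>t\<close>, so the relation fails by \<open>z * v\<close>. The obstacle is that p-groups
  force the units to be 1 modulo p. All nodes \<open>Y\<^sub>3\<close> then agree modulo p and the
  constants vanish there, so linear algebra over a field is of no use. The modulus has to be a high
  power of p depending on the number of relators, counting replaces dimension, and divisibility is
  measured by integers that do not change with the modulus.\<close>

locale top_group = group G for G :: "'a tgroup" (structure) +
  assumes top_grp: "topological_group G"

lemma top_groupI: "topological_group G \<Longrightarrow> top_group G"
  by (simp add: top_group_def top_group_axioms_def topological_group_def)

context top_group
begin

lemma topspace_eq [simp]: "topspace (topo G) = carrier G"
  using top_grp by (simp add: topological_group_def)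

lemma openin_carrier: "openin (topo G) (carrier G)"
  using openin_topspace[of "topo G"] by simp

lemma openin_subset_carrier: "openin (topo G) U \<Longrightarrow> U \<subseteq> carrier G"
  using openin_subset by fastforce

lemma continuous_map_mult:
  assumes "continuous_map X (topo G) f" "continuous_map X (topo G) g"
  shows "continuous_map X (topo G) (\<lambda>x. f x \<otimes> g x)"
proof -
  have "continuous_map X (prod_topology (topo G) (topo G)) (\<lambda>x. (f x, g x))"
    using assms by (simp add: continuous_map_pairwise o_def)
  from continuous_map_compose[OF this, of "topo G" "\<lambda>(x, y). x \<otimes> y"] top_grp
  show ?thesis by (simp add: topological_group_def o_def)
qed

lemma continuous_map_inv:
  assumes "continuous_map X (topo G) f"
  shows "continuous_map X (topo G) (\<lambda>x. inv (f x))"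
  using continuous_map_compose[OF assms, of "topo G" "\<lambda>x. inv x"] top_grp
  by (simp add: topological_group_def o_def)

lemma continuous_map_const_carrier:
  "a \<in> carrier G \<Longrightarrow> continuous_map X (topo G) (\<lambda>x. a)"
  by simp

lemmas continuous_intros_tg = continuous_map_mult continuous_map_inv continuous_map_const_carrier

lemma openin_preimage:
  "continuous_map X (topo G) f \<Longrightarrow> openin (topo G) U \<Longrightarrow> openin X {x \<in> topspace X. f x \<in> U}"
  by (rule openin_continuous_map_preimage)

lemma subgroup_openinI:
  assumes H: "subgroup H G" and B: "openin (topo G) B" "\<one> \<in> B" "B \<subseteq> H"
  shows "openin (topo G) H"
proof (subst openin_subopen, intro ballI)
  fix h assume h: "h \<in> H"
  then have hc: "h \<in> carrier G" using H by (meson subgroup.mem_carrier)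
  let ?T = "{x \<in> topspace (topo G). inv h \<otimes> x \<in> B}"
  have "openin (topo G) ?T"
    by (rule openin_preimage[OF _ B(1)]) (use hc in \<open>intro continuous_intros_tg\<close>, auto)
  moreover have "h \<in> ?T" using hc B by simp
  moreover have "?T \<subseteq> H"
  proof
    fix x assume "x \<in> ?T"
    then have x: "x \<in> carrier G" "inv h \<otimes> x \<in> H" using B by auto
    have "x = h \<otimes> (inv h \<otimes> x)" using x hc by (simp add: m_assoc[symmetric])
    then show "x \<in> H" using H h x by (metis subgroup.m_closed)
  qed
  ultimately show "\<exists>T. openin (topo G) T \<and> h \<in> T \<and> T \<subseteq> H" by blast
qed

lemma openin_rcoset:
  assumes "openin (topo G) U" "a \<in> carrier G"
  shows "openin (topo G) (U #> a)"
proof -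
  have "U #> a = {x \<in> topspace (topo G). x \<otimes> inv a \<in> U}"
    using openin_subset_carrier[OF assms(1)] assms(2)
    by (auto simp: r_coset_def m_assoc intro!: bexI[of _ "_ \<otimes> inv a"])
  moreover have "openin (topo G) \<dots>"
    by (rule openin_preimage[OF _ assms(1)]) (use assms in \<open>intro continuous_intros_tg\<close>, auto)
  ultimately show ?thesis by simp
qed

lemma rcosets_openin:
  "subgroup H G \<Longrightarrow> openin (topo G) H \<Longrightarrow> C \<in> rcosets H \<Longrightarrow> openin (topo G) C"
  by (auto simp: RCOSETS_def intro: openin_rcoset)

lemma open_subgroup_closed:
  assumes H: "subgroup H G" and "openin (topo G) H"
  shows "closedin (topo G) H"
proof -
  have "carrier G - H = \<Union>(rcosets H - {H})"
  proof (intro equalityI subsetI)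
    fix x assume x: "x \<in> carrier G - H"
    then have "x \<in> H #> x" "H #> x \<in> rcosets H"
      using H by (auto simp: rcos_self rcosetsI subgroup.subset)
    moreover have "H #> x \<noteq> H" using x \<open>x \<in> H #> x\<close> by auto
    ultimately show "x \<in> \<Union>(rcosets H - {H})" by blast
  next
    fix x assume "x \<in> \<Union>(rcosets H - {H})"
    then obtain C where C: "C \<in> rcosets H" "C \<noteq> H" "x \<in> C" by blast
    have "H \<in> rcosets H" using H by (simp add: subgroup.subgroup_in_rcosets[OF H is_group])
    then show "x \<in> carrier G - H"
      using rcos_disjoint[OF H] C rcosets_part_G[OF H] by (auto simp: pairwise_def disjnt_iff)
  qed
  moreover have "openin (topo G) (\<Union>(rcosets H - {H}))"
    using rcosets_openin[OF assms] by auto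
  ultimately show ?thesis
    by (simp add: closedin_def subgroup.subset[OF H])
qed

lemma in_closure_ofD:
  "x \<in> T closure_of S \<Longrightarrow> openin T U \<Longrightarrow> x \<in> U \<Longrightarrow> \<exists>y. y \<in> S \<and> y \<in> U"
  by (auto simp: in_closure_of)

lemma closure_of_subgroup:
  assumes H: "subgroup H G"
  shows "subgroup (topo G closure_of H) G"
proof (rule subgroup.intro)
  let ?C = "topo G closure_of H"
  have HC: "H \<subseteq> carrier G" using H by (rule subgroup.subset)
  have HsC: "H \<subseteq> ?C" using closure_of_subset[of H "topo G"] HC by simp
  show C: "?C \<subseteq> carrier G" using closure_of_subset_topspace[of "topo G" H] by simp
  show "\<one> \<in> ?C" using HsC subgroup.one_closed[OF H] by blast
  show "x \<otimes> y \<in> ?C" if x: "x \<in> ?C" and y: "y \<in> ?C" for x y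
    unfolding in_closure_of
  proof (intro conjI allI impI)
    show "x \<otimes> y \<in> topspace (topo G)" using that C by auto
    fix T assume T: "x \<otimes> y \<in> T \<and> openin (topo G) T"
    have xc: "x \<in> carrier G" and yc: "y \<in> carrier G" using that C by auto
    \<comment> \<open>The two factors are approximated one after the other, so only translations
      have to be continuous here.\<close>
    let ?U = "{u \<in> topspace (topo G). u \<otimes> y \<in> T}"
    have "openin (topo G) ?U"
      by (rule openin_preimage) (use T yc in \<open>auto intro!: continuous_intros_tg\<close>)
    moreover have "x \<in> ?U" using xc T by simp
    ultimately obtain u where u: "u \<in> H" "u \<in> ?U" using in_closure_ofD[OF x] by metis
    have uc: "u \<in> carrier G" using u HC by blast
    let ?V = "{v \<in> topspace (topo G). u \<otimes> v \<in> T}"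
    have "openin (topo G) ?V"
      by (rule openin_preimage) (use T uc in \<open>auto intro!: continuous_intros_tg\<close>)
    moreover have "y \<in> ?V" using yc u by simp
    ultimately obtain v where v: "v \<in> H" "v \<in> ?V" using in_closure_ofD[OF y] by metis
    show "\<exists>w. w \<in> H \<and> w \<in> T" using u v subgroup.m_closed[OF H] by blast
  qed
  show "inv x \<in> ?C" if x: "x \<in> ?C" for x
    unfolding in_closure_of
  proof (intro conjI allI impI)
    show "inv x \<in> topspace (topo G)" using that C by auto
    fix T assume T: "inv x \<in> T \<and> openin (topo G) T"
    have xc: "x \<in> carrier G" using that C by auto
    let ?U = "{u \<in> topspace (topo G). inv u \<in> T}"
    have "openin (topo G) ?U"
      by (rule openin_preimage) (use T in \<open>auto intro!: continuous_intros_tg\<close>)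
    moreover have "x \<in> ?U" using xc T by simp
    ultimately obtain u where u: "u \<in> H" "u \<in> ?U" using in_closure_ofD[OF x] by metis
    show "\<exists>w. w \<in> H \<and> w \<in> T" using u subgroup.m_inv_closed[OF H] by blast
  qed
qed

lemma closed_gen_minimal:
  assumes "subgroup C G" "closedin (topo G) C" "X \<subseteq> C"
  shows "topo G closure_of generate G X \<subseteq> C"
  using assms by (simp add: closure_of_minimal generate_subgroup_incl)

text \<open>Open subgroups are closed, so density of the generated subgroup is enough. Most later
  extensions from generators to the whole group go through this.\<close>

lemma top_generates_open_subgroup:
  assumes "top_generates G X" "subgroup C G" "openin (topo G) C" "X \<subseteq> C"
  shows "C = carrier G"
  using closed_gen_minimal[OF assms(2) open_subgroup_closed[OF assms(2,3)] assms(4)] assms(1)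
    subgroup.subset[OF assms(2)] by (auto simp: top_generates_def)

lemma maximal_open_closed: "maximal_open_subgroup M G \<Longrightarrow> closedin (topo G) M"
  by (simp add: maximal_open_subgroup_def open_subgroup_closed)

lemma subgroup_frattini: "subgroup (frattini G) G"
proof -
  have "frattini G = \<Inter>(insert (carrier G) {M. maximal_open_subgroup M G})"
    by (simp add: frattini_def)
  also have "subgroup \<dots> G"
    by (rule subgroups_Inter) (auto simp: maximal_open_subgroup_def subgroup_self)
  finally show ?thesis .
qed

lemma closedin_frattini: "closedin (topo G) (frattini G)"
proof -
  have "frattini G = \<Inter>(insert (carrier G) {M. maximal_open_subgroup M G})"
    by (simp add: frattini_def)
  also have "closedin (topo G) \<dots>"
    using maximal_open_closed closedin_topspace[of "topo G"]
    by (intro closedin_Inter) auto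
  finally show ?thesis .
qed

lemma normal_closed_normal_closure: "S \<subseteq> carrier G \<Longrightarrow> closed_normal_closure G S \<lhd> G"
  and closedin_closed_normal_closure: "S \<subseteq> carrier G \<Longrightarrow> closedin (topo G) (closed_normal_closure G S)"
  and subset_closed_normal_closure: "S \<subseteq> closed_normal_closure G S"
proof -
  let ?\<N> = "{N. N \<lhd> G \<and> closedin (topo G) N \<and> S \<subseteq> N}"
  assume S: "S \<subseteq> carrier G"
  have cG: "carrier G \<lhd> G" by (rule normal_invI) (auto simp: subgroup_self)
  have c: "carrier G \<in> ?\<N>"
    using S cG closedin_topspace[of "topo G"] by simp
  show "closedin (topo G) (closed_normal_closure G S)"
    unfolding closed_normal_closure_def using c by (intro closedin_Inter) auto
  have "subgroup (\<Inter>?\<N>) G"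
    using c by (intro subgroups_Inter) (auto dest: normal_imp_subgroup)
  then show "closed_normal_closure G S \<lhd> G"
    unfolding closed_normal_closure_def
    by (rule normal_invI) (auto dest: normal.inv_op_closed2)
qed (auto simp: closed_normal_closure_def)

end

section \<open>Open normal subgroups of profinite groups, and maximal subgroups of finite
  p-groups\<close>

lemma (in group) mult_inv_cancel:
  assumes "x \<in> carrier G" "y \<in> carrier G"
  shows "x \<otimes> (inv x \<otimes> y) = y" "inv x \<otimes> (x \<otimes> y) = y"
  using assms by (simp_all add: m_assoc[symmetric])

lemmas (in group) word_simps = m_assoc inv_mult_group mult_inv_cancel

text \<open>The component of \<open>\<one>\<close> is a point, so compactness gives a clopen
  \<open>V\<close> with \<open>\<one> \<in> V\<close> inside \<open>U\<close>. A kind of two-sided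
  stabiliser of \<open>V\<close> is then the required subgroup.\<close>

lemma (in top_group) open_normal_base:
  assumes "profinite_group G" and U: "openin (topo G) U" "\<one> \<in> U"
  obtains N where "N \<lhd> G" "openin (topo G) N" "N \<subseteq> U"
proof -
  let ?T = "topo G"
  have cpt: "compact_space ?T" and haus: "Hausdorff_space ?T"
    and td: "\<And>C. connectedin ?T C \<Longrightarrow> \<exists>a. C \<subseteq> {a}"
    using assms(1) by (auto simp: profinite_group_def)
  have "connectedin ?T (connected_component_of_set ?T \<one>)"
    by (simp add: connectedin_connected_component_of)
  moreover have "\<one> \<in> connected_component_of_set ?T \<one>"
    by (simp add: connected_component_of_refl)
  ultimately have "connected_component_of_set ?T \<one> = {\<one>}"
    using td by blast
  then have "{\<one>} \<in> connected_components_of ?T"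
    by (metis connected_component_in_connected_components_of one_closed topspace_eq)
  then obtain V V' where V: "openin ?T V" "openin ?T V'" "disjnt V V'" "V \<union> V' = carrier G"
      "\<one> \<in> V" "V \<subseteq> U"
    using wilder_locally_compact_component_thm[of ?T "{\<one>}" U] U cpt haus
    by (auto simp: compact_imp_locally_compact_space)
  have V': "V' = carrier G - V" using V by (auto simp: disjnt_iff)
  \<comment> \<open>Testing insertion between two arbitrary factors makes \<open>N\<close> normal at
    once: conjugating \<open>n\<close> by \<open>g\<close> only replaces \<open>u\<close>,
    \<open>a\<close> by \<open>u \<otimes> g\<close>, \<open>inv g \<otimes> a\<close>.\<close>
  define N where "N = {n \<in> carrier G. \<forall>u \<in> carrier G. \<forall>a \<in> carrier G. u \<otimes> a \<in> V \<longleftrightarrow> u \<otimes> n \<otimes> a \<in> V}"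
  have NV: "N \<subseteq> V"
  proof
    fix n assume "n \<in> N"
    then show "n \<in> V" using V(5) by (force simp: N_def dest: bspec[of _ _ "\<one>"])
  qed
  have sub: "subgroup N G"
  proof (rule subgroup.intro)
    show "N \<subseteq> carrier G" by (auto simp: N_def)
    show "\<one> \<in> N" by (auto simp: N_def)
    show "m \<otimes> n \<in> N" if "m \<in> N" "n \<in> N" for m n
      unfolding N_def
    proof (intro CollectI conjI ballI)
      show "m \<otimes> n \<in> carrier G" using that by (auto simp: N_def)
      fix u a assume ua: "u \<in> carrier G" "a \<in> carrier G"
      have mn: "m \<in> carrier G" "n \<in> carrier G" using that by (auto simp: N_def)
      have "u \<otimes> a \<in> V \<longleftrightarrow> u \<otimes> m \<otimes> a \<in> V" using that(1) ua by (auto simp: N_def)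
      also have "\<dots> \<longleftrightarrow> (u \<otimes> m) \<otimes> n \<otimes> a \<in> V" using that(2) ua mn by (auto simp: N_def)
      also have "(u \<otimes> m) \<otimes> n \<otimes> a = u \<otimes> (m \<otimes> n) \<otimes> a" using ua mn by (simp add: m_assoc)
      finally show "u \<otimes> a \<in> V \<longleftrightarrow> u \<otimes> (m \<otimes> n) \<otimes> a \<in> V" .
    qed
    show "inv n \<in> N" if "n \<in> N" for n
      unfolding N_def
    proof (intro CollectI conjI ballI)
      have n: "n \<in> carrier G" using that by (auto simp: N_def)
      then show "inv n \<in> carrier G" by simp
      fix u a assume ua: "u \<in> carrier G" "a \<in> carrier G"
      have "(u \<otimes> inv n) \<otimes> a \<in> V \<longleftrightarrow> (u \<otimes> inv n) \<otimes> n \<otimes> a \<in> V"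
        using that ua n unfolding N_def by blast
      also have "(u \<otimes> inv n) \<otimes> n \<otimes> a = u \<otimes> a" using ua n by (simp add: m_assoc)
      finally show "u \<otimes> a \<in> V \<longleftrightarrow> u \<otimes> inv n \<otimes> a \<in> V" by simp
    qed
  qed
  have nor: "N \<lhd> G"
  proof (rule normal_invI[OF sub])
    fix g n assume g: "g \<in> carrier G" and nN: "n \<in> N"
    then have n: "n \<in> carrier G" by (auto simp: N_def)
    show "g \<otimes> n \<otimes> inv g \<in> N"
      unfolding N_def
    proof (intro CollectI conjI ballI)
      show "g \<otimes> n \<otimes> inv g \<in> carrier G" using g n by simp
      fix u a assume ua: "u \<in> carrier G" "a \<in> carrier G"
      have "(u \<otimes> g) \<otimes> (inv g \<otimes> a) \<in> V \<longleftrightarrow> (u \<otimes> g) \<otimes> n \<otimes> (inv g \<otimes> a) \<in> V"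
        using nN ua g unfolding N_def by blast
      then show "u \<otimes> a \<in> V \<longleftrightarrow> u \<otimes> (g \<otimes> n \<otimes> inv g) \<otimes> a \<in> V"
        using ua g n by (simp add: word_simps)
    qed
  qed
  let ?P = "prod_topology (prod_topology ?T ?T) ?T"
  let ?f = "\<lambda>z. fst (fst z) \<otimes> snd (fst z)" and ?g = "\<lambda>z. fst (fst z) \<otimes> snd z \<otimes> snd (fst z)"
  have cf: "continuous_map ?P ?T ?f" "continuous_map ?P ?T ?g"
    by (intro continuous_map_mult continuous_map_fst_of continuous_map_snd_of continuous_map_fst continuous_map_snd continuous_map_compose[OF continuous_map_fst, unfolded o_def])+
  \<comment> \<open>The triples on which both memberships agree form an open set, because
    \<open>V\<close> is clopen. It contains the slice over \<open>\<one>\<close>, and the tube lemma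
    thickens this slice to an open \<open>B\<close>, uniformly in \<open>u\<close> and
    \<open>a\<close>.\<close>
  define W where "W = ({z \<in> topspace ?P. ?f z \<in> V} \<inter> {z \<in> topspace ?P. ?g z \<in> V}) \<union>
     ({z \<in> topspace ?P. ?f z \<in> V'} \<inter> {z \<in> topspace ?P. ?g z \<in> V'})"
  have "openin ?P W"
    unfolding W_def using cf V by (intro openin_Un openin_Int openin_preimage) auto
  moreover have "compactin (prod_topology ?T ?T) (carrier G \<times> carrier G)"
    using cpt by (metis compact_space_def compact_space_prod_topology topspace_eq topspace_prod_topology)
  moreover have "(carrier G \<times> carrier G) \<times> {\<one>} \<subseteq> W"
    using V' by (auto simp: W_def)
  ultimately obtain A B where AB: "openin ?T B" "carrier G \<times> carrier G \<subseteq> A" "\<one> \<in> B" "A \<times> B \<subseteq> W"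
    using tube_lemma_left[of "prod_topology ?T ?T" ?T W "carrier G \<times> carrier G" \<one>] by auto
  have "B \<subseteq> N"
  proof
    fix b assume b: "b \<in> B"
    then have bc: "b \<in> carrier G" using AB(1) openin_subset_carrier by blast
    show "b \<in> N" unfolding N_def
    proof (intro CollectI conjI ballI bc)
      fix u a assume ua: "u \<in> carrier G" "a \<in> carrier G"
      then have "((u, a), b) \<in> W" using AB b by blast
      then show "u \<otimes> a \<in> V \<longleftrightarrow> u \<otimes> b \<otimes> a \<in> V" using V' by (auto simp: W_def)
    qed
  qed
  then have "openin ?T N" using subgroup_openinI[OF sub AB(1,3)] by simp
  with nor NV V(6) show ?thesis using that[of N] by blast
qed

text \<open>By the orbit-stabiliser theorem every orbit has p-power size, so the orbits with more
  than one point contribute a multiple of \<open>p\<close>.\<close>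

lemma (in group_action) card_fixed_points_dvd:
  assumes p: "prime p" and o: "order G = p ^ n" and E: "finite E" "p dvd card E"
  shows "p dvd card {x \<in> E. \<forall>g \<in> carrier G. \<phi> g x = x}"
proof -
  interpret gh: group_hom G "BijGroup E" \<phi> by (rule group_hom)
  define F where "F = {x \<in> E. \<forall>g \<in> carrier G. \<phi> g x = x}"
  define C where "C = {B \<in> orbits G E \<phi>. \<not> card B = 1}"
  have cov: "\<Union>(orbits G E \<phi>) = E" by (rule orbits_coverture)
  have UC: "\<Union>C = E - F"
  proof (intro equalityI subsetI)
    fix x assume "x \<in> \<Union>C"
    then obtain B where B: "B \<in> orbits G E \<phi>" "card B \<noteq> 1" "x \<in> B" by (auto simp: C_def)
    then have xE: "x \<in> E" using cov by auto
    then have "orbit G \<phi> x \<in> orbits G E \<phi>" by (auto simp: orbits_def)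
    then have "B = orbit G \<phi> x" using B disjoint_union orbit_refl[OF xE] by blast
    moreover have "orbit G \<phi> x = {x}" if "x \<in> F"
    proof -
      have "\<phi> \<one> x = x" using that gh.one_closed unfolding F_def by blast
      then show ?thesis using that gh.one_closed unfolding orbit_def F_def by (auto intro!: exI[of _ \<one>] simp del: gh.hom_one)
    qed
    ultimately show "x \<in> E - F" using B xE by auto
  next
    fix x assume x: "x \<in> E - F"
    then obtain g where g: "g \<in> carrier G" "\<phi> g x \<noteq> x" by (auto simp: F_def)
    have xO: "x \<in> orbit G \<phi> x" using orbit_refl x by blast
    moreover have "\<phi> g x \<in> orbit G \<phi> x" using g by (auto simp: orbit_def)
    ultimately have "card (orbit G \<phi> x) \<noteq> 1" using g(2) by (metis card_1_singletonE singletonD)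
    then have "orbit G \<phi> x \<in> C" using x by (auto simp: C_def orbits_def)
    with xO show "x \<in> \<Union>C" by blast
  qed
  have "p dvd card (\<Union>C)"
  proof (rule dvd_partition)
    show "finite (\<Union>C)" using UC E by simp
    show "\<forall>B\<in>C. p dvd card B"
    proof
      fix B assume "B \<in> C"
      then obtain x where x: "x \<in> E" "B = orbit G \<phi> x" "card B \<noteq> 1" by (auto simp: C_def orbits_def)
      have "card B dvd p ^ n" using orbit_stabilizer_theorem[OF x(1)] x(2) o by (metis dvd_triv_left)
      then obtain k where "card B = p ^ k" using divides_primepow_nat[OF p] by blast
      with x(3) show "p dvd card B" by (cases k) auto
    qed
    show "\<forall>c1\<in>C. \<forall>c2\<in>C. c1 \<noteq> c2 \<longrightarrow> c1 \<inter> c2 = {}"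
      using disjoint_union by (auto simp: C_def)
  qed
  then have "p dvd card (E - F)" by (simp add: UC)
  moreover have "card E = card (E - F) + card F"
  proof -
    have "F \<subseteq> E" by (auto simp: F_def)
    with E(1) show ?thesis
      using card_mono[of E F] finite_subset[of F E] by (simp add: card_Diff_subset)
  qed
  ultimately show ?thesis using E by (simp add: F_def dvd_add_right_iff)
qed

text \<open>The fixed points of \<open>M\<close> on its own cosets show that the normaliser of
  \<open>M\<close> is strictly larger, so maximality makes \<open>M\<close> normal. Then the
  centraliser modulo \<open>M\<close> of an element outside \<open>M\<close> is everything.\<close>

lemma (in group) p_group_maximal_commutator:
  assumes p: "prime p" and card: "card (carrier G) = p ^ n"
    and M: "subgroup M G" "M \<noteq> carrier G"
    and max: "\<And>L. subgroup L G \<Longrightarrow> M \<subseteq> L \<Longrightarrow> L = M \<or> L = carrier G"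
    and g: "g \<in> carrier G" and h: "h \<in> carrier G"
  shows "g \<otimes> h \<otimes> inv g \<otimes> inv h \<in> M"
proof -
  have fin: "finite (carrier G)" using card p by (metis card.infinite power_not_zero not_prime_0)
  have Mc: "M \<subseteq> carrier G" using M(1) by (rule subgroup.subset)
  have finM: "finite M" using fin Mc finite_subset by blast
  let ?E = "rcosets M"
  have finE: "finite ?E" using fin by (simp add: RCOSETS_def)
  have lag: "card ?E * card M = p ^ n" using lagrange[OF M(1)] card by (simp add: order_def)
  obtain a where a: "card M = p ^ a" using divides_primepow_nat[OF p] lag by (metis dvd_triv_right)
  have "card ?E \<noteq> 1"
  proof
    assume "card ?E = 1"
    then have "card M = card (carrier G)" using lag card by simp
    then show False using M(2) Mc fin by (metis card_subset_eq)
  qed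
  moreover obtain b where "card ?E = p ^ b" using divides_primepow_nat[OF p] lag by (metis dvd_triv_left)
  ultimately have pE: "p dvd card ?E" by (cases b) auto
  let ?\<phi> = "\<lambda>m. \<lambda>C\<in>?E. C #> inv m"
  have Mm: "m \<in> carrier G" if "m \<in> M" for m using that Mc by blast
  have inE: "C #> m \<in> ?E" if C: "C \<in> ?E" and m: "m \<in> carrier G" for C m
  proof -
    obtain c where c: "c \<in> carrier G" "C = M #> c" using C by (auto simp: RCOSETS_def)
    then have "C #> m = M #> (c \<otimes> m)" using m Mc by (simp add: coset_mult_assoc)
    then show ?thesis using c m Mc by (simp add: rcosetsI)
  qed
  have EC: "C \<subseteq> carrier G" if "C \<in> ?E" for C using that M(1) subgroup.rcosets_carrier is_group by blast
  have bij: "?\<phi> m \<in> Bij ?E" if m: "m \<in> M" for m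
    unfolding Bij_def
  proof (intro IntI CollectI)
    have "bij_betw (\<lambda>C. C #> inv m) ?E ?E"
      by (rule bij_betw_byWitness[where f'="\<lambda>C. C #> m"])
        (use inE Mm m EC in \<open>auto simp: coset_mult_assoc\<close>)
    then show "bij_betw (?\<phi> m) ?E ?E" by (simp add: bij_betw_restrict_eq)
  qed auto
  have gM: "group (G\<lparr>carrier := M\<rparr>)" using M(1) by (rule subgroup_imp_group)
  have "group_action (G\<lparr>carrier := M\<rparr>) ?E ?\<phi>"
    unfolding group_action_def group_hom_def group_hom_axioms_def
  proof (intro conjI gM group_BijGroup homI)
    fix m assume "m \<in> carrier (G\<lparr>carrier := M\<rparr>)"
    then show "?\<phi> m \<in> carrier (BijGroup ?E)" using bij by (simp add: BijGroup_def)
  next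
    fix m k assume "m \<in> carrier (G\<lparr>carrier := M\<rparr>)" "k \<in> carrier (G\<lparr>carrier := M\<rparr>)"
    then have mk: "m \<in> M" "k \<in> M" by auto
    show "?\<phi> (m \<otimes>\<^bsub>G\<lparr>carrier := M\<rparr>\<^esub> k) = ?\<phi> m \<otimes>\<^bsub>BijGroup ?E\<^esub> ?\<phi> k"
      using mk bij[OF mk(1)] bij[OF mk(2)]
      by (auto simp: BijGroup_def compose_def Mm inE coset_mult_assoc EC inv_mult_group intro!: restrict_ext)
  qed
  then interpret act: group_action "G\<lparr>carrier := M\<rparr>" ?E ?\<phi> .
  let ?F = "{C \<in> ?E. \<forall>m \<in> carrier (G\<lparr>carrier := M\<rparr>). ?\<phi> m C = C}"
  have pF: "p dvd card ?F"
    by (rule act.card_fixed_points_dvd[OF p _ finE pE, of a]) (simp add: order_def a)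
  have "M \<in> ?F"
    using M(1) by (auto simp: subgroup.subgroup_in_rcosets is_group coset_join2 Mm subgroup.m_inv_closed)
  \<comment> \<open>\<open>M\<close> is one fixed coset and the number of fixed cosets is divisible
    by \<open>p\<close>, so there is another; its representative normalises
    \<open>M\<close>.\<close>
  have "?F \<noteq> {M}"
  proof
    assume F: "?F = {M}"
    have "p dvd 1" using pF unfolding F by simp
    then show False using p by auto
  qed
  with \<open>M \<in> ?F\<close> obtain C where C: "C \<in> ?F" "C \<noteq> M" by blast
  then obtain c where c: "c \<in> carrier G" "C = M #> c" by (auto simp: RCOSETS_def)
  have cM: "c \<notin> M" using C(2) c M(1) coset_join2 by blast
  have conj_c: "c \<otimes> m \<otimes> inv c \<in> M" if m: "m \<in> M" for m
  proof -
    have "inv m \<in> M" using m M(1) by (simp add: subgroup.m_inv_closed)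
    then have "C #> m = C" using C m by (auto simp: Mm dest: bspec[of _ _ "inv m"])
    then have "M #> (c \<otimes> m) = M #> c" using c m Mc Mm by (simp add: coset_mult_assoc)
    then have "c \<otimes> m \<in> M #> c" using rcos_self[of "c \<otimes> m" M] c m Mm M(1) by auto
    then show ?thesis using subgroup.rcos_module_imp[OF M(1) is_group c(1)] c m Mm by auto
  qed
  \<comment> \<open>The normaliser of \<open>M\<close>. Stated as an equivalence, it is closed under
    inverses without any finiteness argument.\<close>
  define L where "L = {h \<in> carrier G. \<forall>m \<in> carrier G. m \<in> M \<longleftrightarrow> h \<otimes> m \<otimes> inv h \<in> M}"
  have "subgroup L G"
  proof (rule subgroup.intro)
    show "L \<subseteq> carrier G" by (auto simp: L_def)
    show "\<one> \<in> L" by (auto simp: L_def)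
    fix u assume u: "u \<in> L"
    have uc: "u \<in> carrier G" using u by (simp add: L_def)
    have u': "m \<in> M \<longleftrightarrow> u \<otimes> (m \<otimes> inv u) \<in> M" if "m \<in> carrier G" for m
      using u that by (simp add: L_def m_assoc)
    show "inv u \<in> L"
      using uc u'[of "inv u \<otimes> (_ \<otimes> u)"] by (auto simp: L_def word_simps)
    fix v assume v: "v \<in> L"
    have vc: "v \<in> carrier G" using v by (simp add: L_def)
    have v': "m \<in> M \<longleftrightarrow> v \<otimes> (m \<otimes> inv v) \<in> M" if "m \<in> carrier G" for m
      using v that by (simp add: L_def m_assoc)
    show "u \<otimes> v \<in> L"
      using uc vc v' u'[of "v \<otimes> (_ \<otimes> inv v)"] by (auto simp: L_def word_simps)
  qed
  moreover have conjM: "u \<otimes> m \<otimes> inv u \<in> M" if "u \<in> M" "m \<in> M" for u m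
    using that M(1) by (simp add: subgroup.m_closed subgroup.m_inv_closed)
  have "M \<subseteq> L"
  proof
    fix u assume u: "u \<in> M"
    have "m \<in> M" if "m \<in> carrier G" "u \<otimes> m \<otimes> inv u \<in> M" for m
    proof -
      have "inv u \<otimes> (u \<otimes> m \<otimes> inv u) \<otimes> inv (inv u) \<in> M"
        by (rule conjM[OF subgroup.m_inv_closed[OF M(1) u] that(2)])
      then show ?thesis using that u Mm by (simp add: word_simps)
    qed
    then show "u \<in> L" unfolding L_def using conjM[OF u] Mm[OF u] by blast
  qed
  moreover have "c \<in> L"
  proof -
    have "inj_on (\<lambda>m. c \<otimes> m \<otimes> inv c) M"
      using c Mm by (auto simp: inj_on_def)
    then have "(\<lambda>m. c \<otimes> m \<otimes> inv c) ` M = M"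
      using conj_c finM by (intro endo_inj_surj) auto
    then have "m \<in> M" if mc: "m \<in> carrier G" and cm: "c \<otimes> m \<otimes> inv c \<in> M" for m
    proof -
      have "c \<otimes> m \<otimes> inv c \<in> (\<lambda>m. c \<otimes> m \<otimes> inv c) ` M" using \<open>_ ` M = M\<close> cm by simp
      then obtain m' where "m' \<in> M" "c \<otimes> m \<otimes> inv c = c \<otimes> m' \<otimes> inv c" by blast
      then show ?thesis using mc c Mm by auto
    qed
    then show ?thesis unfolding L_def using conj_c c(1) by blast
  qed
  ultimately have "L = carrier G" using max cM by blast
  then have nor: "u \<otimes> m \<otimes> inv u \<in> M" if "u \<in> carrier G" "m \<in> M" for u m
    using that Mm unfolding L_def by blast
  have Mmult: "u \<otimes> v \<in> M" if "u \<in> M" "v \<in> M" for u v using that M(1) by (simp add: subgroup.m_closed)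
  have Minv: "inv u \<in> M" if "u \<in> M" for u using that M(1) by (simp add: subgroup.m_inv_closed)
  show ?thesis
  proof (cases "g \<in> M")
    case True
    have "g \<otimes> (h \<otimes> inv g \<otimes> inv h) \<in> M" by (rule Mmult[OF True nor[OF h Minv[OF True]]])
    then show ?thesis using g h by (simp add: word_simps)
  next
    case False
    \<comment> \<open>The centraliser of \<open>g\<close> modulo \<open>M\<close>. It contains
      \<open>M\<close> because \<open>M\<close> is normal, and it contains \<open>g\<close>, which
      lies outside \<open>M\<close>.\<close>
    define Z where "Z = {u \<in> carrier G. g \<otimes> u \<otimes> inv g \<otimes> inv u \<in> M}"
    have "subgroup Z G"
    proof (rule subgroup.intro)
      show "Z \<subseteq> carrier G" by (auto simp: Z_def)
      show "\<one> \<in> Z" using g M(1) by (auto simp: Z_def subgroup.one_closed)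
      fix u assume u: "u \<in> Z"
      have uc: "u \<in> carrier G" and uM: "g \<otimes> u \<otimes> inv g \<otimes> inv u \<in> M" using u by (auto simp: Z_def)
      have "inv u \<otimes> inv (g \<otimes> u \<otimes> inv g \<otimes> inv u) \<otimes> inv (inv u) \<in> M"
        by (rule nor[OF inv_closed[OF uc] Minv[OF uM]])
      then show "inv u \<in> Z" using u g by (auto simp: Z_def word_simps)
      fix v assume v: "v \<in> Z"
      have "(g \<otimes> u \<otimes> inv g \<otimes> inv u) \<otimes> (u \<otimes> (g \<otimes> v \<otimes> inv g \<otimes> inv v) \<otimes> inv u) \<in> M"
        using v by (intro Mmult[OF uM nor[OF uc]]) (auto simp: Z_def)
      then show "u \<otimes> v \<in> Z" using u v g by (auto simp: Z_def word_simps)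
    qed
    moreover have "M \<subseteq> Z"
      unfolding Z_def using nor[OF g] Mmult Minv Mm by blast
    moreover have "g \<in> Z" using g M(1) by (auto simp: Z_def word_simps subgroup.one_closed)
    ultimately have "Z = carrier G" using max False by blast
    then show ?thesis using h by (auto simp: Z_def)
  qed
qed

section \<open>Extending maps from free pro-p groups\<close>

text \<open>Continuity into a discrete space, with neither a topology nor a carrier on the target,
  so that finite quotients can be treated as plain groups.\<close>

definition locally_constant :: "'a topology \<Rightarrow> ('a \<Rightarrow> 'b) \<Rightarrow> bool" where
  "locally_constant T f \<longleftrightarrow> (\<forall>a. openin T {g \<in> topspace T. f g = a})"

lemma locally_constant_openin:
  assumes "locally_constant T f" shows "openin T {g \<in> topspace T. P (f g)}"
proof -
  have "{g \<in> topspace T. P (f g)} = (\<Union>a \<in> {a. P a}. {g \<in> topspace T. f g = a})" by auto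
  also have "openin T \<dots>" using assms by (intro openin_Union) (auto simp: locally_constant_def)
  finally show ?thesis .
qed

lemma locally_constant_compose: "locally_constant T f \<Longrightarrow> locally_constant T (\<lambda>g. h (f g))"
  unfolding locally_constant_def[of _ "\<lambda>g. h (f g)"] by (intro allI locally_constant_openin)

lemma locally_constant_pair:
  assumes "locally_constant T f" "locally_constant T h"
  shows "locally_constant T (\<lambda>g. (f g, h g))"
  unfolding locally_constant_def
proof
  fix c :: "'b \<times> 'c"
  have "{g \<in> topspace T. (f g, h g) = c} = {g \<in> topspace T. f g = fst c} \<inter> {g \<in> topspace T. h g = snd c}"
    by auto
  then show "openin T {g \<in> topspace T. (f g, h g) = c}"
    using assms by (auto simp: locally_constant_def)
qed

lemma locally_constant_compose2:
  "locally_constant T f \<Longrightarrow> locally_constant T h \<Longrightarrow> locally_constant T (\<lambda>g. k (f g) (h g))"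
  using locally_constant_compose[OF locally_constant_pair, of T f h "\<lambda>(a, b). k a b"] by simp

lemma locally_constant_continuous:
  assumes "locally_constant T f" "continuous_map S T k" shows "locally_constant S (\<lambda>g. f (k g))"
  unfolding locally_constant_def
proof
  fix a
  have "openin S {g \<in> topspace S. k g \<in> {b \<in> topspace T. f b = a}}"
    using assms by (intro openin_continuous_map_preimage) (auto simp: locally_constant_def)
  moreover have "{g \<in> topspace S. k g \<in> {b \<in> topspace T. f b = a}} = {g \<in> topspace S. f (k g) = a}"
    using assms(2) by (auto simp: continuous_map_def)
  ultimately show "openin S {g \<in> topspace S. f (k g) = a}" by simp
qed

lemma locally_constant_cong:
  assumes "locally_constant T f" "\<And>g. g \<in> topspace T \<Longrightarrow> f g = h g" shows "locally_constant T h"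
  unfolding locally_constant_def
proof
  fix a
  have "{g \<in> topspace T. h g = a} = {g \<in> topspace T. f g = a}" using assms(2) by auto
  then show "openin T {g \<in> topspace T. h g = a}" using assms(1) by (simp add: locally_constant_def)
qed

lemma card_rcosets_power:
  assumes p: "prime p" and "group P" "card (carrier P) = p ^ n" "subgroup N P"
  shows "\<exists>k. card (rcosets\<^bsub>P\<^esub> N) = p ^ k"
proof -
  have "card (rcosets\<^bsub>P\<^esub> N) * card N = p ^ n"
    using group.lagrange[OF assms(2,4)] assms(3) by (simp add: order_def)
  then show ?thesis using divides_primepow_nat[OF p] by (metis dvd_triv_left)
qed

section \<open>Moving pro-p groups to other types\<close>

lemma pro_p_group_iso:
  fixes G :: "'a tgroup" (structure) and G' :: "'b tgroup"
  assumes G: "pro_p_group p G" and G': "group G'" "topspace (topo G') = carrier G'"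
    and i: "i \<in> iso G G'" and hom: "homeomorphic_map (topo G) (topo G') i"
  shows "pro_p_group p G'"
proof -
  have tg: "topological_group G" and cpt: "compact_space (topo G)" and haus: "Hausdorff_space (topo G)"
    and td: "\<And>C. connectedin (topo G) C \<Longrightarrow> \<exists>a. C \<subseteq> {a}"
    and idx: "\<And>N. N \<lhd> G \<Longrightarrow> openin (topo G) N \<Longrightarrow> \<exists>k. card (rcosets\<^bsub>G\<^esub> N) = p ^ k"
    using G by (auto simp: pro_p_group_def profinite_group_def)
  interpret top_group G using tg by (rule top_groupI)
  interpret H: group G' by (rule G')
  interpret gh: group_hom G G' i
    using i by (simp add: group_hom_def group_hom_axioms_def iso_def is_group G')
  obtain j where j: "homeomorphic_maps (topo G) (topo G') i j"
    using hom by (auto simp: homeomorphic_map_maps)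
  have ji: "j (i a) = a" if "a \<in> carrier G" for a using j that by (auto simp: homeomorphic_maps_def)
  have ij: "i (j b) = b" if "b \<in> carrier G'" for b using j that G' by (auto simp: homeomorphic_maps_def)
  have jc: "j b \<in> carrier G" if "b \<in> carrier G'" for b
    using j that G' by (auto simp: homeomorphic_maps_def continuous_map_def)
  have contj: "continuous_map (topo G') (topo G) j" and conti: "continuous_map (topo G) (topo G') i"
    using j by (auto simp: homeomorphic_maps_def)
  have jmult: "j (a \<otimes>\<^bsub>G'\<^esub> b) = j a \<otimes> j b" if "a \<in> carrier G'" "b \<in> carrier G'" for a b
    using that by (metis gh.hom_mult ij jc ji m_closed)
  have jinv: "j (inv\<^bsub>G'\<^esub> a) = inv (j a)" if "a \<in> carrier G'" for a
    using that by (metis gh.hom_inv ij jc ji inv_closed)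
  have "continuous_map (prod_topology (topo G') (topo G')) (topo G') (\<lambda>(x, y). x \<otimes>\<^bsub>G'\<^esub> y)"
  proof (rule continuous_map_eq)
    show "continuous_map (prod_topology (topo G') (topo G')) (topo G') (i \<circ> (\<lambda>z. j (fst z) \<otimes> j (snd z)))"
      by (rule continuous_map_compose[OF continuous_map_mult conti])
        (intro continuous_map_compose[OF continuous_map_fst contj, unfolded o_def]
          continuous_map_compose[OF continuous_map_snd contj, unfolded o_def])+
    fix z assume "z \<in> topspace (prod_topology (topo G') (topo G'))"
    then show "(i \<circ> (\<lambda>z. j (fst z) \<otimes> j (snd z))) z = (case z of (x, y) \<Rightarrow> x \<otimes>\<^bsub>G'\<^esub> y)"
      using G' by (auto simp: ij jc)
  qed
  moreover have "continuous_map (topo G') (topo G') (\<lambda>x. inv\<^bsub>G'\<^esub> x)"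
  proof (rule continuous_map_eq)
    show "continuous_map (topo G') (topo G') (i \<circ> (\<lambda>z. inv (j z)))"
      by (rule continuous_map_compose[OF continuous_map_inv[OF contj] conti])
    fix z assume "z \<in> topspace (topo G')"
    then show "(i \<circ> (\<lambda>z. inv (j z))) z = inv\<^bsub>G'\<^esub> z"
      using G' by (auto simp: ij jc)
  qed
  ultimately have tg': "topological_group G'" using G' by (simp add: topological_group_def)
  have home: "topo G homeomorphic_space topo G'" using j by (auto simp: homeomorphic_space_def)
  have cpt': "compact_space (topo G')" "Hausdorff_space (topo G')"
    using cpt haus homeomorphic_compact_space[OF home] homeomorphic_Hausdorff_space[OF home] by auto
  have td': "\<exists>a. C \<subseteq> {a}" if C: "connectedin (topo G') C" for C
  proof -
    have "connectedin (topo G) (j ` C)" using C contj connectedin_continuous_map_image by blast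
    then obtain a where a: "j ` C \<subseteq> {a}" using td by blast
    have "C \<subseteq> carrier G'" using C G' connectedin_subset_topspace by blast
    then have "C \<subseteq> {i a}" using a ij by force
    then show ?thesis by blast
  qed
  have idx': "\<exists>k. card (rcosets\<^bsub>G'\<^esub> N) = p ^ k" if N: "N \<lhd> G'" "openin (topo G') N" for N
  proof -
    let ?M = "{a \<in> carrier G. i a \<in> N}"
    interpret N: normal N G' by (rule N)
    have Nc: "N \<subseteq> carrier G'" by (rule N.subset)
    have "openin (topo G) ?M" using openin_continuous_map_preimage[OF conti N(2)] by simp
    moreover have "?M \<lhd> G"
    proof (rule normal_invI)
      show "subgroup ?M G" by (rule subgroup.intro) auto
      show "x \<otimes> h \<otimes> inv x \<in> ?M" if "x \<in> carrier G" "h \<in> ?M" for x h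
        using that by (auto intro: N.inv_op_closed2)
    qed
    ultimately obtain k where k: "card (rcosets ?M) = p ^ k" using idx by blast
    have im: "i ` (?M #> a) = N #>\<^bsub>G'\<^esub> i a" if a: "a \<in> carrier G" for a
    proof (intro equalityI subsetI)
      fix z assume "z \<in> i ` (?M #> a)"
      then show "z \<in> N #>\<^bsub>G'\<^esub> i a" using a by (auto simp: r_coset_def)
    next
      fix z assume "z \<in> N #>\<^bsub>G'\<^esub> i a"
      then obtain n where n: "n \<in> N" "z = n \<otimes>\<^bsub>G'\<^esub> i a" by (auto simp: r_coset_def)
      then have "z = i (j n \<otimes> a)" "j n \<in> ?M" using Nc a by (auto simp: ij jc subset_iff)
      moreover have "j n \<otimes> a \<in> ?M #> a" using \<open>j n \<in> ?M\<close> unfolding r_coset_def by blast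
      ultimately show "z \<in> i ` (?M #> a)" by blast
    qed
    have "rcosets\<^bsub>G'\<^esub> N = (`) i ` (rcosets ?M)"
    proof (intro equalityI subsetI)
      fix C assume "C \<in> rcosets\<^bsub>G'\<^esub> N"
      then obtain b where b: "b \<in> carrier G'" "C = N #>\<^bsub>G'\<^esub> b" by (auto simp: RCOSETS_def)
      then have "C = i ` (?M #> j b)" using im[OF jc] ij by simp
      moreover have "?M #> j b \<in> rcosets ?M" using jc[OF b(1)] unfolding RCOSETS_def by blast
      ultimately show "C \<in> (`) i ` (rcosets ?M)" by blast
    next
      fix C assume "C \<in> (`) i ` (rcosets ?M)"
      then obtain a where a: "a \<in> carrier G" "C = i ` (?M #> a)" by (auto simp: RCOSETS_def)
      then show "C \<in> rcosets\<^bsub>G'\<^esub> N" using im by (auto simp: RCOSETS_def)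
    qed
    moreover have "inj_on ((`) i) (rcosets ?M)"
    proof (rule inj_on_subset)
      show "inj_on ((`) i) (Pow (carrier G))"
        by (rule inj_on_image_Pow) (auto intro: inj_on_inverseI[of _ j] simp: ji)
      show "rcosets ?M \<subseteq> Pow (carrier G)" by (auto simp: RCOSETS_def r_coset_def)
    qed
    ultimately show ?thesis using k by (metis card_image)
  qed
  show ?thesis
    using tg' cpt' td' idx' by (auto simp: pro_p_group_def profinite_group_def)
qed

text \<open>The universal property in \<open>free_pro_p_on\<close> only speaks of test groups on
  \<open>'a + nat\<close>; any other target is first copied there along an injection.\<close>

definition transport_tgroup :: "('b \<Rightarrow> 'c) \<Rightarrow> 'b tgroup \<Rightarrow> 'c tgroup" where
  "transport_tgroup i G = (let j = inv_into (carrier G) i in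
     \<lparr>carrier = i ` carrier G, mult = (\<lambda>a b. i (j a \<otimes>\<^bsub>G\<^esub> j b)), one = i \<one>\<^bsub>G\<^esub>,
      topo = pullback_topology (i ` carrier G) j (topo G)\<rparr>)"

lemma transport_tgroup:
  fixes G :: "'a tgroup" (structure)
  assumes G: "pro_p_group p G" and i: "inj_on i (carrier G)"
  shows "pro_p_group p (transport_tgroup i G)"
    and "i \<in> iso G (transport_tgroup i G)"
    and "homeomorphic_maps (topo G) (topo (transport_tgroup i G)) i (inv_into (carrier G) i)"
proof -
  let ?G' = "transport_tgroup i G" and ?j = "inv_into (carrier G) i"
  interpret top_group G using G by (auto simp: pro_p_group_def profinite_group_def intro: top_groupI)
  have ji: "?j (i a) = a" if "a \<in> carrier G" for a using that i by simp
  have c: "carrier ?G' = i ` carrier G" and m: "mult ?G' = (\<lambda>a b. i (?j a \<otimes> ?j b))"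
    and one: "one ?G' = i \<one>" and t: "topo ?G' = pullback_topology (i ` carrier G) ?j (topo G)"
    by (simp_all add: transport_tgroup_def Let_def)
  have grp: "group ?G'"
  proof (rule groupI)
    fix a assume "a \<in> carrier ?G'"
    then obtain x where "x \<in> carrier G" "a = i x" by (auto simp: c)
    then show "\<exists>y\<in>carrier ?G'. y \<otimes>\<^bsub>?G'\<^esub> a = \<one>\<^bsub>?G'\<^esub>"
      by (auto simp: c m one ji intro!: bexI[of _ "inv x"])
  qed (auto simp: c m one ji m_assoc)
  show iso: "i \<in> iso G ?G'"
    using i by (auto simp: iso_def hom_def c m ji bij_betw_def)
  have ts: "topspace (topo ?G') = carrier ?G'"
    using ji by (auto simp: t c topspace_pullback_topology)
  show hm: "homeomorphic_maps (topo G) (topo ?G') i ?j"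
    unfolding homeomorphic_maps_def
  proof (intro conjI ballI)
    show "continuous_map (topo ?G') (topo G) ?j"
      using continuous_map_pullback[of "topo G" "topo G" id "i ` carrier G" ?j] by (simp add: t)
    show "continuous_map (topo G) (topo ?G') i"
      unfolding t
    proof (rule continuous_map_pullback')
      show "continuous_map (topo G) (topo G) (?j \<circ> i)"
        by (rule continuous_map_eq[of _ _ id]) (auto simp: ji)
    qed auto
    show "?j (i a) = a" if "a \<in> topspace (topo G)" for a using that ji by simp
    show "i (?j b) = b" if "b \<in> topspace (topo ?G')" for b
      using that ts ji by (auto simp: c)
  qed
  then have "homeomorphic_map (topo G) (topo ?G') i" by (auto simp: homeomorphic_map_maps)
  then show "pro_p_group p ?G'" using pro_p_group_iso[OF G grp ts iso] by blast
qed

text \<open>Extend into the copy of \<open>H\<close> and come back. Two injections will be used: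
  \<open>Inr\<close> for finite groups and \<open>Inl\<close> for the free group itself.\<close>

lemma free_pro_p_extend:
  fixes F :: "'a tgroup" and H :: "'b tgroup" and i :: "'b \<Rightarrow> 'a + nat"
  assumes F: "free_pro_p_on p F X" and H: "pro_p_group p H" and i: "inj_on i (carrier H)"
    and \<phi>: "\<phi> \<in> X \<rightarrow> carrier H" "converges_to_one X \<phi> H"
  obtains h where "h \<in> hom F H" "continuous_map (topo F) (topo H) h" "\<And>x. x \<in> X \<Longrightarrow> h x = \<phi> x"
proof -
  let ?H = "transport_tgroup i H" and ?j = "inv_into (carrier H) i"
  note tr = transport_tgroup[OF H i]
  have ts: "topspace (topo H) = carrier H" and gH: "group H"
    using H by (auto simp: pro_p_group_def profinite_group_def topological_group_def)
  have gH': "group ?H" using tr(1)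
    by (auto simp: pro_p_group_def profinite_group_def topological_group_def)
  have ci: "continuous_map (topo H) (topo ?H) i" and cj: "continuous_map (topo ?H) (topo H) ?j"
    using tr(3) by (auto simp: homeomorphic_maps_def)
  have ji: "?j (i a) = a" if "a \<in> carrier H" for a using that i by simp
  have ih: "i \<in> hom H ?H" using tr(2) by (simp add: iso_def)
  have "i \<circ> \<phi> \<in> X \<rightarrow> carrier ?H" using \<phi>(1) ih by (auto simp: hom_def)
  moreover have "converges_to_one X (i \<circ> \<phi>) ?H"
    unfolding converges_to_one_def
  proof (intro allI impI)
    fix U assume U: "openin (topo ?H) U \<and> \<one>\<^bsub>?H\<^esub> \<in> U"
    let ?V = "{a \<in> topspace (topo H). i a \<in> U}"
    have "openin (topo H) ?V" using U ci openin_continuous_map_preimage by blast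
    moreover have "\<one>\<^bsub>H\<^esub> \<in> ?V"
      using U ts gH gH' ih by (simp add: hom_one[of i H ?H] group.is_monoid monoid.one_closed)
    ultimately have "finite {x \<in> X. \<phi> x \<notin> ?V}" using \<phi>(2) by (auto simp: converges_to_one_def)
    then show "finite {x \<in> X. (i \<circ> \<phi>) x \<notin> U}"
      by (rule finite_subset[rotated]) (use \<phi>(1) ts in auto)
  qed
  ultimately obtain h where h: "h \<in> hom F ?H" "continuous_map (topo F) (topo ?H) h" "\<And>x. x \<in> X \<Longrightarrow> h x = i (\<phi> x)"
    using F tr(1) unfolding free_pro_p_on_def by (metis comp_apply)
  have "?j \<in> iso ?H H"
    using group.iso_set_sym[OF gH tr(2)] .
  then have "?j \<circ> h \<in> hom F H" using h(1) by (auto simp: iso_def intro: Group.hom_compose)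
  moreover have "continuous_map (topo F) (topo H) (?j \<circ> h)" using h(2) cj continuous_map_compose by blast
  moreover have "(?j \<circ> h) x = \<phi> x" if "x \<in> X" for x using h(3) that \<phi>(1) ji by auto
  ultimately show ?thesis by (rule that)
qed

definition discrete_tgroup :: "('b, 'c) monoid_scheme \<Rightarrow> 'b tgroup" where
  "discrete_tgroup P = \<lparr>carrier = carrier P, mult = mult P, one = one P,
     topo = discrete_topology (carrier P)\<rparr>"

lemma discrete_tgroup_simps [simp]:
  "carrier (discrete_tgroup P) = carrier P" "mult (discrete_tgroup P) = mult P"
  "one (discrete_tgroup P) = one P" "topo (discrete_tgroup P) = discrete_topology (carrier P)"
  by (simp_all add: discrete_tgroup_def)

lemma pro_p_discrete_tgroup:
  fixes P (structure)
  assumes p: "prime p" and P: "group P" and card: "card (carrier P) = p ^ n"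
  shows "pro_p_group p (discrete_tgroup P)"
proof -
  let ?D = "discrete_tgroup P"
  interpret group P by (rule P)
  have fin: "finite (carrier P)" using card p by (metis card.infinite power_not_zero not_prime_0)
  have gD: "group ?D"
    by (rule groupI) (auto simp: m_assoc intro!: bexI[of _ "inv _"])
  have invD: "inv\<^bsub>?D\<^esub> x = inv x" for x by (simp add: m_inv_def)
  have "topological_group ?D"
    using gD by (auto simp: topological_group_def invD continuous_map_from_discrete_topology
        simp flip: prod_topology_discrete_topology)
  moreover have "\<exists>k. card (rcosets\<^bsub>?D\<^esub> N) = p ^ k" if "N \<lhd> ?D" for N
    using card_rcosets_power[OF p gD _ normal_imp_subgroup[OF that]] card by simp
  ultimately show ?thesis
    using fin by (auto simp: pro_p_group_def profinite_group_def compact_space_discrete_topology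
        connectedin_discrete_topology)
qed

lemma free_pro_p_extend_finite:
  fixes F :: "'a tgroup" and P :: "('b, 'c) monoid_scheme"
  assumes F: "free_pro_p_on p F X" and p: "prime p" and P: "group P" "card (carrier P) = p ^ n"
    and \<phi>: "\<phi> \<in> X \<rightarrow> carrier P" "finite {x \<in> X. \<phi> x \<noteq> \<one>\<^bsub>P\<^esub>}"
  obtains h where "h \<in> hom F P" "locally_constant (topo F) h"
    "\<And>x. x \<in> X \<Longrightarrow> h x = \<phi> x"
proof -
  have fin: "finite (carrier P)" using P(2) p by (metis card.infinite power_not_zero not_prime_0)
  then obtain f :: "'b \<Rightarrow> nat" where f: "inj_on f (carrier P)"
    using finite_imp_inj_to_nat_seg by blast
  then have i: "inj_on (\<lambda>a. Inr (f a) :: 'a + nat) (carrier (discrete_tgroup P))"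
    by (auto simp: inj_on_def)
  have conv: "converges_to_one X \<phi> (discrete_tgroup P)"
    unfolding converges_to_one_def
  proof (intro allI impI)
    fix U assume "openin (topo (discrete_tgroup P)) U \<and> \<one>\<^bsub>discrete_tgroup P\<^esub> \<in> U"
    then have "{x \<in> X. \<phi> x \<notin> U} \<subseteq> {x \<in> X. \<phi> x \<noteq> \<one>\<^bsub>P\<^esub>}" by auto
    then show "finite {x \<in> X. \<phi> x \<notin> U}" using \<phi>(2) finite_subset by blast
  qed
  obtain h where h: "h \<in> hom F (discrete_tgroup P)" "continuous_map (topo F) (discrete_topology (carrier P)) h"
      "\<And>x. x \<in> X \<Longrightarrow> h x = \<phi> x"
    using free_pro_p_extend[OF F pro_p_discrete_tgroup[OF p P] i _ conv] \<phi>(1) by auto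
  have ts: "topspace (topo F) = carrier F"
    using F by (auto simp: free_pro_p_on_def pro_p_group_def profinite_group_def topological_group_def)
  have "openin (topo F) {g \<in> carrier F. h g = a}" for a
  proof (cases "a \<in> carrier P")
    case True
    then have "openin (topo F) {g \<in> topspace (topo F). h g \<in> {a}}"
      using h(2) by (intro openin_continuous_map_preimage) auto
    then show ?thesis using ts by simp
  next
    case False
    then have "{g \<in> carrier F. h g = a} = {}" using h(1) by (auto simp: hom_def)
    then show ?thesis by (simp only: openin_empty)
  qed
  then have "locally_constant (topo F) h" by (simp add: locally_constant_def ts)
  then show ?thesis using h by (intro that[of h]) (auto simp: hom_def)
qed

text \<open>The equaliser of two locally constant homomorphisms is an open subgroup.\<close>

lemma (in top_group) hom_eq_on_generators:
  assumes X: "top_generates G X" and P: "group P"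
    and f: "f \<in> hom G P" "locally_constant (topo G) f"
    and h: "h \<in> hom G P" "locally_constant (topo G) h"
    and eq: "\<And>x. x \<in> X \<Longrightarrow> f x = h x" and g: "g \<in> carrier G"
  shows "f g = h g"
proof -
  interpret f: group_hom G P f using f(1) P is_group by (simp add: group_hom_def group_hom_axioms_def)
  interpret h: group_hom G P h using h(1) P is_group by (simp add: group_hom_def group_hom_axioms_def)
  let ?E = "{g \<in> carrier G. f g = h g}"
  have "subgroup ?E G" by (rule subgroup.intro) auto
  moreover have "openin (topo G) ?E"
    using locally_constant_openin[OF locally_constant_pair[OF f(2) h(2)], of "\<lambda>c. fst c = snd c"] by simp
  moreover have "X \<subseteq> ?E" using eq X by (auto simp: top_generates_def)
  ultimately have "?E = carrier G" by (rule top_generates_open_subgroup[OF X])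
  then show ?thesis using g by blast
qed

text \<open>Count homomorphisms to the cyclic group of order \<open>p\<close>. Freeness provides
  \<open>p ^ card Y\<close> of them that differ on a finite \<open>Y \<subseteq> X\<close>, while
  two generators allow at most \<open>p ^ 2\<close>. So the basis, which could a priori be infinite,
  has at most two elements, and minimality excludes fewer.\<close>

lemma free_pro_p_rank_two:
  assumes F: "free_pro_p_on p F X" and p: "prime p" and two: "min_gens F = 2"
  obtains x y where "X = {x, y}" "x \<noteq> y"
proof -
  interpret top_group F
    using F by (auto simp: free_pro_p_on_def pro_p_group_def profinite_group_def intro: top_groupI)
  have gX: "top_generates F X" using F by (simp add: free_pro_p_on_def)
  let ?\<S> = "{S. finite S \<and> top_generates F S}"
  \<comment> \<open>The infimum of the empty set is the top element of \<open>enat\<close>; the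
    value 2 therefore comes from an actual finite generating set.\<close>
  have "(\<lambda>S. enat (card S)) ` ?\<S> \<noteq> {}"
  proof
    assume "(\<lambda>S. enat (card S)) ` ?\<S> = {}"
    then have "min_gens F = Inf {}" unfolding min_gens_def by (simp only:)
    then show False using two by (simp add: top_enat_def numeral_eq_enat)
  qed
  then have "min_gens F \<in> (\<lambda>S. enat (card S)) ` ?\<S>"
    unfolding min_gens_def by (metis ex_in_conv wellorder_InfI)
  then obtain S where S: "finite S" "top_generates F S" "card S = 2"
    using two by (auto simp: numeral_eq_enat)
  let ?Z = "integer_mod_group p"
  have p1: "p > 1" using p prime_gt_1_nat by blast
  have cZ: "carrier ?Z = {0..<int p}" using p1 by (simp add: carrier_integer_mod_group)
  have cardZ: "card (carrier ?Z) = p ^ 1" by (simp add: cZ)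
  have bd: "card Y \<le> 2" if Y: "Y \<subseteq> X" "finite Y" for Y
  proof -
    have "\<exists>h. h \<in> hom F ?Z \<and> locally_constant (topo F) h \<and> (\<forall>x \<in> Y. h x = f x)"
      if f: "f \<in> Y \<rightarrow>\<^sub>E carrier ?Z" for f
    proof -
      let ?\<phi> = "\<lambda>x. if x \<in> Y then f x else 0"
      have "?\<phi> \<in> X \<rightarrow> carrier ?Z" using f p1 by (auto simp: cZ PiE_def Pi_def)
      moreover have "finite {x \<in> X. ?\<phi> x \<noteq> \<one>\<^bsub>?Z\<^esub>}" by (rule finite_subset[OF _ Y(2)]) auto
      ultimately obtain h where "h \<in> hom F ?Z" "locally_constant (topo F) h"
          "\<And>x. x \<in> X \<Longrightarrow> h x = ?\<phi> x"
        using free_pro_p_extend_finite[OF F p group_integer_mod_group cardZ] by blast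
      then show ?thesis using Y(1) by (intro exI[of _ h]) (auto simp: subset_iff)
    qed
    then obtain h where h: "\<And>f. f \<in> Y \<rightarrow>\<^sub>E carrier ?Z \<Longrightarrow> h f \<in> hom F ?Z \<and>
        locally_constant (topo F) (h f) \<and> (\<forall>x \<in> Y. h f x = f x)"
      by metis
    have Sc: "S \<subseteq> carrier F" and Xc: "X \<subseteq> carrier F" using S(2) gX by (auto simp: top_generates_def)
    have "inj_on (\<lambda>f. restrict (h f) S) (Y \<rightarrow>\<^sub>E carrier ?Z)"
    proof (rule inj_onI)
      fix f f' assume f: "f \<in> Y \<rightarrow>\<^sub>E carrier ?Z" "f' \<in> Y \<rightarrow>\<^sub>E carrier ?Z" "restrict (h f) S = restrict (h f') S"
      then have eqS: "h f x = h f' x" if "x \<in> S" for x using that by (metis restrict_apply')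
      have "h f g = h f' g" if "g \<in> carrier F" for g
        by (rule hom_eq_on_generators[OF S(2) group_integer_mod_group _ _ _ _ eqS that])
          (use h f in auto)
      then have "f x = f' x" if "x \<in> Y" for x using that h f Y Xc by (metis subsetD)
      then show "f = f'" using f by (auto intro: PiE_ext)
    qed
    moreover have "(\<lambda>f. restrict (h f) S) ` (Y \<rightarrow>\<^sub>E carrier ?Z) \<subseteq> S \<rightarrow>\<^sub>E carrier ?Z"
    proof
      fix z assume "z \<in> (\<lambda>f. restrict (h f) S) ` (Y \<rightarrow>\<^sub>E carrier ?Z)"
      then obtain f where f: "f \<in> Y \<rightarrow>\<^sub>E carrier ?Z" "z = restrict (h f) S" by blast
      then have "h f \<in> carrier F \<rightarrow> carrier ?Z" using h by (auto simp: hom_def)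
      then show "z \<in> S \<rightarrow>\<^sub>E carrier ?Z" using f Sc by (auto simp: PiE_def Pi_def)
    qed
    moreover have "finite (S \<rightarrow>\<^sub>E carrier ?Z)" using S(1) by (intro finite_PiE) (auto simp: cZ)
    ultimately have "card (Y \<rightarrow>\<^sub>E carrier ?Z) \<le> card (S \<rightarrow>\<^sub>E carrier ?Z)" using card_inj_on_le by blast
    then have "p ^ card Y \<le> p ^ card S" using S(1) Y(2) by (simp add: card_PiE cZ)
    then show ?thesis using p1 S(3) by (simp add: power_increasing_iff)
  qed
  have X: "finite X \<and> card X \<le> 2" by (rule finite_if_finite_subsets_card_bdd) (use bd in blast)
  then have "min_gens F \<le> enat (card X)"
    unfolding min_gens_def using gX by (intro INF_lower) auto
  then have "card X = 2" using two X by (simp add: numeral_eq_enat)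
  then show ?thesis using that by (metis card_2_iff)
qed

section \<open>Pro-p groups and the Frattini subgroup\<close>

lemma (in group_hom) subgroup_preimage:
  assumes "subgroup L H" shows "subgroup {g \<in> carrier G. h g \<in> L} G"
proof -
  interpret L: subgroup L H by (rule assms)
  show ?thesis by (rule subgroup.intro) auto
qed

lemma (in top_group) locally_constant_rcoset:
  assumes N: "subgroup N G" "openin (topo G) N"
  shows "locally_constant (topo G) (\<lambda>g. N #> g)"
  unfolding locally_constant_def
proof
  fix C
  show "openin (topo G) {g \<in> topspace (topo G). N #> g = C}"
  proof (cases "\<exists>a \<in> carrier G. N #> a = C")
    case True
    then obtain a where a: "a \<in> carrier G" "C = N #> a" by blast
    have Na: "N #> a \<subseteq> carrier G" using a(1) by (rule r_coset_subset_G[OF subgroup.subset[OF N(1)]])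
    have "{g \<in> topspace (topo G). N #> g = C} = N #> a"
    proof (intro equalityI subsetI)
      fix g assume "g \<in> {g \<in> topspace (topo G). N #> g = C}"
      then have "g \<in> carrier G" "N #> g = N #> a" using a(2) by simp_all
      then show "g \<in> N #> a" using rcos_self[OF _ N(1), of g] by simp
    next
      fix g assume g: "g \<in> N #> a"
      then have "N #> a = N #> g" by (rule repr_independence[OF _ a(1) N(1)])
      then show "g \<in> {g \<in> topspace (topo G). N #> g = C}" using g Na a(2) by auto
    qed
    then show ?thesis using openin_rcoset[OF N(2) a(1)] by simp
  next
    case False
    then have "{g \<in> topspace (topo G). N #> g = C} = {}" by auto
    then show ?thesis by (simp only: openin_empty)
  qed
qed

locale pro_p = top_group +
  fixes p :: nat
  assumes prime_p: "prime p" and pro_p: "pro_p_group p G"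
begin

lemma profinite: "profinite_group G"
  and compact: "compact_space (topo G)" and hausdorff: "Hausdorff_space (topo G)"
  using pro_p by (auto simp: pro_p_group_def profinite_group_def)

lemma card_rcosets: "N \<lhd> G \<Longrightarrow> openin (topo G) N \<Longrightarrow> \<exists>k. card (rcosets N) = p ^ k"
  using pro_p by (auto simp: pro_p_group_def)

lemma finite_rcosets:
  assumes "N \<lhd> G" "openin (topo G) N" shows "finite (rcosets N)"
  using card_rcosets[OF assms] prime_p by (metis card.infinite power_not_zero not_prime_0)

lemma quotient_hom:
  assumes "N \<lhd> G" shows "group_hom G (G Mod N) (\<lambda>g. N #> g)"
  using normal.factorgroup_is_group[OF assms] normal.r_coset_hom_Mod[OF assms] is_group
  by (simp add: group_hom_def group_hom_axioms_def)

lemma rcoset_eq_iff: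
  assumes "subgroup N G" "a \<in> carrier G" "b \<in> carrier G"
  shows "N #> a = N #> b \<longleftrightarrow> a \<otimes> inv b \<in> N"
  using assms subgroup.rcos_module[OF assms(1) is_group, of b a] rcos_self[OF assms(2,1)]
    repr_independence[OF _ _ assms(1), of a b] by auto

lemma one_if_in_all_open_normal:
  assumes a: "a \<in> carrier G" and all: "\<And>N. N \<lhd> G \<Longrightarrow> openin (topo G) N \<Longrightarrow> a \<in> N"
  shows "a = \<one>"
proof (rule ccontr)
  assume "a \<noteq> \<one>"
  then obtain U where "openin (topo G) U" "\<one> \<in> U" "a \<notin> U"
    using hausdorff a unfolding Hausdorff_space_def
    by (metis disjnt_iff one_closed topspace_eq)
  then obtain N where "N \<lhd> G" "openin (topo G) N" "N \<subseteq> U"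
    using open_normal_base[OF profinite] by blast
  then show False using all \<open>a \<notin> U\<close> by blast
qed

lemma eq_if_rcosets_eq:
  assumes "a \<in> carrier G" "b \<in> carrier G"
    and "\<And>N. N \<lhd> G \<Longrightarrow> openin (topo G) N \<Longrightarrow> N #> a = N #> b"
  shows "a = b"
proof -
  have "a \<otimes> inv b = \<one>"
  proof (rule one_if_in_all_open_normal)
    show "a \<otimes> inv b \<in> carrier G" using assms by simp
    show "a \<otimes> inv b \<in> N" if "N \<lhd> G" "openin (topo G) N" for N
      using rcoset_eq_iff[OF normal_imp_subgroup[OF that(1)] assms(1,2)] assms(3)[OF that] by simp
  qed
  then show ?thesis using assms by (simp add: inv_solve_right')
qed

text \<open>An open normal \<open>N\<close> separates a point outside \<open>C\<close> from
  \<open>C\<close>. Only finitely many subgroups contain \<open>N\<close>, so a maximal proper one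
  exists above \<open>N\<close> and \<open>C\<close>, and it is open because it contains
  \<open>N\<close>.\<close>

lemma maximal_open_subgroup_exists:
  assumes C: "subgroup C G" "closedin (topo G) C" "C \<noteq> carrier G"
  obtains M where "maximal_open_subgroup M G" "C \<subseteq> M"
proof -
  have Cc: "C \<subseteq> carrier G" using C(1) by (rule subgroup.subset)
  obtain a where a: "a \<in> carrier G" "a \<notin> C" using C(3) Cc by blast
  let ?U = "{u \<in> topspace (topo G). u \<otimes> a \<in> carrier G - C}"
  have "openin (topo G) ?U"
    by (rule openin_preimage) (use C(2) a in \<open>auto intro!: continuous_intros_tg simp: closedin_def\<close>)
  moreover have "\<one> \<in> ?U" using a by simp
  ultimately obtain N where N: "N \<lhd> G" "openin (topo G) N" "N \<subseteq> ?U"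
    by (rule open_normal_base[OF profinite])
  have Ns: "subgroup N G" using N(1) by (rule normal_imp_subgroup)
  interpret \<pi>: group_hom G "G Mod N" "\<lambda>g. N #> g" by (rule quotient_hom[OF N(1)])
  \<comment> \<open>The product of \<open>N\<close> and \<open>C\<close>, written as a preimage from
    the quotient so that it is visibly a subgroup.\<close>
  define L0 where "L0 = {g \<in> carrier G. N #> g \<in> (\<lambda>g. N #> g) ` C}"
  have L0: "subgroup L0 G"
    unfolding L0_def by (intro \<pi>.subgroup_preimage \<pi>.subgroup_img_is_subgroup C(1))
  have CL0: "C \<subseteq> L0" using Cc by (auto simp: L0_def)
  have aL0: "a \<notin> L0"
  proof
    assume "a \<in> L0"
    then obtain c where c: "c \<in> C" "N #> a = N #> c" by (auto simp: L0_def)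
    then have "N #> c = N #> a" by simp
    then have "c \<otimes> inv a \<in> N" using c Cc a rcoset_eq_iff[OF Ns, of c a] by blast
    then have "c \<otimes> inv a \<otimes> a \<in> carrier G - C" using N(3) by blast
    then show False using c Cc a by (auto simp: word_simps subset_iff)
  qed
  have NL0: "N \<subseteq> L0"
  proof
    fix n assume n: "n \<in> N"
    then have nc: "n \<in> carrier G" using subgroup.mem_carrier[OF Ns] by blast
    have "N #> n = N #> \<one>" using n nc rcoset_eq_iff[OF Ns, of n \<one>] by simp
    moreover have "\<one> \<in> C" using C(1) by (rule subgroup.one_closed)
    ultimately show "n \<in> L0" using nc unfolding L0_def by blast
  qed
  let ?\<L> = "{L. subgroup L G \<and> L0 \<subseteq> L \<and> L \<noteq> carrier G}"
  have "?\<L> \<subseteq> Union ` Pow (rcosets N)"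
  proof
    fix L assume "L \<in> ?\<L>"
    then have L: "subgroup L G" "L0 \<subseteq> L" by auto
    have "L = \<Union>{D \<in> rcosets N. D \<subseteq> L}"
    proof (intro equalityI subsetI)
      fix g assume g: "g \<in> L"
      have gc: "g \<in> carrier G" using subgroup.mem_carrier[OF L(1) g] .
      have "N #> g \<subseteq> L"
      proof
        fix z assume "z \<in> N #> g"
        then obtain n where n: "n \<in> N" "z = n \<otimes> g" by (auto simp: r_coset_def)
        then have "n \<in> L" using L NL0 by blast
        then show "z \<in> L" using subgroup.m_closed[OF L(1) _ g] n(2) by simp
      qed
      moreover have "g \<in> N #> g" by (rule rcos_self[OF gc Ns])
      moreover have "N #> g \<in> rcosets N" using gc subgroup.subset[OF Ns] by (simp add: rcosetsI)
      ultimately show "g \<in> \<Union>{D \<in> rcosets N. D \<subseteq> L}" by blast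
    qed blast
    then show "L \<in> Union ` Pow (rcosets N)" by blast
  qed
  then have "finite ?\<L>" using finite_rcosets[OF N(1,2)] finite_subset by blast
  moreover have "L0 \<in> ?\<L>" using L0 aL0 a by blast
  ultimately have "\<exists>M\<in>?\<L>. \<forall>L\<in>?\<L>. M \<subseteq> L \<longrightarrow> M = L"
    by (intro finite_has_maximal) auto
  then obtain M where M: "M \<in> ?\<L>" and max: "\<forall>L\<in>?\<L>. M \<subseteq> L \<longrightarrow> M = L"
    by (rule bexE)
  have Ms: "subgroup M G" "L0 \<subseteq> M" "M \<noteq> carrier G" using M by auto
  have "openin (topo G) M"
    using subgroup_openinI[OF Ms(1) N(2) subgroup.one_closed[OF Ns]] NL0 Ms(2) by simp
  moreover have "L = M \<or> L = carrier G" if "subgroup L G" "M \<subseteq> L" for L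
    using max that Ms(2) by auto
  ultimately have "maximal_open_subgroup M G"
    using Ms by (simp add: maximal_open_subgroup_def)
  then show ?thesis using that[of M] Ms(2) CL0 by simp
qed

text \<open>\<open>M\<close> contains an open normal subgroup, so the question descends to a finite
  p-group, where \<open>p_group_maximal_commutator\<close> applies.\<close>

lemma maximal_open_commutator:
  assumes M: "maximal_open_subgroup M G" and g: "g \<in> carrier G" and h: "h \<in> carrier G"
  shows "g \<otimes> h \<otimes> inv g \<otimes> inv h \<in> M"
proof -
  have Ms: "subgroup M G" and Mo: "openin (topo G) M" and Mc: "M \<noteq> carrier G"
    and maxM: "\<And>L. subgroup L G \<Longrightarrow> openin (topo G) L \<Longrightarrow> M \<subseteq> L \<Longrightarrow> L = M \<or> L = carrier G"
    using M by (auto simp: maximal_open_subgroup_def)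
  obtain N where N: "N \<lhd> G" "openin (topo G) N" "N \<subseteq> M"
    using open_normal_base[OF profinite Mo subgroup.one_closed[OF Ms]] by blast
  have Ns: "subgroup N G" using N(1) by (rule normal_imp_subgroup)
  interpret \<pi>: group_hom G "G Mod N" "\<lambda>g. N #> g" by (rule quotient_hom[OF N(1)])
  have pull: "a \<in> M" if a: "a \<in> carrier G" and im: "N #> a \<in> (\<lambda>g. N #> g) ` M" for a
  proof -
    obtain m where m: "m \<in> M" "N #> a = N #> m" using im by blast
    have "a \<in> N #> m" using rcos_self[OF a Ns] m by simp
    then obtain n where n: "n \<in> N" "a = n \<otimes> m" by (auto simp: r_coset_def)
    then show ?thesis using N(3) m subgroup.m_closed[OF Ms] by auto
  qed
  obtain k where k: "card (carrier (G Mod N)) = p ^ k" using card_rcosets[OF N(1,2)] by (auto simp: FactGroup_def)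
  have carr: "carrier (G Mod N) = (\<lambda>g. N #> g) ` carrier G" by (rule carrier_FactGroup)
  have MM: "subgroup ((\<lambda>g. N #> g) ` M) (G Mod N)" by (rule \<pi>.subgroup_img_is_subgroup[OF Ms])
  have "(N #> g) \<otimes>\<^bsub>G Mod N\<^esub> (N #> h) \<otimes>\<^bsub>G Mod N\<^esub> inv\<^bsub>G Mod N\<^esub> (N #> g) \<otimes>\<^bsub>G Mod N\<^esub> inv\<^bsub>G Mod N\<^esub> (N #> h)
      \<in> (\<lambda>g. N #> g) ` M"
  proof (rule group.p_group_maximal_commutator[OF \<pi>.H.is_group prime_p k MM])
    show "(\<lambda>g. N #> g) ` M \<noteq> carrier (G Mod N)"
    proof
      assume "(\<lambda>g. N #> g) ` M = carrier (G Mod N)"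
      then have im: "N #> a \<in> (\<lambda>g. N #> g) ` M" if "a \<in> carrier G" for a using that by (simp add: carr)
      have "carrier G \<subseteq> M" using pull[OF _ im] by (rule subsetI)
      then show False using Mc subgroup.subset[OF Ms] by blast
    qed
    fix L assume L: "subgroup L (G Mod N)" "(\<lambda>g. N #> g) ` M \<subseteq> L"
    let ?L = "{g \<in> carrier G. N #> g \<in> L}"
    have Ls: "subgroup ?L G" by (rule \<pi>.subgroup_preimage[OF L(1)])
    have M_L: "M \<subseteq> ?L" using L(2) subgroup.subset[OF Ms] by blast
    have "openin (topo G) ?L"
      by (rule subgroup_openinI[OF Ls Mo subgroup.one_closed[OF Ms] M_L])
    then have "?L = M \<or> ?L = carrier G"
      by (rule maxM[OF Ls _ M_L])
    then consider "?L = M" | "?L = carrier G" by (elim disjE)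
    then show "L = (\<lambda>g. N #> g) ` M \<or> L = carrier (G Mod N)"
    proof cases
      case 1
      have "L \<subseteq> (\<lambda>g. N #> g) ` M"
      proof
        fix C assume C: "C \<in> L"
        then obtain c where "c \<in> carrier G" "C = N #> c"
          using subgroup.subset[OF L(1)] carr by blast
        then show "C \<in> (\<lambda>g. N #> g) ` M" using 1 C by blast
      qed
      then show ?thesis using L(2) by blast
    next
      case 2
      have "N #> g \<in> L" if "g \<in> carrier G" for g using 2 that by blast
      then have "carrier (G Mod N) \<subseteq> L" unfolding carr by (rule image_subsetI)
      then show ?thesis using subgroup.subset[OF L(1)] by blast
    qed
  qed (use g h carr in auto)
  also have "(N #> g) \<otimes>\<^bsub>G Mod N\<^esub> (N #> h) \<otimes>\<^bsub>G Mod N\<^esub> inv\<^bsub>G Mod N\<^esub> (N #> g) \<otimes>\<^bsub>G Mod N\<^esub> inv\<^bsub>G Mod N\<^esub> (N #> h)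
      = N #> (g \<otimes> h \<otimes> inv g \<otimes> inv h)"
    using g h by (simp only: \<pi>.hom_mult \<pi>.hom_inv m_closed inv_closed)
  finally show ?thesis using g h by (intro pull) simp_all
qed

lemma commutator_in_frattini:
  "g \<in> carrier G \<Longrightarrow> h \<in> carrier G \<Longrightarrow> g \<otimes> h \<otimes> inv g \<otimes> inv h \<in> frattini G"
  by (simp add: frattini_def maximal_open_commutator)

lemma continuous_hom_image_closed:
  assumes f: "f \<in> hom G G" "continuous_map (topo G) (topo G) f"
  shows "closedin (topo G) (f ` carrier G)"
proof (rule compactin_imp_closedin[OF hausdorff])
  show "compactin (topo G) (f ` carrier G)"
    using image_compactin[OF _ f(2), of "carrier G"] compact by (simp add: compact_space_def)
qed

end

lemma locally_constant_finite_hom_endo: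
  fixes G (structure)
  assumes "f \<in> hom G G" "continuous_map (topo G) (topo G) f" "h \<in> hom G P" "locally_constant (topo G) h"
  shows "(\<lambda>g. h (f g)) \<in> hom G P" "locally_constant (topo G) (\<lambda>g. h (f g))"
  using Group.hom_compose[OF assms(1,3)] locally_constant_continuous[OF assms(4,2)] by (simp_all add: o_def)

context pro_p begin

lemma hom_eq_endo:
  assumes X: "top_generates G X"
    and f: "f \<in> hom G G" "continuous_map (topo G) (topo G) f"
    and h: "h \<in> hom G G" "continuous_map (topo G) (topo G) h"
    and eq: "\<And>x. x \<in> X \<Longrightarrow> f x = h x" and g: "g \<in> carrier G"
  shows "f g = h g"
proof (rule eq_if_rcosets_eq)
  show "f g \<in> carrier G" "h g \<in> carrier G" using f h g by (auto simp: hom_def)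
  fix N assume N: "N \<lhd> G" "openin (topo G) N"
  interpret \<pi>: group_hom G "G Mod N" "\<lambda>g. N #> g" by (rule quotient_hom[OF N(1)])
  note lc = locally_constant_rcoset[OF normal_imp_subgroup[OF N(1)] N(2)]
  show "N #> f g = N #> h g"
    by (rule hom_eq_on_generators[OF X \<pi>.H.is_group
          locally_constant_finite_hom_endo[OF f \<pi>.homh lc] locally_constant_finite_hom_endo[OF h \<pi>.homh lc] _ g])
      (simp add: eq)
qed

text \<open>The finite set of homomorphisms to a finite quotient is permuted by precomposition with \<open>f\<close>.\<close>

lemma surj_endo_inj:
  assumes X: "top_generates G X" "finite X"
    and f: "f \<in> hom G G" "continuous_map (topo G) (topo G) f" and surj: "f ` carrier G = carrier G"
  shows "inj_on f (carrier G)"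
proof -
  interpret f: group_hom G G f using f(1) is_group by (simp add: group_hom_def group_hom_axioms_def)
  have "a \<in> N" if a: "a \<in> carrier G" "f a = \<one>" and N: "N \<lhd> G" "openin (topo G) N" for a N
  proof -
    interpret \<pi>: group_hom G "G Mod N" "\<lambda>g. N #> g" by (rule quotient_hom[OF N(1)])
    have Ns: "subgroup N G" using N(1) by (rule normal_imp_subgroup)
    note lc = locally_constant_rcoset[OF Ns N(2)]
    let ?P = "G Mod N"
    \<comment> \<open>Without the restriction, homomorphisms that agree on the carrier could still
      differ as functions, and \<open>H\<close> need not be finite.\<close>
    define H where "H = {restrict h (carrier G) | h. h \<in> hom G ?P \<and> locally_constant (topo G) h}"
    have H: "h \<in> hom G ?P \<and> locally_constant (topo G) h \<and> h \<in> extensional (carrier G)" if hH: "h \<in> H" for h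
    proof -
      obtain k where k: "h = restrict k (carrier G)" "k \<in> hom G ?P" "locally_constant (topo G) k"
        using hH by (auto simp: H_def)
      then have "locally_constant (topo G) h" by (intro locally_constant_cong[OF k(3)]) auto
      then show ?thesis using k by (auto simp: hom_def)
    qed
    have "finite (X \<rightarrow>\<^sub>E carrier ?P)"
      using X(2) finite_rcosets[OF N] by (intro finite_PiE) (auto simp: FactGroup_def)
    moreover have "inj_on (\<lambda>h. restrict h X) H"
    proof (rule inj_onI)
      fix h k assume hk: "h \<in> H" "k \<in> H" "restrict h X = restrict k X"
      then have eqX: "h x = k x" if "x \<in> X" for x using that by (metis restrict_apply')
      have "h g = k g" if "g \<in> carrier G" for g
        by (rule hom_eq_on_generators[OF X(1) \<pi>.H.is_group _ _ _ _ eqX that]) (use H hk in auto)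
      then show "h = k" using H hk by (metis extensionalityI)
    qed
    moreover have "(\<lambda>h. restrict h X) ` H \<subseteq> X \<rightarrow>\<^sub>E carrier ?P"
      using H X(1) by (force simp: hom_def top_generates_def)
    ultimately have finH: "finite H" by (meson finite_imageD finite_subset)
    let ?f = "\<lambda>h. \<lambda>g \<in> carrier G. h (f g)"
    have "inj_on ?f H"
    proof (rule inj_onI)
      fix h k assume hk: "h \<in> H" "k \<in> H" "?f h = ?f k"
      have "h g = k g" if gc: "g \<in> carrier G" for g
      proof -
        obtain g' where g': "g' \<in> carrier G" "g = f g'" using gc surj by blast
        then have "?f h g' = ?f k g'" using hk(3) by simp
        then show ?thesis using g' by simp
      qed
      then show "h = k" using H hk by (metis extensionalityI)
    qed
    moreover have "?f ` H \<subseteq> H"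
    proof
      fix k assume "k \<in> ?f ` H"
      then obtain h where h: "h \<in> H" "k = ?f h" by blast
      have "(\<lambda>g. h (f g)) \<in> hom G ?P \<and> locally_constant (topo G) (\<lambda>g. h (f g))"
        using locally_constant_finite_hom_endo[OF f] H[OF h(1)] by blast
      then show "k \<in> H" unfolding H_def h(2) by blast
    qed
    ultimately have "?f ` H = H" using endo_inj_surj[OF finH] by blast
    moreover have "(\<lambda>g \<in> carrier G. N #> g) \<in> H" using \<pi>.homh lc by (auto simp: H_def)
    \<comment> \<open>The projection modulo \<open>N\<close> is itself of the form
      \<open>h \<circ> f\<close> on the carrier, so \<open>f a = \<one>\<close> forces
      \<open>a\<close> into \<open>N\<close>.\<close>
    ultimately obtain h where h: "h \<in> H" "(\<lambda>g \<in> carrier G. N #> g) = ?f h" by blast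
    have "N #> a = h (f a)" using fun_cong[OF h(2), of a] a(1) by simp
    also have "\<dots> = h (f \<one>)" using a(2) by simp
    also have "\<dots> = N #> \<one>" using fun_cong[OF h(2), of \<one>] by (simp only: restrict_apply' one_closed f.hom_one)
    finally show ?thesis using rcoset_eq_iff[OF Ns a(1) one_closed] a by simp
  qed
  then have "a = \<one>" if "a \<in> carrier G" "f a = \<one>" for a
    using one_if_in_all_open_normal that by blast
  then show ?thesis by (metis f.inj_on_one_iff)
qed

text \<open>Otherwise the closed image lies in a maximal open subgroup \<open>M\<close>. As
  \<open>M\<close> contains the Frattini subgroup, it then contains the generators as well.\<close>

lemma surj_endo_if_trivial_mod_frattini:
  assumes X: "top_generates G X"
    and f: "f \<in> hom G G" "continuous_map (topo G) (topo G) f"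
    and triv: "\<And>x. x \<in> X \<Longrightarrow> f x \<in> frattini G #> x"
  shows "f ` carrier G = carrier G"
proof (rule ccontr)
  assume ne: "f ` carrier G \<noteq> carrier G"
  interpret f: group_hom G G f using f(1) is_group by (simp add: group_hom_def group_hom_axioms_def)
  obtain M where M: "maximal_open_subgroup M G" "f ` carrier G \<subseteq> M"
    using maximal_open_subgroup_exists[OF f.img_is_subgroup continuous_hom_image_closed[OF f] ne] .
  then have Ms: "subgroup M G" and Mo: "openin (topo G) M" and Mc: "M \<noteq> carrier G"
    by (auto simp: maximal_open_subgroup_def)
  have "x \<in> M" if x: "x \<in> X" for x
  proof -
    have xc: "x \<in> carrier G" using x X by (auto simp: top_generates_def)
    obtain a where a: "a \<in> frattini G" "f x = a \<otimes> x" using triv[OF x] by (auto simp: r_coset_def)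
    have aM: "a \<in> M" and ac: "a \<in> carrier G" using a(1) M(1) by (auto simp: frattini_def)
    have "inv a \<otimes> f x \<in> M"
      using aM M(2) xc by (intro subgroup.m_closed[OF Ms] subgroup.m_inv_closed[OF Ms]) auto
    then show ?thesis using a ac xc by (simp add: word_simps)
  qed
  then have "M = carrier G" using top_generates_open_subgroup[OF X Ms Mo] by blast
  then show False using Mc by blast
qed

end

section \<open>The congruence topology on the automorphism group\<close>

context pro_p begin

definition nbhd :: "('a \<Rightarrow> 'a) \<Rightarrow> 'a set \<Rightarrow> ('a \<Rightarrow> 'a) set" where
  "nbhd f N = {g \<in> cont_auto G. \<forall>k \<in> carrier G. N #> g k = N #> f k}"

text \<open>The carrier of \<open>Aut0 G\<close>, by \<open>kernel_induced_auto\<close>; in this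
  form automorphisms of the Frattini quotient never have to be handled.\<close>

definition A0 :: "('a \<Rightarrow> 'a) set" where
  "A0 = {f \<in> cont_auto G. \<forall>g \<in> carrier G. frattini G #> f g = frattini G #> g}"

lemma cont_autoD:
  assumes "f \<in> cont_auto G"
  shows "f \<in> hom G G" "continuous_map (topo G) (topo G) f" "f \<in> extensional (carrier G)"
    "bij_betw f (carrier G) (carrier G)" "f \<in> Bij (carrier G)"
  using assms by (auto simp: cont_auto_def auto_def Bij_def)

lemma cont_auto_closed: "f \<in> cont_auto G \<Longrightarrow> k \<in> carrier G \<Longrightarrow> f k \<in> carrier G"
  using cont_autoD(1) by (auto simp: hom_def)

lemma cont_autoI:
  assumes "f \<in> hom G G" "continuous_map (topo G) (topo G) f" "f \<in> extensional (carrier G)"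
    "bij_betw f (carrier G) (carrier G)"
  shows "f \<in> cont_auto G"
  using assms by (auto simp: cont_auto_def auto_def Bij_def)

lemma nbhd_alt:
  assumes "N \<lhd> G" "f \<in> cont_auto G"
  shows "nbhd f N = {g \<in> cont_auto G. \<forall>k \<in> carrier G. g k \<otimes> inv (f k) \<in> N}"
  using rcoset_eq_iff[OF normal_imp_subgroup[OF assms(1)] cont_auto_closed cont_auto_closed[OF assms(2)]]
  by (auto simp: nbhd_def)

lemma openin_aut_topo_iff:
  "openin (aut_topo G) U \<longleftrightarrow> U \<subseteq> cont_auto G \<and>
     (\<forall>f \<in> U. \<exists>N. N \<lhd> G \<and> openin (topo G) N \<and> nbhd f N \<subseteq> U)"
proof -
  have "(\<exists>N. N \<lhd> G \<and> openin (topo G) N \<and> nbhd f N \<subseteq> U) \<longleftrightarrow>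
     (\<exists>N. N \<lhd> G \<and> openin (topo G) N \<and> {g \<in> cont_auto G. \<forall>k \<in> carrier G. g k \<otimes> inv (f k) \<in> N} \<subseteq> U)"
    if "f \<in> cont_auto G" for f
    using nbhd_alt[OF _ that] by (intro ex_cong1) auto
  then show ?thesis unfolding openin_aut_topo[OF is_group] by (meson subsetD)
qed

lemma openin_nbhd:
  assumes "N \<lhd> G" "openin (topo G) N" shows "openin (aut_topo G) (nbhd f N)"
  unfolding openin_aut_topo_iff
proof (intro conjI ballI)
  show "nbhd f N \<subseteq> cont_auto G" by (auto simp: nbhd_def)
  fix g assume "g \<in> nbhd f N"
  then have "nbhd g N \<subseteq> nbhd f N" by (auto simp: nbhd_def)
  then show "\<exists>N'. N' \<lhd> G \<and> openin (topo G) N' \<and> nbhd g N' \<subseteq> nbhd f N" using assms by blast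
qed

lemma topspace_aut_topo: "topspace (aut_topo G) = cont_auto G"
proof
  show "topspace (aut_topo G) \<subseteq> cont_auto G"
    using openin_topspace[of "aut_topo G"] unfolding openin_aut_topo_iff by blast
  have "carrier G \<lhd> G" by (rule normal_invI) (auto simp: subgroup_self)
  then have "openin (aut_topo G) (nbhd id (carrier G))" by (rule openin_nbhd[OF _ openin_carrier])
  moreover have "nbhd id (carrier G) = cont_auto G"
    using coset_join2[OF _ subgroup_self] cont_auto_closed by (auto simp: nbhd_def)
  ultimately show "cont_auto G \<subseteq> topspace (aut_topo G)" using openin_subset by metis
qed

text \<open>A continuous bijection of a compact Hausdorff space is a homeomorphism, so the algebraic
  inverse is continuous.\<close>

lemma cont_auto_inv:
  assumes f: "f \<in> cont_auto G"
  defines "h \<equiv> restrict (inv_into (carrier G) f) (carrier G)"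
  shows "h \<in> cont_auto G" "\<And>k. k \<in> carrier G \<Longrightarrow> f (h k) = k" "\<And>k. k \<in> carrier G \<Longrightarrow> h (f k) = k"
proof -
  note fD = cont_autoD[OF f]
  have surj: "f ` carrier G = carrier G" and inj: "inj_on f (carrier G)"
    using fD(4) by (auto simp: bij_betw_def)
  show fh: "\<And>k. k \<in> carrier G \<Longrightarrow> f (h k) = k" using surj by (simp add: h_def f_inv_into_f)
  show hf: "\<And>k. k \<in> carrier G \<Longrightarrow> h (f k) = k"
    using inj cont_auto_closed[OF f] by (simp add: h_def)
  have "homeomorphic_map (topo G) (topo G) f"
    by (rule continuous_imp_homeomorphic_map[OF fD(2) compact hausdorff]) (use surj inj in simp_all)
  then obtain h' where h': "homeomorphic_maps (topo G) (topo G) f h'" by (auto simp: homeomorphic_map_maps)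
  have "continuous_map (topo G) (topo G) h"
  proof (rule continuous_map_eq)
    show "continuous_map (topo G) (topo G) h'" using h' by (simp add: homeomorphic_maps_def)
    fix k assume "k \<in> topspace (topo G)"
    then have k: "k \<in> carrier G" "f (h' k) = k" "h' k \<in> carrier G"
      using h' by (auto simp: homeomorphic_maps_def continuous_map_def)
    then show "h' k = h k" using hf[of "h' k"] by simp
  qed
  then show "h \<in> cont_auto G"
    using restrict_inv_into_hom[OF fD(1,5)] restrict_inv_into_Bij[OF fD(5)]
    by (intro cont_autoI) (auto simp: h_def Bij_def)
qed

text \<open>Together with the inverse automorphism this yields that the Frattini subgroup is
  characteristic.\<close>

lemma maximal_open_preimage:
  assumes f: "f \<in> cont_auto G" and M: "maximal_open_subgroup M G"
  shows "maximal_open_subgroup {k \<in> carrier G. f k \<in> M} G"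
proof -
  note fD = cont_autoD[OF f]
  interpret f: group_hom G G f using fD(1) is_group by (simp add: group_hom_def group_hom_axioms_def)
  define h where "h = restrict (inv_into (carrier G) f) (carrier G)"
  note h = cont_auto_inv[OF f, folded h_def]
  note hD = cont_autoD[OF h(1)]
  interpret h: group_hom G G h using hD(1) is_group by (simp add: group_hom_def group_hom_axioms_def)
  have Ms: "subgroup M G" "openin (topo G) M" "M \<noteq> carrier G"
    and max: "\<And>L. subgroup L G \<Longrightarrow> openin (topo G) L \<Longrightarrow> M \<subseteq> L \<Longrightarrow> L = M \<or> L = carrier G"
    using M by (auto simp: maximal_open_subgroup_def)
  have Mc: "M \<subseteq> carrier G" by (rule subgroup.subset[OF Ms(1)])
  let ?M = "{k \<in> carrier G. f k \<in> M}"
  have pre: "subgroup ?M G" by (rule f.subgroup_preimage[OF Ms(1)])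
  moreover have "openin (topo G) ?M" using openin_preimage[OF fD(2) Ms(2)] by simp
  moreover have "?M \<noteq> carrier G"
  proof
    assume eq: "?M = carrier G"
    have "k \<in> M" if k: "k \<in> carrier G" for k
    proof -
      have "h k \<in> ?M" unfolding eq by (rule cont_auto_closed[OF h(1) k])
      then show ?thesis using h(2)[OF k] by simp
    qed
    then show False using Ms(3) Mc by blast
  qed
  moreover have "L = ?M \<or> L = carrier G"
    if L: "subgroup L G" "openin (topo G) L" "?M \<subseteq> L" for L
  proof -
    let ?L = "{k \<in> carrier G. h k \<in> L}"
    have Lc: "L \<subseteq> carrier G" by (rule subgroup.subset[OF L(1)])
    have MsL: "M \<subseteq> ?L"
    proof
      fix m assume m: "m \<in> M"
      then have "m \<in> carrier G" using Mc by blast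
      then show "m \<in> ?L" using m L(3) h(2) cont_auto_closed[OF h(1)] by auto
    qed
    have "?L = M \<or> ?L = carrier G"
      by (rule max[OF h.subgroup_preimage[OF L(1)] _ MsL]) (use openin_preimage[OF hD(2) L(2)] in simp)
    moreover have "l \<in> ?M" if "?L = M" "l \<in> L" for l
    proof -
      have lc: "l \<in> carrier G" using that(2) Lc by blast
      then have "f l \<in> ?L" using h(3) that(2) cont_auto_closed[OF f] by simp
      then show ?thesis using that(1) lc by simp
    qed
    moreover have "l \<in> L" if "?L = carrier G" "l \<in> carrier G" for l
    proof -
      have "f l \<in> ?L" unfolding that(1) by (rule cont_auto_closed[OF f that(2)])
      then show ?thesis using h(3)[OF that(2)] by simp
    qed
    ultimately show ?thesis using L(3) Lc by blast
  qed
  ultimately show ?thesis unfolding maximal_open_subgroup_def by blast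
qed

lemma cont_auto_frattini:
  assumes f: "f \<in> cont_auto G" shows "f ` frattini G = frattini G"
proof -
  have sub: "g k \<in> frattini G" if g: "g \<in> cont_auto G" and k: "k \<in> frattini G" for g k
    using k maximal_open_preimage[OF g] cont_auto_closed[OF g] by (auto simp: frattini_def)
  note h = cont_auto_inv[OF f]
  have Fc: "k \<in> carrier G" if "k \<in> frattini G" for k using that by (simp add: frattini_def)
  show ?thesis
  proof (intro equalityI subsetI)
    fix k assume k: "k \<in> frattini G"
    show "k \<in> f ` frattini G"
      using h(2)[OF Fc[OF k]] sub[OF h(1) k] by (metis imageI)
  qed (use sub[OF f] in auto)
qed

lemma normal_frattini: "frattini G \<lhd> G"
proof (rule normal_invI[OF subgroup_frattini])
  fix g n assume g: "g \<in> carrier G" and n: "n \<in> frattini G"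
  then have nc: "n \<in> carrier G" by (simp add: frattini_def)
  have "(g \<otimes> n \<otimes> inv g \<otimes> inv n) \<otimes> n \<in> frattini G"
    by (rule subgroup.m_closed[OF subgroup_frattini commutator_in_frattini[OF g nc] n])
  then show "g \<otimes> n \<otimes> inv g \<in> frattini G" using g nc by (simp add: word_simps)
qed

lemma cont_auto_image_rcoset:
  assumes f: "f \<in> cont_auto G" and g: "g \<in> carrier G"
  shows "f ` (frattini G #> g) = frattini G #> f g"
proof -
  have Fc: "k \<in> carrier G" if "k \<in> frattini G" for k using that by (simp add: frattini_def)
  have hom: "f (k \<otimes> g) = f k \<otimes> f g" if "k \<in> frattini G" for k
    using cont_autoD(1)[OF f] Fc[OF that] g by (simp add: hom_def)
  have "f ` (frattini G #> g) = (\<lambda>k. f (k \<otimes> g)) ` frattini G" by (auto simp: r_coset_def)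
  also have "\<dots> = (\<lambda>k. k \<otimes> f g) ` (f ` frattini G)" using hom by (auto simp: image_image)
  also have "\<dots> = frattini G #> f g" unfolding cont_auto_frattini[OF f] by (auto simp: r_coset_def)
  finally show ?thesis .
qed

text \<open>Since \<open>f\<close> preserves the Frattini subgroup, it maps the coset of
  \<open>g\<close> onto the coset of \<open>f g\<close>, so triviality on the quotient can be tested
  on elements.\<close>

lemma kernel_induced_auto:
  "kernel (Aut G) (Aut (tquot G (frattini G))) (induced_auto G (frattini G)) = A0"
proof -
  have iff: "induced_auto G (frattini G) f = (\<lambda>C \<in> rcosets frattini G. C) \<longleftrightarrow>
      (\<forall>g \<in> carrier G. frattini G #> f g = frattini G #> g)" if f: "f \<in> cont_auto G" for f
  proof
    assume eq: "induced_auto G (frattini G) f = (\<lambda>C \<in> rcosets frattini G. C)"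
    show "\<forall>g \<in> carrier G. frattini G #> f g = frattini G #> g"
    proof
      fix g assume g: "g \<in> carrier G"
      then have "frattini G #> g \<in> rcosets frattini G"
        by (simp add: rcosetsI subgroup.subset[OF subgroup_frattini])
      then show "frattini G #> f g = frattini G #> g"
        using fun_cong[OF eq, of "frattini G #> g"] cont_auto_image_rcoset[OF f g]
        by (simp add: induced_auto_def)
    qed
  next
    assume all: "\<forall>g \<in> carrier G. frattini G #> f g = frattini G #> g"
    show "induced_auto G (frattini G) f = (\<lambda>C \<in> rcosets frattini G. C)"
      unfolding induced_auto_def
    proof (rule restrict_ext)
      fix C assume "C \<in> rcosets frattini G"
      then obtain g where "g \<in> carrier G" "C = frattini G #> g" by (auto simp: RCOSETS_def)
      then show "f ` C = C" using all cont_auto_image_rcoset[OF f] by simp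
    qed
  qed
  show ?thesis
    unfolding kernel_def A0_def by (rule Collect_cong) (use iff in auto)
qed

lemma Aut0_simps [simp]:
  "carrier (Aut0 G) = A0" "mult (Aut0 G) = mult (BijGroup (carrier G))"
  "one (Aut0 G) = (\<lambda>k \<in> carrier G. k)" "topo (Aut0 G) = subtopology (aut_topo G) A0"
  by (simp_all add: Aut0_def kernel_induced_auto)

lemma A0_cont_auto: "f \<in> A0 \<Longrightarrow> f \<in> cont_auto G" by (simp add: A0_def)

lemma A0_mult:
  assumes "f \<in> A0" "g \<in> A0"
  shows "f \<otimes>\<^bsub>BijGroup (carrier G)\<^esub> g = compose (carrier G) f g"
  using cont_autoD(5)[OF A0_cont_auto] assms by (simp add: BijGroup_def)

lemma subgroup_A0: "subgroup A0 (BijGroup (carrier G))"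
proof (rule subgroup.intro)
  show "A0 \<subseteq> carrier (BijGroup (carrier G))"
    using cont_autoD(5) by (auto simp: A0_def BijGroup_def)
  show "\<one>\<^bsub>BijGroup (carrier G)\<^esub> \<in> A0"
  proof -
    have "continuous_map (topo G) (topo G) (\<lambda>k \<in> carrier G. k)"
      by (rule continuous_map_eq[OF continuous_map_id]) simp
    then show ?thesis using id_in_auto by (simp add: BijGroup_def A0_def cont_auto_def)
  qed
  fix f assume f: "f \<in> A0"
  note fc = A0_cont_auto[OF f]
  let ?h = "restrict (inv_into (carrier G) f) (carrier G)"
  note h = cont_auto_inv[OF fc]
  have "?h \<in> A0"
    unfolding A0_def
  proof (intro CollectI conjI ballI h(1))
    fix k assume k: "k \<in> carrier G"
    have "?h k \<in> carrier G" by (rule cont_auto_closed[OF h(1) k])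
    then have "frattini G #> f (?h k) = frattini G #> ?h k" using f unfolding A0_def by blast
    then show "frattini G #> ?h k = frattini G #> k" unfolding h(2)[OF k] by simp
  qed
  then show "inv\<^bsub>BijGroup (carrier G)\<^esub> f \<in> A0"
    using inv_BijGroup[OF cont_autoD(5)[OF fc]] by simp
  fix g assume g: "g \<in> A0"
  note gc = A0_cont_auto[OF g]
  have "compose (carrier G) f g \<in> cont_auto G"
  proof (rule cont_autoI)
    show "compose (carrier G) f g \<in> hom G G"
      using hom_compose[OF cont_autoD(1)[OF gc] cont_autoD(1)[OF fc]] by simp
    show "continuous_map (topo G) (topo G) (compose (carrier G) f g)"
      by (rule continuous_map_eq[OF continuous_map_compose[OF cont_autoD(2)[OF gc] cont_autoD(2)[OF fc]]])
        (simp add: compose_def)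
    show "bij_betw (compose (carrier G) f g) (carrier G) (carrier G)"
      using bij_betw_compose[OF cont_autoD(4)[OF gc] cont_autoD(4)[OF fc]] .
  qed (simp add: compose_def)
  moreover have "frattini G #> compose (carrier G) f g k = frattini G #> k" if k: "k \<in> carrier G" for k
  proof -
    have "frattini G #> f (g k) = frattini G #> g k"
      using f cont_auto_closed[OF gc k] unfolding A0_def by blast
    also have "\<dots> = frattini G #> k" using g k unfolding A0_def by blast
    finally show ?thesis using k by (simp add: compose_def)
  qed
  ultimately have "compose (carrier G) f g \<in> A0" unfolding A0_def by blast
  then show "f \<otimes>\<^bsub>BijGroup (carrier G)\<^esub> g \<in> A0" using A0_mult[OF f g] by simp
qed

lemma group_Aut0: "group (Aut0 G)"
proof -
  interpret B: group "(BijGroup (carrier G))\<lparr>carrier := A0\<rparr>"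
    by (rule subgroup.subgroup_is_group[OF subgroup_A0 group_BijGroup])
  show ?thesis
  proof (rule groupI)
    fix f assume "f \<in> carrier (Aut0 G)"
    then show "\<exists>g\<in>carrier (Aut0 G). g \<otimes>\<^bsub>Aut0 G\<^esub> f = \<one>\<^bsub>Aut0 G\<^esub>"
      using B.l_inv_ex[of f] by (simp add: BijGroup_def)
  qed (use B.m_closed B.one_closed B.m_assoc B.l_one in \<open>simp_all add: BijGroup_def\<close>)
qed

lemma inv_Aut0:
  assumes "f \<in> A0"
  shows "inv\<^bsub>Aut0 G\<^esub> f = restrict (inv_into (carrier G) f) (carrier G)"
proof -
  have "inv\<^bsub>Aut0 G\<^esub> f = inv\<^bsub>(BijGroup (carrier G))\<lparr>carrier := A0\<rparr>\<^esub> f"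
    by (simp add: m_inv_def BijGroup_def)
  also have "\<dots> = inv\<^bsub>BijGroup (carrier G)\<^esub> f"
    using group.m_inv_consistent[OF group_BijGroup subgroup_A0 assms] .
  also have "\<dots> = restrict (inv_into (carrier G) f) (carrier G)"
    using inv_BijGroup[OF cont_autoD(5)[OF A0_cont_auto[OF assms]]] by simp
  finally show ?thesis .
qed

lemma Aut0_mult_apply:
  assumes "f \<in> A0" "g \<in> A0" "k \<in> carrier G"
  shows "(f \<otimes>\<^bsub>Aut0 G\<^esub> g) k = f (g k)"
  using A0_mult[OF assms(1,2)] assms(3) by (simp add: compose_def)

lemma Aut0_inv_apply:
  assumes "f \<in> A0" "k \<in> carrier G"
  shows "f ((inv\<^bsub>Aut0 G\<^esub> f) k) = k" "(inv\<^bsub>Aut0 G\<^esub> f) (f k) = k"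
  using cont_auto_inv(2,3)[OF A0_cont_auto[OF assms(1)] assms(2)] inv_Aut0[OF assms(1)] by simp_all

lemma A0_eqI:
  assumes "f \<in> A0" "g \<in> A0" "\<And>k. k \<in> carrier G \<Longrightarrow> f k = g k"
  shows "f = g"
  using cont_autoD(3)[OF A0_cont_auto] assms by (metis extensionalityI)

lemma topspace_Aut0: "topspace (topo (Aut0 G)) = A0"
  using A0_cont_auto by (auto simp: topspace_aut_topo)

lemma openin_Aut0_nbhd:
  "N \<lhd> G \<Longrightarrow> openin (topo G) N \<Longrightarrow> openin (topo (Aut0 G)) (nbhd f N \<inter> A0)"
  using openin_nbhd by (auto simp: openin_subtopology)

lemma openin_Aut0D:
  assumes "openin (topo (Aut0 G)) U" "f \<in> U"
  obtains N where "N \<lhd> G" "openin (topo G) N" "nbhd f N \<inter> A0 \<subseteq> U"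
proof -
  obtain V where V: "openin (aut_topo G) V" "U = V \<inter> A0"
    using assms(1) by (auto simp: openin_subtopology)
  then obtain N where "N \<lhd> G" "openin (topo G) N" "nbhd f N \<subseteq> V"
    using assms(2) unfolding openin_aut_topo_iff by blast
  then show ?thesis using that V(2) by blast
qed

lemma normal_open_preimage:
  assumes f: "f \<in> cont_auto G" and N: "N \<lhd> G" "openin (topo G) N"
  shows "{k \<in> carrier G. f k \<in> N} \<lhd> G" "openin (topo G) {k \<in> carrier G. f k \<in> N}"
proof -
  note fD = cont_autoD[OF f]
  interpret f: group_hom G G f using fD(1) is_group by (simp add: group_hom_def group_hom_axioms_def)
  show "{k \<in> carrier G. f k \<in> N} \<lhd> G"
  proof (rule normal_invI[OF f.subgroup_preimage[OF normal_imp_subgroup[OF N(1)]]])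
    show "g \<otimes> h \<otimes> inv g \<in> {k \<in> carrier G. f k \<in> N}"
      if "g \<in> carrier G" "h \<in> {k \<in> carrier G. f k \<in> N}" for g h
      using that normal.inv_op_closed2[OF N(1)] by simp
  qed
  show "openin (topo G) {k \<in> carrier G. f k \<in> N}" using openin_preimage[OF fD(2) N(2)] by simp
qed

lemma topological_group_Aut0: "topological_group (Aut0 G)"
  unfolding topological_group_def
proof (intro conjI)
  let ?T = "topo (Aut0 G)"
  show "group (Aut0 G)" by (rule group_Aut0)
  then interpret A: group "Aut0 G" .
  show "topspace ?T = carrier (Aut0 G)" using topspace_Aut0 by simp
  have mc: "f \<otimes>\<^bsub>Aut0 G\<^esub> g \<in> A0" if "f \<in> A0" "g \<in> A0" for f g using A.m_closed that by simp
  have ic: "inv\<^bsub>Aut0 G\<^esub> f \<in> A0" if "f \<in> A0" for f using A.inv_closed that by simp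
  show "continuous_map (prod_topology ?T ?T) ?T (\<lambda>(f, g). f \<otimes>\<^bsub>Aut0 G\<^esub> g)"
    unfolding continuous_map_eq_topcontinuous_at
  proof
    fix z assume "z \<in> topspace (prod_topology ?T ?T)"
    then obtain f g where z: "z = (f, g)" "f \<in> A0" "g \<in> A0"
      by (auto simp: topspace_Aut0 simp del: Aut0_simps)
    show "topcontinuous_at (prod_topology ?T ?T) ?T (\<lambda>(f, g). f \<otimes>\<^bsub>Aut0 G\<^esub> g) z"
      unfolding topcontinuous_at_def
    proof (intro conjI allI impI)
      show "z \<in> topspace (prod_topology ?T ?T)" by fact
      show "(\<lambda>(f, g). f \<otimes>\<^bsub>Aut0 G\<^esub> g) \<in> topspace (prod_topology ?T ?T) \<rightarrow> topspace ?T"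
        unfolding topspace_prod_topology topspace_Aut0 using mc by auto
      fix V assume V: "openin ?T V \<and> (case z of (f, g) \<Rightarrow> f \<otimes>\<^bsub>Aut0 G\<^esub> g) \<in> V"
      then obtain N where N: "N \<lhd> G" "openin (topo G) N" "nbhd (f \<otimes>\<^bsub>Aut0 G\<^esub> g) N \<inter> A0 \<subseteq> V"
        using openin_Aut0D z(1) by (metis case_prod_conv)
      have Ns: "subgroup N G" by (rule normal_imp_subgroup[OF N(1)])
      note fc = A0_cont_auto[OF z(2)] and gc = A0_cont_auto[OF z(3)]
      interpret f: group_hom G G f using cont_autoD(1)[OF fc] is_group by (simp add: group_hom_def group_hom_axioms_def)
      \<comment> \<open>\<open>N\<close> may fail to be invariant under \<open>f\<close>, so the
        second factor is controlled modulo the preimage of \<open>N\<close>.\<close>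
      let ?N = "{k \<in> carrier G. f k \<in> N}"
      note N' = normal_open_preimage[OF fc N(1,2)]
      let ?U = "(nbhd f N \<inter> A0) \<times> (nbhd g ?N \<inter> A0)"
      have "openin (prod_topology ?T ?T) ?U"
        using openin_Aut0_nbhd[OF N(1,2)] openin_Aut0_nbhd[OF N'] by (simp add: openin_prod_Times_iff)
      moreover have "z \<in> ?U" using z fc gc by (simp add: nbhd_def)
      moreover have "f' \<otimes>\<^bsub>Aut0 G\<^esub> g' \<in> V" if fg: "f' \<in> nbhd f N \<inter> A0" "g' \<in> nbhd g ?N \<inter> A0" for f' g'
      proof -
        have A: "f' \<in> A0" "g' \<in> A0" using fg by auto
        note gc' = A0_cont_auto[OF A(2)]
        have "N #> (f' \<otimes>\<^bsub>Aut0 G\<^esub> g') k = N #> (f \<otimes>\<^bsub>Aut0 G\<^esub> g) k" if k: "k \<in> carrier G" for k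
        proof -
          have gk: "g k \<in> carrier G" "g' k \<in> carrier G" using cont_auto_closed gc gc' k by auto
          have "N #> f' (g' k) = N #> f (g' k)" using fg(1) gk by (simp add: nbhd_def)
          also have "?N #> g' k = ?N #> g k" using fg(2) k by (simp add: nbhd_def)
          then have "g' k \<otimes> inv (g k) \<in> ?N"
            using rcoset_eq_iff[OF normal_imp_subgroup[OF N'(1)] gk(2,1)] by simp
          then have "f (g' k) \<otimes> inv (f (g k)) \<in> N" using gk by simp
          then have "N #> f (g' k) = N #> f (g k)" using rcoset_eq_iff[OF Ns] gk by simp
          finally show ?thesis using Aut0_mult_apply[OF A k] Aut0_mult_apply[OF z(2,3) k] by simp
        qed
        then have "f' \<otimes>\<^bsub>Aut0 G\<^esub> g' \<in> nbhd (f \<otimes>\<^bsub>Aut0 G\<^esub> g) N \<inter> A0"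
          using mc[OF A] A0_cont_auto by (simp add: nbhd_def)
        then show ?thesis using N(3) by blast
      qed
      ultimately show "\<exists>U. openin (prod_topology ?T ?T) U \<and> z \<in> U \<and>
          (\<forall>w\<in>U. (case w of (f, g) \<Rightarrow> f \<otimes>\<^bsub>Aut0 G\<^esub> g) \<in> V)"
        by (intro exI[of _ ?U]) auto
    qed
  qed
  show "continuous_map ?T ?T (\<lambda>f. inv\<^bsub>Aut0 G\<^esub> f)"
    unfolding continuous_map_eq_topcontinuous_at
  proof
    fix f assume "f \<in> topspace ?T"
    then have f: "f \<in> A0" unfolding topspace_Aut0 .
    note fc = A0_cont_auto[OF f]
    show "topcontinuous_at ?T ?T (\<lambda>f. inv\<^bsub>Aut0 G\<^esub> f) f"
      unfolding topcontinuous_at_def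
    proof (intro conjI allI impI)
      show "f \<in> topspace ?T" by fact
      show "(\<lambda>f. inv\<^bsub>Aut0 G\<^esub> f) \<in> topspace ?T \<rightarrow> topspace ?T"
        unfolding topspace_Aut0 using ic by auto
      fix V assume V: "openin ?T V \<and> inv\<^bsub>Aut0 G\<^esub> f \<in> V"
      let ?h = "inv\<^bsub>Aut0 G\<^esub> f"
      obtain N where N: "N \<lhd> G" "openin (topo G) N" "nbhd ?h N \<inter> A0 \<subseteq> V"
        using openin_Aut0D V by metis
      have Ns: "subgroup N G" by (rule normal_imp_subgroup[OF N(1)])
      note hc = A0_cont_auto[OF ic[OF f]]
      interpret h: group_hom G G ?h using cont_autoD(1)[OF hc] is_group by (simp add: group_hom_def group_hom_axioms_def)
      \<comment> \<open>If \<open>f'\<close> is close to \<open>f\<close> modulo this preimage and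
        \<open>h'\<close> is the inverse of \<open>f'\<close>, then \<open>k = f' (h' k)\<close> is
        close to \<open>f (h' k)\<close>, and applying \<open>?h\<close> compares
        \<open>?h k\<close> with \<open>h' k\<close> modulo \<open>N\<close>.\<close>
      let ?N = "{k \<in> carrier G. ?h k \<in> N}"
      note N' = normal_open_preimage[OF hc N(1,2)]
      let ?U = "nbhd f ?N \<inter> A0"
      have "openin ?T ?U" by (rule openin_Aut0_nbhd[OF N'])
      moreover have "f \<in> ?U" using f fc by (simp add: nbhd_def)
      moreover have "inv\<^bsub>Aut0 G\<^esub> f' \<in> V" if f': "f' \<in> ?U" for f'
      proof -
        have A: "f' \<in> A0" using f' by simp
        let ?h' = "inv\<^bsub>Aut0 G\<^esub> f'"
        note hc' = A0_cont_auto[OF ic[OF A]]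
        have "N #> ?h' k = N #> ?h k" if k: "k \<in> carrier G" for k
        proof -
          have m: "?h' k \<in> carrier G" "f (?h' k) \<in> carrier G" "?h k \<in> carrier G"
            using cont_auto_closed[OF hc' k] cont_auto_closed[OF fc] cont_auto_closed[OF hc k] by auto
          have "?N #> f' (?h' k) = ?N #> f (?h' k)" using f' m(1) by (simp add: nbhd_def)
          then have "?N #> k = ?N #> f (?h' k)" using Aut0_inv_apply(1)[OF A k] by simp
          then have "k \<otimes> inv (f (?h' k)) \<in> ?N"
            using rcoset_eq_iff[OF normal_imp_subgroup[OF N'(1)] k m(2)] by simp
          then have "?h k \<otimes> inv (?h (f (?h' k))) \<in> N" using k m by simp
          then have "?h k \<otimes> inv (?h' k) \<in> N" using Aut0_inv_apply(2)[OF f m(1)] by simp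
          then show ?thesis using rcoset_eq_iff[OF Ns m(3,1)] by simp
        qed
        then have "?h' \<in> nbhd ?h N \<inter> A0" using ic[OF A] hc' by (simp add: nbhd_def)
        then show ?thesis using N(3) by blast
      qed
      ultimately show "\<exists>U. openin ?T U \<and> f \<in> U \<and> (\<forall>g\<in>U. inv\<^bsub>Aut0 G\<^esub> g \<in> V)" by blast
    qed
  qed
qed

lemma A0_separated:
  assumes "f \<in> A0" "g \<in> A0" "f \<noteq> g"
  obtains N where "N \<lhd> G" "openin (topo G) N" "g \<notin> nbhd f N"
proof -
  obtain k where k: "k \<in> carrier G" "f k \<noteq> g k" using A0_eqI[OF assms(1,2)] assms(3) by blast
  have "f k \<in> carrier G" "g k \<in> carrier G" using cont_auto_closed[OF A0_cont_auto] assms k by auto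
  then obtain N where "N \<lhd> G" "openin (topo G) N" "N #> f k \<noteq> N #> g k"
    using eq_if_rcosets_eq k(2) by blast
  then show ?thesis using k by (intro that[of N]) (auto simp: nbhd_def)
qed

lemma Hausdorff_Aut0: "Hausdorff_space (topo (Aut0 G))"
  unfolding Hausdorff_space_def topspace_Aut0
proof (intro allI impI)
  fix f g assume fg: "f \<in> A0 \<and> g \<in> A0 \<and> f \<noteq> g"
  then obtain N where N: "N \<lhd> G" "openin (topo G) N" "g \<notin> nbhd f N" using A0_separated by metis
  have gc: "f \<in> cont_auto G" "g \<in> cont_auto G" using fg A0_cont_auto by auto
  have "f \<in> nbhd f N \<inter> A0" "g \<in> nbhd g N \<inter> A0" using fg gc by (auto simp: nbhd_def)
  moreover have "disjnt (nbhd f N \<inter> A0) (nbhd g N \<inter> A0)"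
    using N(3) gc by (auto simp: nbhd_def disjnt_iff)
  ultimately show "\<exists>U V. openin (topo (Aut0 G)) U \<and> openin (topo (Aut0 G)) V \<and> f \<in> U \<and> g \<in> V \<and> disjnt U V"
    using openin_Aut0_nbhd[OF N(1,2)] by blast
qed

text \<open>For a fixed \<open>N\<close> the sets \<open>nbhd h N\<close> partition
  \<open>A0\<close> into open pieces, and some \<open>N\<close> puts two given automorphisms into
  different pieces.\<close>

lemma totally_disconnected_Aut0:
  assumes C: "connectedin (topo (Aut0 G)) C" shows "\<exists>f. C \<subseteq> {f}"
proof (cases "C = {}")
  case False
  then obtain f where f: "f \<in> C" by blast
  have CA: "C \<subseteq> A0" using connectedin_subset_topspace[OF C] unfolding topspace_Aut0 .
  have "g = f" if g: "g \<in> C" for g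
  proof (rule ccontr)
    assume "g \<noteq> f"
    then obtain N where N: "N \<lhd> G" "openin (topo G) N" "g \<notin> nbhd f N"
      using A0_separated[of f g] f g CA by blast
    let ?V = "\<Union>h \<in> A0 - nbhd f N. nbhd h N \<inter> A0"
    have o: "openin (topo (Aut0 G)) (nbhd f N \<inter> A0)" "openin (topo (Aut0 G)) ?V"
      using openin_Aut0_nbhd[OF N(1,2)] by (blast intro: openin_Union)+
    have self: "h \<in> nbhd h N" if "h \<in> A0" for h using A0_cont_auto[OF that] by (simp add: nbhd_def)
    have cov: "C \<subseteq> (nbhd f N \<inter> A0) \<union> ?V" using CA self by blast
    have "(nbhd f N \<inter> A0) \<inter> ?V = {}"
    proof -
      have "h \<in> nbhd f N" if "k \<in> nbhd f N" "k \<in> nbhd h N" "h \<in> A0" for h k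
        using that A0_cont_auto by (simp add: nbhd_def)
      then show ?thesis by blast
    qed
    then have disj: "(nbhd f N \<inter> A0) \<inter> ?V \<inter> C = {}" by blast
    have "(nbhd f N \<inter> A0) \<inter> C \<noteq> {}" using f CA self by blast
    moreover have "?V \<inter> C \<noteq> {}" using g N(3) CA self by blast
    ultimately show False using connectedinD[OF C o cov disj] by blast
  qed
  then show ?thesis by blast
qed simp

end

section \<open>Automorphisms of a free pro-p group of rank two\<close>

locale free_pro_p_two = pro_p +
  fixes x y :: 'a
  assumes free: "free_pro_p_on p G {x, y}" and distinct: "x \<noteq> y"
begin

lemma generators: "top_generates G {x, y}"
  using free by (simp add: free_pro_p_on_def)

lemma x_closed [simp]: "x \<in> carrier G" and y_closed [simp]: "y \<in> carrier G"
  using generators by (auto simp: top_generates_def)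

lemma extend_finite:
  assumes "group P" "card (carrier P) = p ^ n" "u \<in> carrier P" "v \<in> carrier P"
  obtains h where "h \<in> hom G P" "locally_constant (topo G) h" "h x = u" "h y = v"
proof -
  let ?\<phi> = "\<lambda>z. if z = x then u else v"
  obtain h where "h \<in> hom G P" "locally_constant (topo G) h" "\<And>z. z \<in> {x, y} \<Longrightarrow> h z = ?\<phi> z"
    by (rule free_pro_p_extend_finite[OF free prime_p assms(1,2), of ?\<phi>]) (use assms in auto)
  then show ?thesis using that[of h] distinct by auto
qed

text \<open>The restriction is there because elements of \<open>cont_auto\<close> are
  extensional.\<close>

definition endo :: "'a \<Rightarrow> 'a \<Rightarrow> 'a \<Rightarrow> 'a" where
  "endo u v = restrict (SOME f. f \<in> hom G G \<and> continuous_map (topo G) (topo G) f \<and> f x = u \<and> f y = v) (carrier G)"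

lemma endo:
  assumes "u \<in> carrier G" "v \<in> carrier G"
  shows "endo u v \<in> hom G G" "continuous_map (topo G) (topo G) (endo u v)" "endo u v x = u" "endo u v y = v"
    "endo u v \<in> extensional (carrier G)"
proof -
  let ?P = "\<lambda>f. f \<in> hom G G \<and> continuous_map (topo G) (topo G) f \<and> f x = u \<and> f y = v"
  let ?\<phi> = "\<lambda>z. if z = x then u else v"
  have conv: "converges_to_one {x, y} ?\<phi> G"
    unfolding converges_to_one_def by (auto intro: finite_subset[of _ "{x, y}"])
  obtain f where "f \<in> hom G G" "continuous_map (topo G) (topo G) f" "\<And>z. z \<in> {x, y} \<Longrightarrow> f z = ?\<phi> z"
    by (rule free_pro_p_extend[OF free pro_p _ _ conv, of Inl]) (use assms in auto)
  then have "\<exists>f. ?P f" using distinct by (intro exI[of _ f]) auto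
  then have P: "?P (SOME f. ?P f)" by (rule someI_ex)
  then show "endo u v \<in> hom G G" by (simp add: endo_def hom_def Pi_def)
  show "continuous_map (topo G) (topo G) (endo u v)"
    by (rule continuous_map_eq[of _ _ "SOME f. ?P f"]) (use P in \<open>simp_all add: endo_def\<close>)
  show "endo u v x = u" "endo u v y = v" "endo u v \<in> extensional (carrier G)"
    using P by (simp_all add: endo_def)
qed

lemma endo_eq:
  assumes "f \<in> hom G G" "continuous_map (topo G) (topo G) f" "f \<in> extensional (carrier G)"
  shows "endo (f x) (f y) = f"
proof -
  have c: "f x \<in> carrier G" "f y \<in> carrier G" using hom_in_carrier[OF assms(1)] by auto
  note e = endo[OF c]
  have "endo (f x) (f y) g = f g" if "g \<in> carrier G" for g
    by (rule hom_eq_endo[OF generators e(1,2) assms(1,2) _ that]) (use e in auto)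
  then show ?thesis using e(5) assms(3) by (metis extensionalityI)
qed

text \<open>Triviality modulo the Frattini subgroup on the generators gives surjectivity, and a
  surjective continuous endomorphism of a finitely generated pro-p group is injective. Thus
  \<open>A0\<close> is parametrised by pairs from two Frattini cosets, on which its compactness and
  the count of cosets rest.\<close>

lemma endo_in_A0:
  assumes u: "u \<in> frattini G #> x" and v: "v \<in> frattini G #> y"
  shows "endo u v \<in> A0"
proof -
  have Fs: "subgroup (frattini G) G" by (rule subgroup_frattini)
  have c: "u \<in> carrier G" "v \<in> carrier G"
    using r_coset_subset_G[OF subgroup.subset[OF Fs]] u v x_closed y_closed by blast+
  let ?f = "endo u v"
  note e = endo[OF c]
  interpret f: group_hom G G ?f using e(1) is_group by (simp add: group_hom_def group_hom_axioms_def)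
  have triv: "?f z \<in> frattini G #> z" if "z \<in> {x, y}" for z using that u v e by auto
  have surj: "?f ` carrier G = carrier G"
    by (rule surj_endo_if_trivial_mod_frattini[OF generators e(1,2) triv])
  have "inj_on ?f (carrier G)" by (rule surj_endo_inj[OF generators _ e(1,2) surj]) simp
  with surj have ca: "?f \<in> cont_auto G" by (intro cont_autoI e) (simp add: bij_betw_def)
  interpret \<pi>: group_hom G "G Mod frattini G" "\<lambda>g. frattini G #> g" by (rule quotient_hom[OF normal_frattini])
  let ?E = "{g \<in> carrier G. frattini G #> ?f g = frattini G #> g}"
  have hom: "frattini G #> ?f (g \<otimes> h) = (frattini G #> ?f g) \<otimes>\<^bsub>G Mod frattini G\<^esub> (frattini G #> ?f h)"
    if "g \<in> carrier G" "h \<in> carrier G" for g h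
    using that by (simp only: f.hom_mult f.hom_closed \<pi>.hom_mult)
  have homi: "frattini G #> ?f (inv g) = inv\<^bsub>G Mod frattini G\<^esub> (frattini G #> ?f g)"
    if "g \<in> carrier G" for g
    using that by (simp only: f.hom_inv f.hom_closed \<pi>.hom_inv)
  have sub: "subgroup ?E G"
  proof (rule subgroup.intro)
    show "g \<otimes> h \<in> ?E" if "g \<in> ?E" "h \<in> ?E" for g h
      using that hom[of g h] \<pi>.hom_mult[of g h] by (simp del: mult_FactGroup)
    show "inv g \<in> ?E" if "g \<in> ?E" for g
      using that homi[of g] \<pi>.hom_inv[of g] by (simp del: f.hom_inv)
  qed auto
  have "?E = {g \<in> topspace (topo G). ?f g \<otimes> inv g \<in> frattini G}"
    using rcoset_eq_iff[OF Fs f.hom_closed] by auto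
  moreover have "closedin (topo G) {g \<in> topspace (topo G). ?f g \<otimes> inv g \<in> frattini G}"
    by (rule closedin_continuous_map_preimage[OF continuous_map_mult[OF e(2) continuous_map_inv[OF continuous_map_id[unfolded id_def]]] closedin_frattini])
  ultimately have cl: "closedin (topo G) ?E" by simp
  have "z \<in> ?E" if "z \<in> {x, y}" for z
    using repr_independence[OF triv[OF that] _ Fs] that by auto
  then have "topo G closure_of generate G {x, y} \<subseteq> ?E" by (intro closed_gen_minimal[OF sub cl]) auto
  then have "?E = carrier G" using generators by (auto simp: top_generates_def)
  then show ?thesis using ca unfolding A0_def by blast
qed

lemma A0_values:
  assumes "f \<in> A0"
  shows "f x \<in> frattini G #> x" "f y \<in> frattini G #> y" "f = endo (f x) (f y)"
proof -
  have c: "f z \<in> carrier G" if "z \<in> carrier G" for z using cont_auto_closed[OF A0_cont_auto[OF assms] that] .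
  have "f z \<in> frattini G #> z" if z: "z \<in> carrier G" for z
    using assms rcos_self[OF c[OF z] subgroup_frattini] z by (simp add: A0_def)
  then show "f x \<in> frattini G #> x" "f y \<in> frattini G #> y" by simp_all
  note fD = cont_autoD[OF A0_cont_auto[OF assms]]
  show "f = endo (f x) (f y)" using endo_eq[OF fD(1-3)] by simp
qed

section \<open>Compactness and indices of open normal subgroups: \<open>Aut0 G\<close> is a pro-p
  group\<close>

lemma rcoset_determined:
  assumes N: "N \<lhd> G" "openin (topo G) N" and f: "f \<in> hom G G" "continuous_map (topo G) (topo G) f"
    and h: "h \<in> hom G G" "continuous_map (topo G) (topo G) h"
    and eq: "N #> f x = N #> h x" "N #> f y = N #> h y" and k: "k \<in> carrier G"
  shows "N #> f k = N #> h k"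
proof -
  interpret \<pi>: group_hom G "G Mod N" "\<lambda>g. N #> g" by (rule quotient_hom[OF N(1)])
  note lc = locally_constant_rcoset[OF normal_imp_subgroup[OF N(1)] N(2)]
  show ?thesis
    by (rule hom_eq_on_generators[OF generators \<pi>.H.is_group
          locally_constant_finite_hom_endo[OF f \<pi>.homh lc] locally_constant_finite_hom_endo[OF h \<pi>.homh lc] _ k])
      (use eq in auto)
qed

lemma nbhd_iff:
  assumes N: "N \<lhd> G" "openin (topo G) N" and f: "f \<in> A0" and h: "h \<in> A0"
  shows "h \<in> nbhd f N \<longleftrightarrow> N #> h x = N #> f x \<and> N #> h y = N #> f y"
proof
  assume "N #> h x = N #> f x \<and> N #> h y = N #> f y"
  then show "h \<in> nbhd f N"
    using rcoset_determined[OF N cont_autoD(1,2)[OF A0_cont_auto[OF h]] cont_autoD(1,2)[OF A0_cont_auto[OF f]]]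
      A0_cont_auto[OF h] by (simp add: nbhd_def)
qed (simp add: nbhd_def)

text \<open>The parametrisation by \<open>endo\<close> is continuous, and its domain is a product of
  two cosets of a closed subgroup of a compact group.\<close>

lemma compact_Aut0: "compact_space (topo (Aut0 G))"
proof -
  let ?Z = "(frattini G #> x) \<times> (frattini G #> y)"
  let ?P = "prod_topology (topo G) (topo G)"
  have Fs: "subgroup (frattini G) G" by (rule subgroup_frattini)
  have sub: "frattini G #> z \<subseteq> carrier G" if "z \<in> carrier G" for z
    using r_coset_subset_G[OF subgroup.subset[OF Fs] that] .
  have cl: "compactin (topo G) (frattini G #> z)" if z: "z \<in> carrier G" for z
  proof (rule closedin_compact_space[OF compact])
    have "frattini G #> z = {g \<in> topspace (topo G). g \<otimes> inv z \<in> frattini G}"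
    proof (intro equalityI subsetI)
      fix g assume g: "g \<in> frattini G #> z"
      then have gc: "g \<in> carrier G" using sub[OF z] by blast
      then show "g \<in> {g \<in> topspace (topo G). g \<otimes> inv z \<in> frattini G}"
        using repr_independence[OF g z Fs] rcoset_eq_iff[OF Fs gc z] by simp
    next
      fix g assume "g \<in> {g \<in> topspace (topo G). g \<otimes> inv z \<in> frattini G}"
      then have gc: "g \<in> carrier G" and "frattini G #> g = frattini G #> z"
        using rcoset_eq_iff[OF Fs _ z] by auto
      then show "g \<in> frattini G #> z" using rcos_self[OF gc Fs] by simp
    qed
    moreover have "closedin (topo G) {g \<in> topspace (topo G). g \<otimes> inv z \<in> frattini G}"
      by (rule closedin_continuous_map_preimage[OF continuous_map_mult[OF continuous_map_id[unfolded id_def] continuous_map_const_carrier] closedin_frattini])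
        (use z in simp)
    ultimately show "closedin (topo G) (frattini G #> z)" by simp
  qed
  have cZ: "compactin ?P ?Z" using cl[OF x_closed] cl[OF y_closed] by (simp add: compactin_Times)
  then have cZ': "compact_space (subtopology ?P ?Z)" by (rule compact_space_subtopology)
  have tsZ: "topspace (subtopology ?P ?Z) = ?Z"
    using sub[OF x_closed] sub[OF y_closed] by auto
  have im: "(\<lambda>(u, v). endo u v) ` ?Z = A0"
    using endo_in_A0 A0_values by (fastforce simp: image_iff)
  have "continuous_map (subtopology ?P ?Z) (topo (Aut0 G)) (\<lambda>(u, v). endo u v)"
    unfolding continuous_map_eq_topcontinuous_at
  proof
    fix z assume z: "z \<in> topspace (subtopology ?P ?Z)"
    then obtain u v where uv: "z = (u, v)" "u \<in> frattini G #> x" "v \<in> frattini G #> y"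
      unfolding tsZ by blast
    have uvc: "u \<in> carrier G" "v \<in> carrier G" using uv sub[OF x_closed] sub[OF y_closed] by auto
    show "topcontinuous_at (subtopology ?P ?Z) (topo (Aut0 G)) (\<lambda>(u, v). endo u v) z"
      unfolding topcontinuous_at_def
    proof (intro conjI allI impI z)
      show "(\<lambda>(u, v). endo u v) \<in> topspace (subtopology ?P ?Z) \<rightarrow> topspace (topo (Aut0 G))"
        unfolding tsZ topspace_Aut0 using im by blast
      fix V assume V: "openin (topo (Aut0 G)) V \<and> (case z of (u, v) \<Rightarrow> endo u v) \<in> V"
      then obtain N where N: "N \<lhd> G" "openin (topo G) N" "nbhd (endo u v) N \<inter> A0 \<subseteq> V"
        using openin_Aut0D uv(1) by (metis case_prod_conv)
      have Ns: "subgroup N G" by (rule normal_imp_subgroup[OF N(1)])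
      let ?U = "((N #> u) \<times> (N #> v)) \<inter> ?Z"
      have "openin (subtopology ?P ?Z) ?U"
        unfolding openin_subtopology
        by (rule exI[of _ "(N #> u) \<times> (N #> v)"])
          (simp add: openin_prod_Times_iff openin_rcoset[OF N(2)] uvc)
      moreover have "z \<in> ?U" using uv rcos_self[OF _ Ns] uvc by simp
      moreover have "endo u' v' \<in> V" if uv': "(u', v') \<in> ?U" for u' v'
      proof -
        have c': "u' \<in> carrier G" "v' \<in> carrier G" using uv' sub[OF x_closed] sub[OF y_closed] by auto
        have "N #> u' = N #> u" "N #> v' = N #> v"
          using repr_independence[OF _ _ Ns] uv' uvc by auto
        then have "endo u' v' \<in> nbhd (endo u v) N"
          using nbhd_iff[OF N(1,2) endo_in_A0[OF uv(2,3)], of "endo u' v'"] endo_in_A0 uv'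
            endo(3,4)[OF uvc] endo(3,4)[OF c'] by simp
        then show ?thesis using N(3) endo_in_A0 uv' by blast
      qed
      ultimately show "\<exists>U. openin (subtopology ?P ?Z) U \<and> z \<in> U \<and> (\<forall>w\<in>U. (case w of (u, v) \<Rightarrow> endo u v) \<in> V)"
        by (intro exI[of _ ?U]) auto
    qed
  qed
  then have "compactin (topo (Aut0 G)) ((\<lambda>(u, v). endo u v) ` ?Z)"
    using image_compactin cZ' by (metis compact_space_def tsZ)
  then show ?thesis unfolding im compact_space_def topspace_Aut0 .
qed

text \<open>The automorphisms that are trivial modulo a suitable open normal \<open>N\<close> form a
  subgroup inside \<open>\<N>\<close>, and \<open>\<tau>\<close> tells its right cosets apart. So
  the index of \<open>\<N>\<close> divides the number of values of \<open>\<tau>\<close>, which is a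
  power of \<open>p\<close>.\<close>

lemma card_rcosets_Aut0:
  assumes \<N>: "\<N> \<lhd> Aut0 G" "openin (topo (Aut0 G)) \<N>"
  shows "\<exists>k. card (rcosets\<^bsub>Aut0 G\<^esub> \<N>) = p ^ k"
proof -
  interpret A: group "Aut0 G" by (rule group_Aut0)
  have \<N>s: "subgroup \<N> (Aut0 G)" by (rule normal_imp_subgroup[OF \<N>(1)])
  have \<N>A: "\<N> \<subseteq> A0" using subgroup.subset[OF \<N>s] by simp
  obtain N where N: "N \<lhd> G" "openin (topo G) N" "nbhd \<one>\<^bsub>Aut0 G\<^esub> N \<inter> A0 \<subseteq> \<N>"
    using openin_Aut0D[OF \<N>(2) subgroup.one_closed[OF \<N>s]] .
  have Ns: "subgroup N G" by (rule normal_imp_subgroup[OF N(1)])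
  interpret \<pi>: group_hom G "G Mod N" "\<lambda>g. N #> g" by (rule quotient_hom[OF N(1)])
  define \<tau> where "\<tau> f = (N #> f x, N #> f y)" for f :: "'a \<Rightarrow> 'a"
  define D where "D = \<tau> ` A0"
  have c: "f z \<in> carrier G" if "f \<in> A0" "z \<in> carrier G" for f z
    using cont_auto_closed[OF A0_cont_auto[OF that(1)] that(2)] .
  have mc: "f \<otimes>\<^bsub>Aut0 G\<^esub> g \<in> A0" if "f \<in> A0" "g \<in> A0" for f g using A.m_closed that by simp
  have ic: "inv\<^bsub>Aut0 G\<^esub> f \<in> A0" if "f \<in> A0" for f using A.inv_closed that by simp
  have tau_eq: "\<tau> f = \<tau> g \<longleftrightarrow> f \<in> nbhd g N" if "f \<in> A0" "g \<in> A0" for f g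
    using nbhd_iff[OF N(1,2) that(2,1)] by (simp add: \<tau>_def)
  have tau_mult: "\<tau> (f \<otimes>\<^bsub>Aut0 G\<^esub> h) = \<tau> (g \<otimes>\<^bsub>Aut0 G\<^esub> h)" if "f \<in> A0" "g \<in> A0" "h \<in> A0" "\<tau> f = \<tau> g" for f g h
    using that(4) tau_eq[OF that(1,2)] c[OF that(3)] Aut0_mult_apply[OF that(1,3)] Aut0_mult_apply[OF that(2,3)]
    by (simp add: \<tau>_def nbhd_def)
  have tau_mult_iff: "\<tau> (f \<otimes>\<^bsub>Aut0 G\<^esub> h) = \<tau> (g \<otimes>\<^bsub>Aut0 G\<^esub> h) \<longleftrightarrow> \<tau> f = \<tau> g" if "f \<in> A0" "g \<in> A0" "h \<in> A0" for f g h
  proof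
    assume fg: "\<tau> (f \<otimes>\<^bsub>Aut0 G\<^esub> h) = \<tau> (g \<otimes>\<^bsub>Aut0 G\<^esub> h)"
    have eq: "\<tau> ((f \<otimes>\<^bsub>Aut0 G\<^esub> h) \<otimes>\<^bsub>Aut0 G\<^esub> inv\<^bsub>Aut0 G\<^esub> h) = \<tau> ((g \<otimes>\<^bsub>Aut0 G\<^esub> h) \<otimes>\<^bsub>Aut0 G\<^esub> inv\<^bsub>Aut0 G\<^esub> h)"
      by (rule tau_mult[OF mc[OF that(1,3)] mc[OF that(2,3)] ic[OF that(3)] fg])
    have canc: "(k \<otimes>\<^bsub>Aut0 G\<^esub> h) \<otimes>\<^bsub>Aut0 G\<^esub> inv\<^bsub>Aut0 G\<^esub> h = k" if k: "k \<in> A0" for k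
      using A.m_assoc[of k h "inv\<^bsub>Aut0 G\<^esub> h"] A.r_inv[of h] A.r_one[of k] ic k \<open>h \<in> A0\<close>
      by (simp del: Aut0_simps(2,3))
    show "\<tau> f = \<tau> g" using eq unfolding canc[OF that(1)] canc[OF that(2)] .
  qed (rule tau_mult[OF that])
  have one: "\<one>\<^bsub>Aut0 G\<^esub> \<in> A0" using A.one_closed by simp
  have tau_\<N>: "f \<otimes>\<^bsub>Aut0 G\<^esub> inv\<^bsub>Aut0 G\<^esub> g \<in> \<N>" if "f \<in> A0" "g \<in> A0" "\<tau> f = \<tau> g" for f g
  proof -
    have "\<tau> (f \<otimes>\<^bsub>Aut0 G\<^esub> inv\<^bsub>Aut0 G\<^esub> g) = \<tau> (g \<otimes>\<^bsub>Aut0 G\<^esub> inv\<^bsub>Aut0 G\<^esub> g)"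
      by (intro tau_mult ic that)
    also have "g \<otimes>\<^bsub>Aut0 G\<^esub> inv\<^bsub>Aut0 G\<^esub> g = \<one>\<^bsub>Aut0 G\<^esub>" using A.r_inv that(2) by simp
    finally show ?thesis using tau_eq[OF mc[OF that(1) ic[OF that(2)]] one] N(3) mc[OF that(1) ic[OF that(2)]] by blast
  qed
  \<comment> \<open>By the parametrisation, the two values can be prescribed independently, each in
    the image of a Frattini coset in \<open>G Mod N\<close>. Such an image is a translate of a
    subgroup of a finite p-group.\<close>
  have "\<tau> ` A0 = (\<lambda>u. N #> u) ` (frattini G #> x) \<times> (\<lambda>u. N #> u) ` (frattini G #> y)"
  proof (intro equalityI subsetI)
    fix z assume "z \<in> \<tau> ` A0"
    then obtain f where "f \<in> A0" "z = \<tau> f" by blast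
    then show "z \<in> (\<lambda>u. N #> u) ` (frattini G #> x) \<times> (\<lambda>u. N #> u) ` (frattini G #> y)"
      using A0_values by (simp add: \<tau>_def)
  next
    fix z assume "z \<in> (\<lambda>u. N #> u) ` (frattini G #> x) \<times> (\<lambda>u. N #> u) ` (frattini G #> y)"
    then obtain u v where uv: "u \<in> frattini G #> x" "v \<in> frattini G #> y" "z = (N #> u, N #> v)" by blast
    have "u \<in> carrier G" "v \<in> carrier G"
      using r_coset_subset_G[OF subgroup.subset[OF subgroup_frattini]] uv x_closed y_closed by blast+
    then have "z = \<tau> (endo u v)" using uv endo(3,4) by (simp add: \<tau>_def)
    then show "z \<in> \<tau> ` A0" using endo_in_A0[OF uv(1,2)] by blast
  qed
  moreover obtain a where a: "card ((\<lambda>u. N #> u) ` frattini G) = p ^ a"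
  proof -
    obtain b where "card (carrier (G Mod N)) = p ^ b" using card_rcosets[OF N(1,2)] by (auto simp: FactGroup_def)
    moreover have "card (rcosets\<^bsub>G Mod N\<^esub> ((\<lambda>u. N #> u) ` frattini G)) * card ((\<lambda>u. N #> u) ` frattini G) = card (carrier (G Mod N))"
      using \<pi>.H.lagrange[OF \<pi>.subgroup_img_is_subgroup[OF subgroup_frattini]] by (simp add: order_def)
    ultimately show ?thesis using that divides_primepow_nat[OF prime_p] by (metis dvd_triv_right)
  qed
  moreover have "card ((\<lambda>u. N #> u) ` (frattini G #> z)) = p ^ a" if z: "z \<in> carrier G" for z
  proof -
    have Fc: "k \<in> carrier G" if "k \<in> frattini G" for k using that by (simp add: frattini_def)
    let ?m = "\<lambda>C. C \<otimes>\<^bsub>G Mod N\<^esub> (N #> z)"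
    have "(\<lambda>u. N #> u) ` (frattini G #> z) = (\<lambda>k. N #> (k \<otimes> z)) ` frattini G" by (auto simp: r_coset_def)
    also have "\<dots> = (\<lambda>k. ?m (N #> k)) ` frattini G"
      by (rule image_cong[OF refl]) (simp only: \<pi>.hom_mult[OF Fc z])
    also have "\<dots> = ?m ` ((\<lambda>k. N #> k) ` frattini G)" by (simp only: image_image)
    finally have "card ((\<lambda>u. N #> u) ` (frattini G #> z)) = card (?m ` ((\<lambda>k. N #> k) ` frattini G))" by simp
    also have "\<dots> = p ^ a"
    proof (subst card_image)
      show "inj_on ?m ((\<lambda>k. N #> k) ` frattini G)"
      proof (rule inj_on_subset)
        show "inj_on ?m (carrier (G Mod N))"
          using \<pi>.H.inj_on_multc \<pi>.hom_closed[OF z] by blast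
        show "(\<lambda>k. N #> k) ` frattini G \<subseteq> carrier (G Mod N)" using \<pi>.hom_closed Fc by blast
      qed
    qed (rule a)
    finally show ?thesis .
  qed
  ultimately have cardD: "card D = p ^ (a + a)"
    by (simp add: D_def card_cartesian_product power_add)
  then have finD: "finite D" using prime_p by (metis card.infinite power_not_zero not_prime_0)
  let ?R = "rcosets\<^bsub>Aut0 G\<^esub> \<N>"
  have RA: "C \<subseteq> A0" if "C \<in> ?R" for C
    using subgroup.rcosets_carrier[OF \<N>s A.is_group that] by simp
  have UR: "\<Union>?R = A0" using A.rcosets_part_G[OF \<N>s] by simp
  have sep: "C = C'" if C: "C \<in> ?R" "C' \<in> ?R" and fg: "f \<in> C" "g \<in> C'" "\<tau> f = \<tau> g" for C C' f g
  proof -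
    have fgA: "f \<in> A0" "g \<in> A0" using RA C fg by auto
    obtain h h' where h: "h \<in> carrier (Aut0 G)" "C = \<N> #>\<^bsub>Aut0 G\<^esub> h" "h' \<in> carrier (Aut0 G)" "C' = \<N> #>\<^bsub>Aut0 G\<^esub> h'"
      using C by (auto simp: RCOSETS_def)
    have Cf: "C = \<N> #>\<^bsub>Aut0 G\<^esub> f" using A.repr_independence[OF _ h(1) \<N>s] fg(1) h(2) by simp
    have Cg: "C' = \<N> #>\<^bsub>Aut0 G\<^esub> g" using A.repr_independence[OF _ h(3) \<N>s] fg(2) h(4) by simp
    have "f \<in> \<N> #>\<^bsub>Aut0 G\<^esub> g"
      using subgroup.rcos_module_rev[OF \<N>s A.is_group, of g f] tau_\<N>[OF fgA fg(3)] fgA by simp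
    then show ?thesis using A.repr_independence[OF _ _ \<N>s, of f g] Cf Cg fgA by simp
  qed
  have inj: "inj_on ((`) \<tau>) ?R"
  proof (rule inj_onI)
    fix C C' assume C: "C \<in> ?R" "C' \<in> ?R" "\<tau> ` C = \<tau> ` C'"
    obtain f where f: "f \<in> C" using subgroup.rcosets_non_empty[OF \<N>s C(1)] by blast
    then have "\<tau> f \<in> \<tau> ` C'" using C(3) by blast
    then obtain g where "g \<in> C'" "\<tau> f = \<tau> g" by blast
    then show "C = C'" using sep[OF C(1,2) f] by blast
  qed
  have U: "\<Union>((`) \<tau> ` ?R) = D" unfolding D_def UR[symmetric] by blast
  have finI: "finite ((`) \<tau> ` ?R)"
    using finD U by (metis finite_UnionD)
  have "card (\<tau> ` \<N>) * card ((`) \<tau> ` ?R) = card (\<Union>((`) \<tau> ` ?R))"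
  proof (rule card_partition[OF finI])
    show "finite (\<Union>((`) \<tau> ` ?R))" unfolding U by (rule finD)
    fix S assume "S \<in> (`) \<tau> ` ?R"
    then obtain h where h: "h \<in> A0" "S = \<tau> ` (\<N> #>\<^bsub>Aut0 G\<^esub> h)" by (auto simp: RCOSETS_def)
    have S: "S = (\<lambda>f. \<tau> (f \<otimes>\<^bsub>Aut0 G\<^esub> h)) ` \<N>" unfolding h(2) by (auto simp: r_coset_def simp del: Aut0_simps)
    \<comment> \<open>Right multiplication by \<open>h\<close> respects the fibres of
      \<open>\<tau>\<close>, so it descends to the values; \<open>SOME\<close> merely picks a
      representative. All cosets of \<open>\<N>\<close> therefore have equally many values.\<close>
    define \<sigma> where "\<sigma> d = \<tau> ((SOME f. f \<in> \<N> \<and> \<tau> f = d) \<otimes>\<^bsub>Aut0 G\<^esub> h)" for d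
    have \<sigma>: "\<sigma> (\<tau> f) = \<tau> (f \<otimes>\<^bsub>Aut0 G\<^esub> h)" if "f \<in> \<N>" for f
    proof -
      have "\<exists>g. g \<in> \<N> \<and> \<tau> g = \<tau> f" using that by blast
      then have "(SOME g. g \<in> \<N> \<and> \<tau> g = \<tau> f) \<in> \<N> \<and> \<tau> (SOME g. g \<in> \<N> \<and> \<tau> g = \<tau> f) = \<tau> f" by (rule someI_ex)
      then show ?thesis unfolding \<sigma>_def using tau_mult_iff[OF _ _ h(1)] \<N>A that by blast
    qed
    have "S = \<sigma> ` (\<tau> ` \<N>)" unfolding S image_image using \<sigma> by (intro image_cong) auto
    moreover have "inj_on \<sigma> (\<tau> ` \<N>)"
    proof (rule inj_onI)
      fix d e assume "d \<in> \<tau> ` \<N>" "e \<in> \<tau> ` \<N>" "\<sigma> d = \<sigma> e"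
      then obtain f g where fg: "f \<in> \<N>" "g \<in> \<N>" "d = \<tau> f" "e = \<tau> g" by blast
      then have "\<tau> (f \<otimes>\<^bsub>Aut0 G\<^esub> h) = \<tau> (g \<otimes>\<^bsub>Aut0 G\<^esub> h)" using \<open>\<sigma> d = \<sigma> e\<close> \<sigma> by simp
      then show "d = e" using tau_mult_iff[OF _ _ h(1)] \<N>A fg by blast
    qed
    ultimately show "card S = card (\<tau> ` \<N>)" by (simp add: card_image)
  next
    fix S S' assume SS: "S \<in> (`) \<tau> ` ?R" "S' \<in> (`) \<tau> ` ?R" "S \<noteq> S'"
    then obtain C C' where C: "C \<in> ?R" "C' \<in> ?R" "S = \<tau> ` C" "S' = \<tau> ` C'" by blast
    show "S \<inter> S' = {}"
    proof (rule ccontr)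
      assume "S \<inter> S' \<noteq> {}"
      then obtain d where "d \<in> \<tau> ` C" "d \<in> \<tau> ` C'" using C(3,4) by blast
      then obtain f g where "f \<in> C" "g \<in> C'" "\<tau> f = \<tau> g" by (metis imageE)
      then show False using sep[OF C(1,2)] C SS(3) by blast
    qed
  qed
  then have "card ?R dvd p ^ (a + a)"
    using card_image[OF inj] cardD U by (metis dvd_triv_right)
  then show ?thesis using divides_primepow_nat[OF prime_p] by blast
qed

theorem pro_p_Aut0: "pro_p_group p (Aut0 G)"
  unfolding pro_p_group_def profinite_group_def
  using topological_group_Aut0 compact_Aut0 Hausdorff_Aut0 totally_disconnected_Aut0 card_rcosets_Aut0 by blast

end

section \<open>Finite p-groups of matrices over the integers modulo a prime power\<close>

type_synonym hexa = "int \<times> int \<times> int \<times> int \<times> int \<times> int"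
type_synonym quad = "int \<times> int \<times> int \<times> int"
type_synonym twist = "int \<times> int \<times> int \<times> int \<times> int \<times> int \<times> int \<times> int"

text \<open>Restricting diagonal entries to units that are 1 modulo \<open>p\<close> keeps the
  matrix groups of p-power order.\<close>

definition one_units :: "int \<Rightarrow> int \<Rightarrow> int set" where
  "one_units p m = {a \<in> {0..<m}. a mod p = 1}"

text \<open>
  In matrix form: \<open>(A\<^sub>1, A\<^sub>2, w\<^sub>1, w\<^sub>2, q, w)\<close> stands for the upper triangular matrix with
  diagonal \<open>(A\<^sub>1 A\<^sub>2, A\<^sub>2, 1)\<close> and upper entries \<open>A\<^sub>2 w\<^sub>1\<close>, \<open>w\<^sub>2\<close>, \<open>q\<close>, together with the affine map
  \<open>t \<mapsto> A\<^sub>1 A\<^sub>2 t + w\<close>.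
\<close>

fun hexa_prod :: "hexa \<Rightarrow> hexa \<Rightarrow> hexa" where
  "hexa_prod (A1, A2, w1, w2, q, w) (B1, B2, u1, u2, r, u) =
     (A1 * B1, A2 * B2, w1 + A1 * u1, w2 + A2 * u2, q + A1 * A2 * r + A2 * w1 * u2, w + A1 * A2 * u)"

fun hexa_red :: "int \<Rightarrow> hexa \<Rightarrow> hexa" where
  "hexa_red m (A1, A2, w1, w2, q, w) = (A1 mod m, A2 mod m, w1 mod m, w2 mod m, q mod m, w mod m)"

definition hexa_group :: "int \<Rightarrow> int \<Rightarrow> hexa monoid" where
  "hexa_group p m = \<lparr>carrier = one_units p m \<times> one_units p m \<times> {0..<m} \<times> {0..<m} \<times> {0..<m} \<times> {0..<m},
     mult = (\<lambda>g h. hexa_red m (hexa_prod g h)), one = (1, 1, 0, 0, 0, 0)\<rparr>"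

text \<open>The quadruple \<open>(d, v, z, c)\<close> stands for the matrix with rows \<open>(1, z, c)\<close>, \<open>(0, d, v)\<close>, \<open>(0, 0, 1)\<close>.\<close>

fun quad_prod :: "quad \<Rightarrow> quad \<Rightarrow> quad" where
  "quad_prod (d, v, z, c) (d', v', z', c') = (d * d', v + d * v', z' + z * d', c + c' + z * v')"

fun quad_red :: "int \<Rightarrow> quad \<Rightarrow> quad" where
  "quad_red m (d, v, z, c) = (d mod m, v mod m, z mod m, c mod m)"

definition quad_group :: "int \<Rightarrow> int \<Rightarrow> quad monoid" where
  "quad_group p m = \<lparr>carrier = one_units p m \<times> {0..<m} \<times> {0..<m} \<times> {0..<m},
     mult = (\<lambda>g h. quad_red m (quad_prod g h)), one = (1, 0, 0, 0)\<rparr>"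

text \<open>The triangular matrix is conjugated by the diagonal matrix with entries
  \<open>(d1, 1, d1)\<close>, where \<open>d2\<close> is the inverse of \<open>d1\<close>, and then
  by the unipotent matrix with upper entries \<open>a1\<close>, \<open>a2\<close> and corner
  \<open>b\<close>. The affine map is conjugated by \<open>t \<mapsto> d * t + v\<close>. The term
  \<open>z * w\<close> adds a multiple of a cocycle with the same character to the corner.\<close>

fun twist :: "twist \<Rightarrow> hexa \<Rightarrow> hexa" where
  "twist (d1, d2, d, z, a1, a2, b, v) (A1, A2, w1, w2, q, w) =
     (A1, A2, d1 * w1 + (1 - A1) * a1, d2 * w2 + (1 - A2) * a2,
      q + z * w + (1 - A1 * A2) * b + a1 * d2 * w2 - A2 * (d1 * w1 + (1 - A1) * a1) * a2,
      d * w + (1 - A1 * A2) * v)"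

definition twist_map :: "int \<Rightarrow> twist \<Rightarrow> hexa \<Rightarrow> hexa" where
  "twist_map m P g = hexa_red m (twist P g)"

text \<open>The first condition leaves the corner entry unscaled and makes \<open>twist\<close>
  multiplicative modulo \<open>m\<close>; the second makes \<open>d\<close> invertible modulo powers
  of \<open>p\<close>.\<close>

fun twist_ok :: "int \<Rightarrow> int \<Rightarrow> twist \<Rightarrow> bool" where
  "twist_ok p m (d1, d2, d, z, a1, a2, b, v) \<longleftrightarrow> (d1 * d2) mod m = 1 \<and> d mod p = 1"

text \<open>Parameters of the first twist applied after the second. The entries \<open>d\<close>,
  \<open>v\<close>, \<open>z\<close> compose among themselves, and this is the source of the group
  \<open>E / C\<close>.\<close>

fun twist_comp :: "twist \<Rightarrow> twist \<Rightarrow> twist" where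
  "twist_comp (d1, d2, d, z, a1, a2, b, v) (d1', d2', d', z', a1', a2', b', v') =
     (d1 * d1', d2 * d2', d * d', z' + d' * z, a1 + d1 * a1', a2 + d2 * a2',
      b + b' + z * v' + a1 * d2 * a2', v + d * v')"

lemma hexa_prod_red [simp]:
  "hexa_red m (hexa_prod (hexa_red m g) h) = hexa_red m (hexa_prod g h)"
  "hexa_red m (hexa_prod g (hexa_red m h)) = hexa_red m (hexa_prod g h)"
  by (cases g rule: prod_cases6; cases h rule: prod_cases6;
      simp flip: cong_def; auto intro!: cong_add cong_mult)+

lemma quad_prod_red [simp]:
  "quad_red m (quad_prod (quad_red m g) h) = quad_red m (quad_prod g h)"
  "quad_red m (quad_prod g (quad_red m h)) = quad_red m (quad_prod g h)"
  by (cases g rule: prod_cases4; cases h rule: prod_cases4;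
      simp flip: cong_def; auto intro!: cong_add cong_mult)+

lemma hexa_prod_assoc: "hexa_prod (hexa_prod g h) k = hexa_prod g (hexa_prod h k)"
  by (cases g rule: prod_cases6; cases h rule: prod_cases6; cases k rule: prod_cases6)
    (simp add: algebra_simps)

lemma quad_prod_assoc: "quad_prod (quad_prod g h) k = quad_prod g (quad_prod h k)"
  by (cases g rule: prod_cases4; cases h rule: prod_cases4; cases k rule: prod_cases4)
    (simp add: algebra_simps)

lemma mod_eq_if_diff_multiple: "a = b - k * (m * t) \<Longrightarrow> a mod m = b mod m" for a b :: int
  by (simp add: mod_eq_dvd_iff)

lemma twist_cases:
  fixes P :: twist
  obtains d1 d2 d z a1 a2 b v where "P = (d1, d2, d, z, a1, a2, b, v)"
  using that by (cases P rule: prod_cases7) (metis surj_pair)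

lemma twist_red [simp]: "hexa_red m (twist P (hexa_red m g)) = hexa_red m (twist P g)"
proof -
  obtain d1 d2 d z a1 a2 b v where "P = (d1, d2, d, z, a1, a2, b, v)" by (rule twist_cases)
  then show ?thesis
    by (cases g rule: prod_cases6; simp flip: cong_def; auto intro!: cong_add cong_mult cong_diff)
qed

context
  fixes p m :: int and j :: nat
  assumes p: "prime p" and j: "j > 0" and m: "m = p ^ j"
begin

lemma p_gt_1: "p > 1" using p prime_gt_1_int by blast

lemma m_gt_1: "m > 1" using p_gt_1 j m by (simp add: one_less_power)

lemma p_dvd_m: "p dvd m" using j m by (simp add: dvd_power)

lemma card_one_units: "card (one_units p m) = nat p ^ (j - 1)"
proof -
  have mm: "m = p * p ^ (j - 1)" using j m by (metis Suc_diff_1 power_Suc)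
  have "bij_betw (\<lambda>k. 1 + p * k) {0..<p ^ (j - 1)} (one_units p m)"
    unfolding bij_betw_def
  proof
    show "inj_on (\<lambda>k. 1 + p * k) {0..<p ^ (j - 1)}" using p_gt_1 by (auto simp: inj_on_def)
    show "(\<lambda>k. 1 + p * k) ` {0..<p ^ (j - 1)} = one_units p m"
    proof (intro equalityI subsetI)
      fix a assume "a \<in> (\<lambda>k. 1 + p * k) ` {0..<p ^ (j - 1)}"
      then obtain k where k: "0 \<le> k" "k < p ^ (j - 1)" "a = 1 + p * k" by auto
      then have "p * (k + 1) \<le> m" unfolding mm using p_gt_1 by (intro mult_left_mono) auto
      then show "a \<in> one_units p m" using k p_gt_1 by (auto simp: one_units_def algebra_simps)
    next
      fix a assume a: "a \<in> one_units p m"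
      have "a = 1 + p * (a div p)" using a mult_div_mod_eq[of p a] by (simp add: one_units_def)
      moreover have "0 \<le> a div p" using a p_gt_1 by (simp add: one_units_def pos_imp_zdiv_nonneg_iff)
      moreover have "a div p < p ^ (j - 1)"
      proof (rule ccontr)
        assume "\<not> a div p < p ^ (j - 1)"
        then have "p * p ^ (j - 1) \<le> p * (a div p)" using p_gt_1 by (intro mult_left_mono) auto
        then show False using \<open>a = 1 + p * (a div p)\<close> a mm by (simp add: one_units_def)
      qed
      ultimately show "a \<in> (\<lambda>k. 1 + p * k) ` {0..<p ^ (j - 1)}" by auto
    qed
  qed
  then have "card (one_units p m) = card {0..<p ^ (j - 1)}" by (metis bij_betw_same_card)
  then show ?thesis using p_gt_1 by (simp add: nat_power_eq)
qed

lemma one_unit_mult: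
  assumes "a mod p = 1" "b mod p = 1" shows "(a * b) mod m \<in> one_units p m"
proof -
  have "(a * b) mod m mod p = (a * b) mod p" using p_dvd_m by (simp add: mod_mod_cancel)
  also have "\<dots> = (a mod p * (b mod p)) mod p" by (simp add: mod_mult_eq)
  also have "\<dots> = 1" using assms p_gt_1 by simp
  finally show ?thesis using m_gt_1 by (simp add: one_units_def)
qed

lemma one_unit_inverse:
  assumes "a mod p = 1" obtains b where "b \<in> one_units p m" "(b * a) mod m = 1"
proof -
  have "coprime a p"
  proof -
    have "p \<noteq> 0" using p_gt_1 by simp
    moreover have "coprime (a mod p) p" using assms by simp
    ultimately show ?thesis by (metis coprime_mod_left_iff)
  qed
  then have "coprime a m" by (simp add: m)
  then obtain b where "[a * b = 1] (mod m)" using cong_solve_coprime_int by blast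
  then have ab: "(a * b) mod m = 1" using m_gt_1 by (simp add: cong_def)
  then have "(a * b) mod p = 1 mod p" using p_dvd_m by (metis mod_mod_cancel)
  then have "(a mod p * b) mod p = 1" using p_gt_1 by (simp add: mod_mult_left_eq)
  then have "b mod p = 1" using assms by simp
  then have "b mod m \<in> one_units p m" using one_unit_mult[of b 1] p_gt_1 by simp
  moreover have "(b mod m * a) mod m = 1" using ab by (simp add: mod_simps mult.commute)
  ultimately show ?thesis by (rule that)
qed

lemma one_units_mod: "a \<in> one_units p m \<Longrightarrow> a mod p = 1" "a \<in> one_units p m \<Longrightarrow> a mod m = a"
  by (auto simp: one_units_def)

lemma one_in_one_units: "1 \<in> one_units p m" using p_gt_1 m_gt_1 by (simp add: one_units_def)

lemma hexa_red_carrier: "g \<in> carrier (hexa_group p m) \<Longrightarrow> hexa_red m g = g"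
  by (cases g rule: prod_cases6) (auto simp: hexa_group_def one_units_def)

lemma quad_red_carrier: "g \<in> carrier (quad_group p m) \<Longrightarrow> quad_red m g = g"
  by (cases g rule: prod_cases4) (auto simp: quad_group_def one_units_def)

lemma mod_mult_eq_one: "(b * a) mod m = 1 \<Longrightarrow> (b * a * k) mod m = k mod m"
  by (metis mod_mult_left_eq mult_1)

lemma group_hexa: "group (hexa_group p m)"
proof (rule groupI)
  show "\<one>\<^bsub>hexa_group p m\<^esub> \<in> carrier (hexa_group p m)"
    using one_in_one_units m_gt_1 by (simp add: hexa_group_def)
  fix g assume g: "g \<in> carrier (hexa_group p m)"
  obtain A1 A2 w1 w2 q w where gg: "g = (A1, A2, w1, w2, q, w)" by (metis prod_cases6)
  show "\<one>\<^bsub>hexa_group p m\<^esub> \<otimes>\<^bsub>hexa_group p m\<^esub> g = g"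
    using hexa_red_carrier[OF g] by (simp add: gg hexa_group_def)
  obtain B1 where B1: "B1 \<in> one_units p m" "(B1 * A1) mod m = 1"
    using g one_unit_inverse[of A1] by (auto simp: gg hexa_group_def one_units_def)
  obtain B2 where B2: "B2 \<in> one_units p m" "(B2 * A2) mod m = 1"
    using g one_unit_inverse[of A2] by (auto simp: gg hexa_group_def one_units_def)
  let ?k = "(B1, B2, - B1 * w1, - B2 * w2, - B1 * B2 * q + B1 * B2 * w1 * w2, - B1 * B2 * w)"
  let ?h = "hexa_red m ?k"
  have "?h \<in> carrier (hexa_group p m)" using B1 B2 m_gt_1 by (simp add: hexa_group_def one_units_mod)
  moreover have "hexa_red m (hexa_prod ?k g) = (1, 1, 0, 0, 0, 0)"
    using B1 B2 by (simp add: gg algebra_simps)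
  then have "?h \<otimes>\<^bsub>hexa_group p m\<^esub> g = \<one>\<^bsub>hexa_group p m\<^esub>"
    by (simp add: hexa_group_def del: hexa_red.simps hexa_prod.simps)
  ultimately show "\<exists>h\<in>carrier (hexa_group p m). h \<otimes>\<^bsub>hexa_group p m\<^esub> g = \<one>\<^bsub>hexa_group p m\<^esub>" by blast
  fix h assume h: "h \<in> carrier (hexa_group p m)"
  obtain B1 B2 u1 u2 r u where hh: "h = (B1, B2, u1, u2, r, u)" by (metis prod_cases6)
  show "g \<otimes>\<^bsub>hexa_group p m\<^esub> h \<in> carrier (hexa_group p m)"
    using g h m_gt_1 by (simp add: gg hh hexa_group_def one_unit_mult one_units_mod)
  fix k assume k: "k \<in> carrier (hexa_group p m)"
  show "g \<otimes>\<^bsub>hexa_group p m\<^esub> h \<otimes>\<^bsub>hexa_group p m\<^esub> k = g \<otimes>\<^bsub>hexa_group p m\<^esub> (h \<otimes>\<^bsub>hexa_group p m\<^esub> k)"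
    by (simp add: hexa_group_def hexa_prod_assoc)
qed

lemma card_hexa: "card (carrier (hexa_group p m)) = nat p ^ (2 * (j - 1) + 4 * j)"
proof -
  have e: "2 * (j - 1) + 4 * j = (j - 1) + ((j - 1) + (j + (j + (j + j))))" by simp
  have "nat m = nat p ^ j" using m p_gt_1 by (simp add: nat_power_eq)
  then show ?thesis
    unfolding e power_add by (simp add: hexa_group_def card_cartesian_product card_one_units)
qed

lemma group_quad: "group (quad_group p m)"
proof (rule groupI)
  show "\<one>\<^bsub>quad_group p m\<^esub> \<in> carrier (quad_group p m)"
    using one_in_one_units m_gt_1 by (simp add: quad_group_def)
  fix g assume g: "g \<in> carrier (quad_group p m)"
  obtain d v z c where gg: "g = (d, v, z, c)" by (metis prod_cases4)
  show "\<one>\<^bsub>quad_group p m\<^esub> \<otimes>\<^bsub>quad_group p m\<^esub> g = g"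
    using quad_red_carrier[OF g] by (simp add: gg quad_group_def)
  obtain b where b: "b \<in> one_units p m" "(b * d) mod m = 1"
    using g one_unit_inverse[of d] by (auto simp: gg quad_group_def one_units_def)
  let ?k = "(b, - b * v, - z * b, - c + z * b * v)"
  let ?h = "quad_red m ?k"
  have "?h \<in> carrier (quad_group p m)" using b m_gt_1 by (simp add: quad_group_def one_units_mod)
  moreover have "(z - b * d * z) mod m = 0"
    using mod_diff_cong[OF refl mod_mult_eq_one[OF b(2)], of z z] by simp
  then have "quad_red m (quad_prod ?k g) = (1, 0, 0, 0)"
    using b by (simp add: gg algebra_simps)
  then have "?h \<otimes>\<^bsub>quad_group p m\<^esub> g = \<one>\<^bsub>quad_group p m\<^esub>"
    by (simp add: quad_group_def del: quad_red.simps quad_prod.simps)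
  ultimately show "\<exists>h\<in>carrier (quad_group p m). h \<otimes>\<^bsub>quad_group p m\<^esub> g = \<one>\<^bsub>quad_group p m\<^esub>" by blast
  fix h assume h: "h \<in> carrier (quad_group p m)"
  obtain d' v' z' c' where hh: "h = (d', v', z', c')" by (metis prod_cases4)
  show "g \<otimes>\<^bsub>quad_group p m\<^esub> h \<in> carrier (quad_group p m)"
    using g h m_gt_1 by (simp add: gg hh quad_group_def one_unit_mult one_units_mod)
  fix k assume k: "k \<in> carrier (quad_group p m)"
  show "g \<otimes>\<^bsub>quad_group p m\<^esub> h \<otimes>\<^bsub>quad_group p m\<^esub> k = g \<otimes>\<^bsub>quad_group p m\<^esub> (h \<otimes>\<^bsub>quad_group p m\<^esub> k)"
    by (simp add: quad_group_def quad_prod_assoc)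
qed

lemma card_quad: "card (carrier (quad_group p m)) = nat p ^ ((j - 1) + 3 * j)"
proof -
  have e: "(j - 1) + 3 * j = (j - 1) + (j + (j + j))" by simp
  have "nat m = nat p ^ j" using m p_gt_1 by (simp add: nat_power_eq)
  then show ?thesis
    unfolding e power_add by (simp add: quad_group_def card_cartesian_product card_one_units)
qed

lemma twist_map_closed:
  assumes "g \<in> carrier (hexa_group p m)" shows "twist_map m P g \<in> carrier (hexa_group p m)"
proof -
  obtain A1 A2 w1 w2 q w where "g = (A1, A2, w1, w2, q, w)" by (metis prod_cases6)
  moreover obtain d1 d2 d z a1 a2 b v where "P = (d1, d2, d, z, a1, a2, b, v)" by (rule twist_cases)
  ultimately show ?thesis using assms m_gt_1 by (simp add: twist_map_def hexa_group_def one_units_mod)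
qed

text \<open>All coordinates agree as polynomials except the corner, where the two sides differ by
  \<open>A2 * w1 * u2 * (d1 * d2 - 1)\<close>.\<close>

lemma twist_map_hom:
  assumes P: "twist_ok p m P" and g: "g \<in> carrier (hexa_group p m)" and h: "h \<in> carrier (hexa_group p m)"
  shows "twist_map m P (g \<otimes>\<^bsub>hexa_group p m\<^esub> h) = twist_map m P g \<otimes>\<^bsub>hexa_group p m\<^esub> twist_map m P h"
proof -
  obtain A1 A2 w1 w2 q w where gg: "g = (A1, A2, w1, w2, q, w)" by (metis prod_cases6)
  obtain B1 B2 u1 u2 r u where hh: "h = (B1, B2, u1, u2, r, u)" by (metis prod_cases6)
  obtain d1 d2 d z a1 a2 b v where PP: "P = (d1, d2, d, z, a1, a2, b, v)" by (rule twist_cases)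
  have "(d1 * d2) mod m = 1 mod m" using P m_gt_1 by (simp add: PP)
  then obtain t where t: "d1 * d2 = 1 + m * t" by (metis add.commute mod_eqE mult.commute)
  have "((q + A1 * A2 * r + A2 * w1 * u2) + z * (w + A1 * A2 * u) + (1 - (A1 * B1) * (A2 * B2)) * b
       + a1 * d2 * (w2 + A2 * u2) - (A2 * B2) * (d1 * (w1 + A1 * u1) + (1 - A1 * B1) * a1) * a2)
     = (q + z * w + (1 - A1 * A2) * b + a1 * d2 * w2 - A2 * (d1 * w1 + (1 - A1) * a1) * a2)
       + A1 * A2 * (r + z * u + (1 - B1 * B2) * b + a1 * d2 * u2 - B2 * (d1 * u1 + (1 - B1) * a1) * a2)
       + A2 * (d1 * w1 + (1 - A1) * a1) * (d2 * u2 + (1 - B2) * a2) - A2 * w1 * u2 * (d1 * d2 - 1)"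
    by algebra
  also have "d1 * d2 - 1 = m * t" using t by simp
  finally have q: "((q + A1 * A2 * r + A2 * w1 * u2) + z * (w + A1 * A2 * u) + (1 - (A1 * B1) * (A2 * B2)) * b
       + a1 * d2 * (w2 + A2 * u2) - (A2 * B2) * (d1 * (w1 + A1 * u1) + (1 - A1 * B1) * a1) * a2) mod m
     = ((q + z * w + (1 - A1 * A2) * b + a1 * d2 * w2 - A2 * (d1 * w1 + (1 - A1) * a1) * a2)
       + A1 * A2 * (r + z * u + (1 - B1 * B2) * b + a1 * d2 * u2 - B2 * (d1 * u1 + (1 - B1) * a1) * a2)
       + A2 * (d1 * w1 + (1 - A1) * a1) * (d2 * u2 + (1 - B2) * a2)) mod m"
    by (rule mod_eq_if_diff_multiple)
  have "hexa_red m (twist P (hexa_prod g h)) = hexa_red m (hexa_prod (twist P g) (twist P h))"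
    using q by (simp add: gg hh PP) (simp add: algebra_simps)
  then show ?thesis by (simp add: hexa_group_def twist_map_def)
qed

text \<open>Again only the corner uses \<open>d1 * d2 = 1\<close>. The summand \<open>z * v'\<close>
  of the new \<open>b\<close> arises because \<open>z\<close> is applied to a \<open>w\<close>
  already shifted by a multiple of \<open>v'\<close>.\<close>

lemma twist_map_comp:
  assumes P: "twist_ok p m P" "twist_ok p m P'" and g: "g \<in> carrier (hexa_group p m)"
  shows "twist_map m P (twist_map m P' g) = twist_map m (twist_comp P P') g"
proof -
  obtain A1 A2 w1 w2 q w where gg: "g = (A1, A2, w1, w2, q, w)" by (metis prod_cases6)
  obtain d1 d2 d z a1 a2 b v where PP: "P = (d1, d2, d, z, a1, a2, b, v)" by (rule twist_cases)
  obtain d1' d2' d' z' a1' a2' b' v' where PP': "P' = (d1', d2', d', z', a1', a2', b', v')" by (rule twist_cases)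
  have "(d1 * d2) mod m = 1 mod m" using P m_gt_1 by (simp add: PP)
  then obtain t where t: "d1 * d2 = 1 + m * t" by (metis add.commute mod_eqE mult.commute)
  define W1 where "W1 = d1' * w1 + (1 - A1) * a1'"
  define W2 where "W2 = d2' * w2 + (1 - A2) * a2'"
  define W where "W = d' * w + (1 - A1 * A2) * v'"
  define Q where "Q = q + z' * w + (1 - A1 * A2) * b' + a1' * d2' * w2 - A2 * W1 * a2'"
  have "Q + z * W + (1 - A1 * A2) * b + a1 * d2 * W2 - A2 * (d1 * W1 + (1 - A1) * a1) * a2
    = q + (z' + d' * z) * w + (1 - A1 * A2) * (b + b' + z * v' + a1 * d2 * a2')
      + (a1 + d1 * a1') * (d2 * d2') * w2
      - A2 * (d1 * d1' * w1 + (1 - A1) * (a1 + d1 * a1')) * (a2 + d2 * a2')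
      - (d1 * d2 - 1) * (a1' * d2' * w2 - A2 * W1 * a2')"
    unfolding Q_def W_def W2_def W1_def by algebra
  also have "d1 * d2 - 1 = m * t" using t by simp
  finally have q: "(Q + z * W + (1 - A1 * A2) * b + a1 * d2 * W2 - A2 * (d1 * W1 + (1 - A1) * a1) * a2) mod m
    = (q + (z' + d' * z) * w + (1 - A1 * A2) * (b + b' + z * v' + a1 * d2 * a2')
      + (a1 + d1 * a1') * (d2 * d2') * w2
      - A2 * (d1 * d1' * w1 + (1 - A1) * (a1 + d1 * a1')) * (a2 + d2 * a2')) mod m"
    by (simp add: mod_eq_dvd_iff)
  have "hexa_red m (twist P (twist P' g)) = hexa_red m (twist (twist_comp P P') g)"
    using q unfolding Q_def W_def W2_def W1_def by (simp add: gg PP PP') (simp add: algebra_simps)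
  then show ?thesis by (simp add: twist_map_def)
qed

lemma twist_ok_comp: "twist_ok p m P \<Longrightarrow> twist_ok p m P' \<Longrightarrow> twist_ok p m (twist_comp P P')"
proof -
  assume P: "twist_ok p m P" "twist_ok p m P'"
  obtain d1 d2 d z a1 a2 b v where PP: "P = (d1, d2, d, z, a1, a2, b, v)" by (rule twist_cases)
  obtain d1' d2' d' z' a1' a2' b' v' where PP': "P' = (d1', d2', d', z', a1', a2', b', v')" by (rule twist_cases)
  have "(d1 * d1' * (d2 * d2')) mod m = ((d1 * d2) mod m * ((d1' * d2') mod m)) mod m"
    by (simp add: mod_simps) (simp add: algebra_simps)
  moreover have "(d * d') mod p = (d mod p * (d' mod p)) mod p" by (simp add: mod_simps)
  ultimately show ?thesis using P m_gt_1 p_gt_1 by (simp add: PP PP')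
qed

lemma twist_inverse:
  assumes P: "twist_ok p m P"
  obtains P' where "twist_ok p m P'" "\<And>g. g \<in> carrier (hexa_group p m) \<Longrightarrow> twist_map m P' (twist_map m P g) = g"
proof -
  obtain d1 d2 d z a1 a2 b v where PP: "P = (d1, d2, d, z, a1, a2, b, v)" by (rule twist_cases)
  have ok: "(d1 * d2) mod m = 1" "d mod p = 1" using P by (simp_all add: PP)
  obtain e where e: "e \<in> one_units p m" "(e * d) mod m = 1" using one_unit_inverse[OF ok(2)] .
  \<comment> \<open>Modulo \<open>m\<close>, \<open>d2\<close> inverts \<open>d1\<close> and
    \<open>e\<close> inverts \<open>d\<close>. The remaining entries solve
    \<open>twist_comp P' P\<close> for zero; \<open>a1\<close>, \<open>a2\<close>, \<open>b\<close>,
    \<open>v\<close> cancel exactly, and \<open>z\<close> cancels modulo \<open>m\<close>.\<close>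
  define P' :: twist where "P' = (d2, d1, e, - e * z, - d2 * a1, - d1 * a2, - b + e * z * v + d2 * a1 * d1 * a2, - e * v)"
  have P': "twist_ok p m P'" using ok(1) one_units_mod(1)[OF e(1)] by (simp add: P'_def mult.commute)
  have comp: "twist_comp P' P = (d2 * d1, d1 * d2, e * d, z - d * (e * z), 0, 0, 0, 0)"
    by (simp add: P'_def PP algebra_simps)
  have "twist_map m P' (twist_map m P g) = g" if g: "g \<in> carrier (hexa_group p m)" for g
  proof -
    obtain A1 A2 w1 w2 q w where gg: "g = (A1, A2, w1, w2, q, w)" by (metis prod_cases6)
    have "(z - e * d * z) mod m = 0"
      using mod_diff_cong[OF refl mod_mult_eq_one[OF e(2)], of z z] by simp
    then have "((z - d * (e * z)) * w) mod m = 0"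
      by (metis mod_mult_left_eq mod_0 mult.assoc mult.commute mult_zero_left)
    then have "(q + (z - d * (e * z)) * w) mod m = q mod m" by (metis add.right_neutral mod_add_right_eq)
    then have "hexa_red m (twist (twist_comp P' P) g) = hexa_red m g"
      using mod_mult_eq_one[OF ok(1)] mod_mult_eq_one[OF e(2)] by (simp add: comp gg mult.commute[of d2 d1])
    then show ?thesis
      using twist_map_comp[OF P' P g] hexa_red_carrier[OF g] by (simp add: twist_map_def)
  qed
  then show ?thesis using that P' by blast
qed

end

section \<open>A subgroup with three generators\<close>

type_synonym tri = "int \<times> int \<times> int"

text \<open>This is \<open>quad_prod\<close> without the entry \<open>c\<close>, that is, the law of
  \<open>E / C\<close>. The triples are never declared as a group, which is why cancellations are
  carried out by hand later.\<close>

fun tri_prod :: "tri \<Rightarrow> tri \<Rightarrow> tri" where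
  "tri_prod (d, v, z) (d', v', z') = (d * d', v + d * v', z' + z * d')"

fun tri_red :: "int \<Rightarrow> tri \<Rightarrow> tri" where
  "tri_red m (d, v, z) = (d mod m, v mod m, z mod m)"

lemma tri_prod_red [simp]:
  "tri_red m (tri_prod (tri_red m g) h) = tri_red m (tri_prod g h)"
  "tri_red m (tri_prod g (tri_red m h)) = tri_red m (tri_prod g h)"
  by (cases g rule: prod_cases3; cases h rule: prod_cases3;
      simp flip: cong_def; auto intro!: cong_add cong_mult)+

context free_pro_p_two
begin

definition inn :: "'a \<Rightarrow> 'a \<Rightarrow> 'a" where
  "inn g = (\<lambda>k \<in> carrier G. g \<otimes> k \<otimes> inv g)"

primrec conjs :: "nat \<Rightarrow> 'a" where
  "conjs 0 = x"
| "conjs (Suc k) = y \<otimes> conjs k \<otimes> inv y"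

definition auto_s :: "'a \<Rightarrow> 'a" where
  "auto_s = endo (x \<otimes> x \<otimes> inv (conjs 1)) y"

definition auto_t :: "'a \<Rightarrow> 'a" where
  "auto_t = endo (x \<otimes> (x \<otimes> conjs 1 \<otimes> inv x \<otimes> inv (conjs 1))) y"

definition autos :: "('a \<Rightarrow> 'a) set" where
  "autos = {inn x, auto_s, auto_t}"

definition witness :: "('a \<Rightarrow> 'a) set" where
  "witness = topo (Aut0 G) closure_of generate (Aut0 G) autos"

lemma conjs_closed [simp]: "conjs k \<in> carrier G"
  by (induction k) auto

text \<open>Right cosets have the Frattini element on the left, whereas \<open>auto_s\<close> and
  \<open>auto_t\<close> multiply \<open>x\<close> by a commutator on the right.\<close>

lemma mult_mem_frattini_rcoset:
  assumes "c \<in> frattini G" "g \<in> carrier G" shows "g \<otimes> c \<in> frattini G #> g"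
proof -
  have c: "c \<in> carrier G" using assms(1) by (simp add: frattini_def)
  have "g \<otimes> c \<otimes> inv g \<in> frattini G" by (rule normal.inv_op_closed2[OF normal_frattini assms(2,1)])
  then have "(g \<otimes> c \<otimes> inv g) \<otimes> g \<in> frattini G #> g" unfolding r_coset_def by blast
  then show ?thesis using c assms(2) by (simp add: word_simps)
qed

lemma y_mem_frattini_rcoset: "y \<in> frattini G #> y"
  by (rule rcos_self[OF y_closed subgroup_frattini])

lemma inn_A0:
  assumes g: "g \<in> carrier G" shows "inn g \<in> A0"
proof -
  have hom: "inn g \<in> hom G G"
    by (rule homI) (use g in \<open>simp_all add: inn_def word_simps\<close>)
  have "continuous_map (topo G) (topo G) (\<lambda>k. g \<otimes> k \<otimes> inv g)"
    using g by (intro continuous_map_mult continuous_map_id[unfolded id_def] continuous_map_const_carrier) simp_all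
  then have cont: "continuous_map (topo G) (topo G) (inn g)"
    by (rule continuous_map_eq) (simp add: inn_def)
  have "inn g k \<in> frattini G #> k" if k: "k \<in> carrier G" for k
  proof -
    have "(g \<otimes> k \<otimes> inv g \<otimes> inv k) \<otimes> k \<in> frattini G #> k"
      unfolding r_coset_def using commutator_in_frattini[OF g k] by blast
    then show ?thesis using g k by (simp add: inn_def word_simps)
  qed
  then have "endo (inn g x) (inn g y) \<in> A0" by (intro endo_in_A0) simp_all
  moreover have "inn g \<in> extensional (carrier G)" by (simp add: inn_def)
  ultimately show ?thesis using endo_eq[OF hom cont] by simp
qed

lemma s_value_closed: "x \<otimes> x \<otimes> inv (conjs 1) \<in> carrier G"
  and t_value_closed: "x \<otimes> (x \<otimes> conjs 1 \<otimes> inv x \<otimes> inv (conjs 1)) \<in> carrier G"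
  using conjs_closed[of 1] x_closed by (simp_all del: conjs.simps One_nat_def)

lemmas auto_s = endo(1-4)[OF s_value_closed y_closed, folded auto_s_def]
lemmas auto_t = endo(1-4)[OF t_value_closed y_closed, folded auto_t_def]

lemma auto_s_A0: "auto_s \<in> A0"
proof -
  have "x \<otimes> x \<otimes> inv (conjs 1) = x \<otimes> (x \<otimes> y \<otimes> inv x \<otimes> inv y)"
    by (simp add: word_simps)
  then have "x \<otimes> x \<otimes> inv (conjs 1) \<in> frattini G #> x"
    using mult_mem_frattini_rcoset[OF commutator_in_frattini[OF x_closed y_closed] x_closed] by simp
  then show ?thesis unfolding auto_s_def by (rule endo_in_A0[OF _ y_mem_frattini_rcoset])
qed

lemma auto_t_A0: "auto_t \<in> A0"
  unfolding auto_t_def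
  by (rule endo_in_A0[OF mult_mem_frattini_rcoset[OF commutator_in_frattini[OF x_closed conjs_closed] x_closed]
        y_mem_frattini_rcoset])

sublocale Aut0: top_group "Aut0 G"
  by (rule top_groupI[OF topological_group_Aut0])

lemma autos_A0: "autos \<subseteq> A0"
  using inn_A0[OF x_closed] auto_s_A0 auto_t_A0 by (simp add: autos_def)

lemma witness_subgroup: "subgroup witness (Aut0 G)"
  unfolding witness_def
  by (rule Aut0.closure_of_subgroup[OF Aut0.generate_is_subgroup]) (simp add: autos_A0)

lemma witness_A0: "n \<in> witness \<Longrightarrow> n \<in> A0"
  using subgroup.mem_carrier[OF witness_subgroup] by simp

lemma autos_witness: "autos \<subseteq> witness"
proof -
  have "generate (Aut0 G) autos \<subseteq> topspace (topo (Aut0 G))"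
    using Aut0.generate_incl[of autos] autos_A0 unfolding topspace_Aut0 by simp
  then have sub: "generate (Aut0 G) autos \<subseteq> witness" unfolding witness_def by (rule closure_of_subset)
  have "autos \<subseteq> generate (Aut0 G) autos" by (rule subsetI) (rule generate.incl)
  then show ?thesis using sub by (rule order_trans)
qed

text \<open>Two automorphisms that agree modulo an open normal subgroup in the kernel of
  \<open>h\<close> have the same value. Conditions on finite images thereby become open conditions
  on automorphisms.\<close>

lemma locally_constant_eval:
  assumes h: "h \<in> hom G P" "group P" "locally_constant (topo G) h" and g: "g \<in> carrier G"
  shows "locally_constant (topo (Aut0 G)) (\<lambda>n. h (n g))"
  unfolding locally_constant_def
proof
  fix a
  interpret h: group_hom G P h using h(1,2) is_group by (simp add: group_hom_def group_hom_axioms_def)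
  let ?N = "{k \<in> topspace (topo G). h k = \<one>\<^bsub>P\<^esub>}"
  have No: "openin (topo G) ?N" using h(3) by (simp add: locally_constant_def del: topspace_eq)
  obtain N where N: "N \<lhd> G" "openin (topo G) N" "N \<subseteq> ?N"
    using open_normal_base[OF profinite No] h.hom_one by auto
  have Ns: "subgroup N G" by (rule normal_imp_subgroup[OF N(1)])
  show "openin (topo (Aut0 G)) {n \<in> topspace (topo (Aut0 G)). h (n g) = a}"
  proof (subst openin_subopen, intro ballI)
    fix n assume "n \<in> {n \<in> topspace (topo (Aut0 G)). h (n g) = a}"
    then have n: "n \<in> A0" "h (n g) = a" unfolding topspace_Aut0 by auto
    have "h (n' g) = a" if n': "n' \<in> nbhd n N \<inter> A0" for n'
    proof -
      have c: "n' g \<in> carrier G" "n g \<in> carrier G"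
        using cont_auto_closed[OF A0_cont_auto g] n n' by auto
      have "N #> n' g = N #> n g" using n' g by (simp add: nbhd_def)
      then have "n' g \<otimes> inv (n g) \<in> N" using rcoset_eq_iff[OF Ns c] by simp
      then have "h (n' g \<otimes> inv (n g)) = \<one>\<^bsub>P\<^esub>" using N(3) by blast
      then have "h (n' g) \<otimes>\<^bsub>P\<^esub> inv\<^bsub>P\<^esub> h (n g) = \<one>\<^bsub>P\<^esub>" using c by simp
      then have "h (n' g) = h (n g)" using c by (metis h.H.inv_equality h.H.inv_inv h.hom_closed h.H.inv_closed)
      then show ?thesis using n(2) by simp
    qed
    moreover have "n \<in> nbhd n N \<inter> A0" using n A0_cont_auto[OF n(1)] by (simp add: nbhd_def)
    ultimately show "\<exists>T. openin (topo (Aut0 G)) T \<and> n \<in> T \<and> T \<subseteq> {n \<in> topspace (topo (Aut0 G)). h (n g) = a}"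
      using openin_Aut0_nbhd[OF N(1,2), of n] unfolding topspace_Aut0 by blast
  qed
qed

end

section \<open>The action of the witness on matrix representations\<close>

locale evaluation_point = free_pro_p_two +
  fixes j :: nat and Y1 Y2 m Y3 :: int
  assumes j: "j > 0" and m_def: "m = int p ^ j"
    and Y1: "Y1 mod int p = 1" and Y2: "Y2 mod int p = 1" and Y12: "((2 - Y1) * (2 - Y2)) mod m = 1"
    and Y3_def: "Y3 = Y1 * Y2"
begin

abbreviation "HG \<equiv> hexa_group (int p) m"

lemma prime_int_p: "prime (int p)" using prime_p by simp

lemmas ctx = prime_int_p j m_def
lemmas m_gt_1 = m_gt_1[OF ctx]

sublocale HG: group HG by (rule group_hexa[OF ctx])

text \<open>With \<open>hy\<close>, this normalises the cocycles as Fox derivatives: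
  \<open>w1\<close>, \<open>w2\<close>, \<open>w\<close> are 1 at \<open>x\<close> and 0 at
  \<open>y\<close>, so at \<open>conjs k\<close> they are the powers \<open>Y1 ^ k\<close>,
  \<open>Y2 ^ k\<close>, \<open>Y3 ^ k\<close>.\<close>

definition hx :: hexa where "hx = (1, 1, 1, 1, 0, 1)"
definition hy :: hexa where "hy = hexa_red m (Y1, Y2, 0, 0, 0, 0)"

lemma hx_closed: "hx \<in> carrier HG" and hy_closed: "hy \<in> carrier HG"
  using one_in_one_units[OF ctx] one_unit_mult[OF ctx Y1, of 1] one_unit_mult[OF ctx Y2, of 1] m_gt_1
    prime_gt_1_int[OF prime_int_p]
  by (simp_all add: hx_def hy_def hexa_group_def)

definition rep :: "'a \<Rightarrow> hexa" where
  "rep = (SOME h. h \<in> hom G HG \<and> locally_constant (topo G) h \<and> h x = hx \<and> h y = hy)"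

lemma rep: "rep \<in> hom G HG" "locally_constant (topo G) rep" "rep x = hx" "rep y = hy"
proof -
  let ?Q = "\<lambda>h. h \<in> hom G HG \<and> locally_constant (topo G) h \<and> h x = hx \<and> h y = hy"
  have "\<exists>h. ?Q h"
    by (rule extend_finite[OF group_hexa[OF ctx] _ hx_closed hy_closed]) (use card_hexa[OF ctx] in auto)
  then have "?Q rep" unfolding rep_def by (rule someI_ex)
  then show "rep \<in> hom G HG" "locally_constant (topo G) rep" "rep x = hx" "rep y = hy" by auto
qed

sublocale rep: group_hom G HG rep
  using rep(1) is_group HG.is_group by (simp add: group_hom_def group_hom_axioms_def)

text \<open>The parameters \<open>P\<close> need not be determined by \<open>n\<close>; only certain
  multiples of their entries are, see \<open>tri_of\<close>.\<close>

definition compatible :: "twist \<Rightarrow> ('a \<Rightarrow> 'a) \<Rightarrow> bool" where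
  "compatible P n \<longleftrightarrow> twist_ok (int p) m P \<and> (\<forall>g \<in> carrier G. rep (n g) = twist_map m P (rep g))"

lemma compatibleI:
  assumes P: "twist_ok (int p) m P" and n: "n \<in> A0"
    and eq: "rep (n x) = twist_map m P hx" "rep (n y) = twist_map m P hy"
  shows "compatible P n"
  unfolding compatible_def
proof (intro conjI ballI P)
  fix g assume g: "g \<in> carrier G"
  note nD = cont_autoD(1,2)[OF A0_cont_auto[OF n]]
  have "(\<lambda>g. twist_map m P (rep g)) \<in> hom G HG"
    by (rule homI) (simp_all add: twist_map_closed[OF ctx] twist_map_hom[OF ctx P])
  moreover have "locally_constant (topo G) (\<lambda>g. twist_map m P (rep g))"
    by (rule locally_constant_compose[OF rep(2)])
  ultimately show "rep (n g) = twist_map m P (rep g)"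
    by (rule hom_eq_on_generators[OF generators HG.is_group locally_constant_finite_hom_endo[OF nD rep(1,2)] _ _ _ g])
      (use eq rep(3,4) in auto)
qed

lemma compatible_mult:
  assumes "compatible P n" "compatible P' n'" "n \<in> A0" "n' \<in> A0"
  shows "compatible (twist_comp P P') (n \<otimes>\<^bsub>Aut0 G\<^esub> n')"
  unfolding compatible_def
proof (intro conjI ballI)
  show "twist_ok (int p) m (twist_comp P P')"
    using assms(1,2) twist_ok_comp[OF ctx] by (simp add: compatible_def)
  fix g assume g: "g \<in> carrier G"
  have "rep ((n \<otimes>\<^bsub>Aut0 G\<^esub> n') g) = rep (n (n' g))" using Aut0_mult_apply[OF assms(3,4) g] by simp
  also have "\<dots> = twist_map m P (twist_map m P' (rep g))"
    using assms(1,2) g cont_auto_closed[OF A0_cont_auto[OF assms(4)] g] by (simp add: compatible_def)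
  also have "\<dots> = twist_map m (twist_comp P P') (rep g)"
    using assms(1,2) g by (intro twist_map_comp[OF ctx]) (simp_all add: compatible_def)
  finally show "rep ((n \<otimes>\<^bsub>Aut0 G\<^esub> n') g) = twist_map m (twist_comp P P') (rep g)" .
qed

lemma compatible_inv:
  assumes "compatible P n" "n \<in> A0" obtains P' where "compatible P' (inv\<^bsub>Aut0 G\<^esub> n)"
proof -
  obtain P' where P': "twist_ok (int p) m P'" "\<And>g. g \<in> carrier HG \<Longrightarrow> twist_map m P' (twist_map m P g) = g"
    using assms(1) twist_inverse[OF ctx] by (metis compatible_def)
  have "compatible P' (inv\<^bsub>Aut0 G\<^esub> n)"
    unfolding compatible_def
  proof (intro conjI ballI P'(1))
    fix g assume g: "g \<in> carrier G"
    let ?k = "(inv\<^bsub>Aut0 G\<^esub> n) g"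
    have "inv\<^bsub>Aut0 G\<^esub> n \<in> A0" using Aut0.inv_closed assms(2) by simp
    then have k: "?k \<in> carrier G" using cont_auto_closed[OF A0_cont_auto g] by simp
    have "rep g = twist_map m P (rep ?k)"
      using assms(1) k Aut0_inv_apply(1)[OF assms(2) g] by (metis compatible_def)
    then show "rep ?k = twist_map m P' (rep g)" using P'(2) rep.hom_closed[OF k] by simp
  qed
  then show ?thesis by (rule that)
qed

definition tame :: "('a \<Rightarrow> 'a) \<Rightarrow> bool" where
  "tame n \<longleftrightarrow> (\<exists>P. compatible P n)"

lemma tameI: "compatible P n \<Longrightarrow> tame n"
  unfolding tame_def by (rule exI)

lemma tame_mult: "tame n \<Longrightarrow> tame n' \<Longrightarrow> n \<in> A0 \<Longrightarrow> n' \<in> A0 \<Longrightarrow> tame (n \<otimes>\<^bsub>Aut0 G\<^esub> n')"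
  using compatible_mult unfolding tame_def by meson

lemma tame_inv: "tame n \<Longrightarrow> n \<in> A0 \<Longrightarrow> tame (inv\<^bsub>Aut0 G\<^esub> n)"
  using compatible_inv unfolding tame_def by meson

lemma compatible_one: "compatible (1, 1, 1, 0, 0, 0, 0, 0) \<one>\<^bsub>Aut0 G\<^esub>"
  unfolding compatible_def
proof (intro conjI ballI)
  show "twist_ok (int p) m (1, 1, 1, 0, 0, 0, 0, 0)"
    using m_gt_1 prime_gt_1_int[OF prime_int_p] by simp
  fix g assume g: "g \<in> carrier G"
  obtain A1 A2 w1 w2 q w where gg: "rep g = (A1, A2, w1, w2, q, w)" by (metis prod_cases6)
  show "rep (\<one>\<^bsub>Aut0 G\<^esub> g) = twist_map m (1, 1, 1, 0, 0, 0, 0, 0) (rep g)"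
    using g hexa_red_carrier[OF ctx rep.hom_closed[OF g]] by (simp add: twist_map_def gg)
qed

text \<open>Tameness depends only on the locally constant values \<open>rep (n x)\<close> and
  \<open>rep (n y)\<close>, so the tame elements form an open and hence closed subgroup.\<close>

lemma tame_if_witness:
  assumes gens: "\<And>n. n \<in> autos \<Longrightarrow> tame n" and n: "n \<in> witness"
  shows "tame n"
proof -
  let ?D = "{n \<in> A0. tame n}"
  have sub: "subgroup ?D (Aut0 G)"
  proof (rule subgroup.intro)
    show "?D \<subseteq> carrier (Aut0 G)" by auto
    show "n \<otimes>\<^bsub>Aut0 G\<^esub> n' \<in> ?D" if "n \<in> ?D" "n' \<in> ?D" for n n'
      using that tame_mult[of n n'] Aut0.m_closed[of n n'] by (simp del: Aut0_simps(2))
    show "inv\<^bsub>Aut0 G\<^esub> n \<in> ?D" if "n \<in> ?D" for n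
      using that tame_inv[of n] Aut0.inv_closed[of n] by simp
    have "tame \<one>\<^bsub>Aut0 G\<^esub>" by (rule tameI[OF compatible_one])
    then show "\<one>\<^bsub>Aut0 G\<^esub> \<in> ?D" using Aut0.one_closed by (simp del: Aut0_simps(3))
  qed
  have lc: "locally_constant (topo (Aut0 G)) (\<lambda>n. (rep (n x), rep (n y)))"
    by (intro locally_constant_pair locally_constant_eval[OF rep(1) HG.is_group rep(2)]) simp_all
  have tame_iff: "tame n \<longleftrightarrow> (\<exists>P. twist_ok (int p) m P \<and>
      fst (rep (n x), rep (n y)) = twist_map m P hx \<and> snd (rep (n x), rep (n y)) = twist_map m P hy)"
    if "n \<in> A0" for n
    unfolding tame_def
  proof (rule ex_cong1)
    fix P
    show "compatible P n \<longleftrightarrow> twist_ok (int p) m P \<and>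
        fst (rep (n x), rep (n y)) = twist_map m P hx \<and> snd (rep (n x), rep (n y)) = twist_map m P hy"
      using compatibleI[OF _ that, of P] rep(3,4) x_closed y_closed by (auto simp: compatible_def simp del: twist_ok.simps)
  qed
  have "?D = {n \<in> topspace (topo (Aut0 G)). \<exists>P. twist_ok (int p) m P \<and>
      fst (rep (n x), rep (n y)) = twist_map m P hx \<and> snd (rep (n x), rep (n y)) = twist_map m P hy}"
    unfolding topspace_Aut0 using tame_iff by (intro Collect_cong conj_cong refl)
  moreover have "openin (topo (Aut0 G)) \<dots>" by (rule locally_constant_openin[OF lc])
  ultimately have o: "openin (topo (Aut0 G)) ?D" by (simp only:)
  have "autos \<subseteq> ?D" using gens autos_A0 by blast
  then have "witness \<subseteq> ?D"
    unfolding witness_def by (rule Aut0.closed_gen_minimal[OF sub Aut0.open_subgroup_closed[OF sub o]])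
  then show ?thesis using n by blast
qed

text \<open>From the values at \<open>y\<close>, the parameters \<open>a1\<close>,
  \<open>a2\<close>, \<open>v\<close> are visible only after multiplication by
  \<open>1 - Y1\<close>, \<open>1 - Y2\<close>, \<open>1 - Y3\<close>, which are divisible by
  \<open>p\<close>. The value at \<open>x\<close> shows \<open>z\<close> only within
  \<open>z + a1 * d2 - d1 * a2\<close>. The combination taken here removes \<open>a1\<close> and
  \<open>a2\<close>, at the price of the factor \<open>(1 - Y1) * (1 - Y2)\<close> in front of
  \<open>z\<close>.\<close>

definition tri_of :: "hexa \<Rightarrow> hexa \<Rightarrow> tri" where
  "tri_of X Y = (case X of (A1, A2, w1, w2, q, w) \<Rightarrow> case Y of (B1, B2, u1, u2, r, u) \<Rightarrow>
     (w, u, ((1 - Y1) * (1 - Y2) * q - (1 - Y2) * u1 * w2 + (1 - Y1) * w1 * u2) mod m))"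

definition T :: "('a \<Rightarrow> 'a) \<Rightarrow> tri" where
  "T n = tri_of (rep (n x)) (rep (n y))"

lemma locally_constant_T: "locally_constant (topo (Aut0 G)) T"
  unfolding T_def
  by (rule locally_constant_compose2[where k = tri_of];
      rule locally_constant_eval[OF rep(1) HG.is_group rep(2)]) simp_all

lemma T_compatible:
  assumes "compatible (d1, d2, d, z, a1, a2, b, v) n"
  shows "T n = tri_red m (d, (1 - Y3) * v, (1 - Y1) * (1 - Y2) * z)"
proof -
  let ?P = "(d1, d2, d, z, a1, a2, b, v) :: twist"
  have X: "rep (n x) = hexa_red m (1, 1, d1, d2, z + a1 * d2 - d1 * a2, d)"
    using assms x_closed by (simp add: compatible_def rep(3) twist_map_def hx_def)
  have "rep (n y) = hexa_red m (twist ?P (Y1, Y2, 0, 0, 0, 0))"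
    using assms y_closed twist_red[of m ?P "(Y1, Y2, 0, 0, 0, 0)"]
    by (simp add: compatible_def rep(4) twist_map_def hy_def del: hexa_red.simps twist.simps)
  then have Y: "rep (n y) = hexa_red m (Y1, Y2, (1 - Y1) * a1, (1 - Y2) * a2,
      (1 - Y1 * Y2) * b - Y2 * ((1 - Y1) * a1) * a2, (1 - Y3) * v)"
    by (simp add: Y3_def)
  have "((1 - Y1) * (1 - Y2) * ((z + a1 * d2 - d1 * a2) mod m) - (1 - Y2) * (((1 - Y1) * a1) mod m) * (d2 mod m)
        + (1 - Y1) * (d1 mod m) * (((1 - Y2) * a2) mod m)) mod m
      = ((1 - Y1) * (1 - Y2) * (z + a1 * d2 - d1 * a2) - (1 - Y2) * ((1 - Y1) * a1) * d2
        + (1 - Y1) * d1 * ((1 - Y2) * a2)) mod m"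
    unfolding cong_def[symmetric] by (intro cong_add cong_diff cong_mult cong_refl) (simp_all add: cong_def)
  also have "(1 - Y1) * (1 - Y2) * (z + a1 * d2 - d1 * a2) - (1 - Y2) * ((1 - Y1) * a1) * d2
        + (1 - Y1) * d1 * ((1 - Y2) * a2) = (1 - Y1) * (1 - Y2) * z"
    by algebra
  finally show ?thesis by (simp add: T_def X Y tri_of_def)
qed

text \<open>The \<open>v\<close> and \<open>z\<close> entries of \<open>tri_prod\<close> are linear
  in \<open>v\<close> and \<open>z\<close> respectively, so the law survives their multiplication by
  constants.\<close>

lemma T_mult:
  assumes "compatible P n" "compatible P' n'" "n \<in> A0" "n' \<in> A0"
  shows "T (n \<otimes>\<^bsub>Aut0 G\<^esub> n') = tri_red m (tri_prod (T n) (T n'))"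
proof -
  obtain d1 d2 d z a1 a2 b v where PP: "P = (d1, d2, d, z, a1, a2, b, v)" by (rule twist_cases)
  obtain d1' d2' d' z' a1' a2' b' v' where PP': "P' = (d1', d2', d', z', a1', a2', b', v')" by (rule twist_cases)
  have "T (n \<otimes>\<^bsub>Aut0 G\<^esub> n') = tri_red m (d * d', (1 - Y3) * (v + d * v'), (1 - Y1) * (1 - Y2) * (z' + d' * z))"
    by (rule T_compatible) (use compatible_mult[OF assms] in \<open>simp only: PP PP' twist_comp.simps\<close>)
  also have "\<dots> = tri_red m (tri_prod (d, (1 - Y3) * v, (1 - Y1) * (1 - Y2) * z) (d', (1 - Y3) * v', (1 - Y1) * (1 - Y2) * z'))"
    by (simp add: algebra_simps)
  finally show ?thesis
    using T_compatible[OF assms(1)[unfolded PP]] T_compatible[OF assms(2)[unfolded PP']]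
    by (simp del: tri_red.simps tri_prod.simps)
qed

text \<open>Used to move inverse letters of a word to the other side, so that no inverse in
  \<open>HG\<close> has to be computed.\<close>

lemma rep_eqI:
  assumes "a \<in> carrier G" "b \<in> carrier G" "X \<in> carrier HG" "X \<otimes>\<^bsub>HG\<^esub> rep b = rep (a \<otimes> b)"
  shows "rep a = X"
proof -
  have "rep a \<otimes>\<^bsub>HG\<^esub> rep b = X \<otimes>\<^bsub>HG\<^esub> rep b"
    unfolding assms(4) using assms(1,2) by (rule rep.hom_mult[symmetric])
  then show ?thesis
    using HG.right_cancel[OF rep.hom_closed[OF assms(2)] rep.hom_closed[OF assms(1)] assms(3)] by (rule iffD1[rotated])
qed

lemma HG_mult: "g \<otimes>\<^bsub>HG\<^esub> h = hexa_red m (hexa_prod g h)"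
  by (simp add: hexa_group_def)

lemma unipotent_closed: "hexa_red m (1, 1, a, b, c, d) \<in> carrier HG"
  using one_in_one_units[OF ctx] m_gt_1 by (simp add: hexa_group_def)

lemma rep_conjs_1: "rep (conjs 1) = hexa_red m (1, 1, Y1, Y2, 0, Y3)"
proof (rule rep_eqI[OF conjs_closed y_closed unipotent_closed])
  have "conjs 1 \<otimes> y = y \<otimes> x" by (simp add: word_simps)
  then have "rep (conjs 1 \<otimes> y) = hy \<otimes>\<^bsub>HG\<^esub> hx" by (simp add: rep(3,4))
  then show "hexa_red m (1, 1, Y1, Y2, 0, Y3) \<otimes>\<^bsub>HG\<^esub> rep y = rep (conjs 1 \<otimes> y)"
    unfolding rep(4) hy_def by (simp add: HG_mult hx_def Y3_def del: hexa_red.simps)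
qed

text \<open>In the equation \<open>auto_s x \<otimes> conjs 1 = x \<otimes> x\<close> the corner
  entries give \<open>q + (2 - Y1) * Y2 = 1\<close>.\<close>

lemma rep_s_x: "rep (auto_s x) = hexa_red m (1, 1, 2 - Y1, 2 - Y2, 1 - 2 * Y2 + Y1 * Y2, 2 - Y3)"
proof (rule rep_eqI[OF _ conjs_closed unipotent_closed])
  show "auto_s x \<in> carrier G" using auto_s(3) s_value_closed by simp
  have "auto_s x \<otimes> conjs 1 = x \<otimes> x"
    unfolding auto_s(3) using conjs_closed[of 1] by (simp add: m_assoc del: conjs.simps One_nat_def)
  then have "rep (auto_s x \<otimes> conjs 1) = hx \<otimes>\<^bsub>HG\<^esub> hx" by (simp add: rep(3) del: conjs.simps One_nat_def)
  then show "hexa_red m (1, 1, 2 - Y1, 2 - Y2, 1 - 2 * Y2 + Y1 * Y2, 2 - Y3) \<otimes>\<^bsub>HG\<^esub> rep (conjs 1) = rep (auto_s x \<otimes> conjs 1)"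
    unfolding rep_conjs_1 by (simp add: HG_mult hx_def algebra_simps del: hexa_red.simps)
qed

text \<open>The commutator of \<open>x\<close> and \<open>conjs 1\<close> is trivial except for its
  corner entry, which is \<open>Y2 - Y1\<close>.\<close>

lemma rep_t_x: "rep (auto_t x) = hexa_red m (1, 1, 1, 1, Y2 - Y1, 1)"
proof (rule rep_eqI[OF _ _ unipotent_closed])
  show "auto_t x \<in> carrier G" using auto_t(3) t_value_closed by simp
  show "conjs 1 \<otimes> x \<in> carrier G" by simp
  have "auto_t x \<otimes> (conjs 1 \<otimes> x) = x \<otimes> (x \<otimes> conjs 1)"
    unfolding auto_t(3) using conjs_closed[of 1] by (simp add: word_simps del: conjs.simps One_nat_def)
  then have "rep (auto_t x \<otimes> (conjs 1 \<otimes> x)) = hx \<otimes>\<^bsub>HG\<^esub> (hx \<otimes>\<^bsub>HG\<^esub> rep (conjs 1))"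
    by (simp add: rep(3) del: conjs.simps One_nat_def)
  moreover have "rep (conjs 1 \<otimes> x) = rep (conjs 1) \<otimes>\<^bsub>HG\<^esub> hx" by (simp add: rep(3) del: conjs.simps One_nat_def)
  ultimately show "hexa_red m (1, 1, 1, 1, Y2 - Y1, 1) \<otimes>\<^bsub>HG\<^esub> rep (conjs 1 \<otimes> x) = rep (auto_t x \<otimes> (conjs 1 \<otimes> x))"
    unfolding rep_conjs_1 by (simp add: HG_mult hx_def algebra_simps del: hexa_red.simps)
qed

text \<open>Conjugation by \<open>hx\<close> itself: its matrix has upper entries 1 and corner 0,
  and its affine map is translation by 1.\<close>

lemma compatible_inn: "compatible (1, 1, 1, 0, 1, 1, 0, 1) (inn x)"
proof (rule compatibleI[OF _ inn_A0[OF x_closed]])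
  show "twist_ok (int p) m (1, 1, 1, 0, 1, 1, 0, 1)" using m_gt_1 prime_gt_1_int[OF prime_int_p] by simp
  show "rep (inn x x) = twist_map m (1, 1, 1, 0, 1, 1, 0, 1) hx"
    using m_gt_1 by (simp add: inn_def m_assoc rep(3) twist_map_def hx_def)
  let ?X = "hexa_red m (twist (1, 1, 1, 0, 1, 1, 0, 1) (Y1, Y2, 0, 0, 0, 0))"
  have X: "?X = twist_map m (1, 1, 1, 0, 1, 1, 0, 1) hy"
    unfolding twist_map_def hy_def by (simp only: twist_red)
  have "rep (inn x y) = ?X"
  proof (rule rep_eqI[OF _ x_closed])
    show "inn x y \<in> carrier G" by (simp add: inn_def)
    show "?X \<in> carrier HG" unfolding X by (rule twist_map_closed[OF ctx hy_closed])
    have "inn x y \<otimes> x = x \<otimes> y" by (simp add: inn_def word_simps)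
    then have "rep (inn x y \<otimes> x) = hx \<otimes>\<^bsub>HG\<^esub> hy" by (simp add: rep(3,4))
    then show "?X \<otimes>\<^bsub>HG\<^esub> rep x = rep (inn x y \<otimes> x)"
      unfolding rep(3) hy_def by (simp add: HG_mult hx_def algebra_simps del: hexa_red.simps)
  qed
  then show "rep (inn x y) = twist_map m (1, 1, 1, 0, 1, 1, 0, 1) hy" unfolding X .
qed

text \<open>As \<open>auto_s\<close> fixes \<open>y\<close>, no coboundary parameters occur, and the
  others are read off from \<open>rep_s_x\<close>. The assumption \<open>Y12\<close> is the
  condition on \<open>d1 * d2\<close>.\<close>

lemma compatible_s: "compatible (2 - Y1, 2 - Y2, 2 - Y3, 1 - 2 * Y2 + Y1 * Y2, 0, 0, 0, 0) auto_s"
proof (rule compatibleI[OF _ auto_s_A0])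
  have "(2 - Y3) mod int p = (2 - (Y1 mod int p) * (Y2 mod int p)) mod int p"
    unfolding Y3_def by (rule mod_diff_cong) (simp_all add: mod_mult_eq)
  then have "(2 - Y3) mod int p = 1" using Y1 Y2 prime_gt_1_int[OF prime_int_p] by simp
  then show "twist_ok (int p) m (2 - Y1, 2 - Y2, 2 - Y3, 1 - 2 * Y2 + Y1 * Y2, 0, 0, 0, 0)"
    using Y12 by simp
  show "rep (auto_s x) = twist_map m (2 - Y1, 2 - Y2, 2 - Y3, 1 - 2 * Y2 + Y1 * Y2, 0, 0, 0, 0) hx"
    unfolding rep_s_x twist_map_def hx_def by simp
  show "rep (auto_s y) = twist_map m (2 - Y1, 2 - Y2, 2 - Y3, 1 - 2 * Y2 + Y1 * Y2, 0, 0, 0, 0) hy"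
    unfolding auto_s(4) rep(4) twist_map_def hy_def by simp
qed

lemma compatible_t: "compatible (1, 1, 1, Y2 - Y1, 0, 0, 0, 0) auto_t"
proof (rule compatibleI[OF _ auto_t_A0])
  show "twist_ok (int p) m (1, 1, 1, Y2 - Y1, 0, 0, 0, 0)" using m_gt_1 prime_gt_1_int[OF prime_int_p] by simp
  show "rep (auto_t x) = twist_map m (1, 1, 1, Y2 - Y1, 0, 0, 0, 0) hx"
    unfolding rep_t_x twist_map_def hx_def by simp
  show "rep (auto_t y) = twist_map m (1, 1, 1, Y2 - Y1, 0, 0, 0, 0) hy"
    unfolding auto_t(4) rep(4) twist_map_def hy_def by simp
qed

lemma witness_tame: "n \<in> witness \<Longrightarrow> tame n"
  by (rule tame_if_witness)
    (use tameI[OF compatible_inn] tameI[OF compatible_s] tameI[OF compatible_t] in \<open>auto simp: autos_def\<close>)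

lemma T_mult_witness:
  assumes "n \<in> witness" "n' \<in> witness"
  shows "T (n \<otimes>\<^bsub>Aut0 G\<^esub> n') = tri_red m (tri_prod (T n) (T n'))"
  using T_mult[OF _ _ witness_A0[OF assms(1)] witness_A0[OF assms(2)]] witness_tame assms
  unfolding tame_def by meson

lemma T_carrier:
  assumes "n \<in> witness" shows "T n \<in> one_units (int p) m \<times> {0..<m} \<times> {0..<m}"
proof -
  obtain P where P: "compatible P n" using witness_tame[OF assms] unfolding tame_def by blast
  obtain d1 d2 d z a1 a2 b v where PP: "P = (d1, d2, d, z, a1, a2, b, v)" by (rule twist_cases)
  have "d mod m \<in> one_units (int p) m"
    using P one_unit_mult[OF ctx, of d 1] prime_gt_1_int[OF prime_int_p] by (simp add: PP compatible_def)
  then show ?thesis using T_compatible[OF P[unfolded PP]] m_gt_1 by simp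
qed

lemma T_one: "T \<one>\<^bsub>Aut0 G\<^esub> = (1, 0, 0)"
  using T_compatible[OF compatible_one] m_gt_1 by simp

lemma T_inn: "T (inn x) = tri_red m (1, 1 - Y3, 0)"
  and T_s: "T auto_s = tri_red m (2 - Y3, 0, (1 - Y1) * (1 - Y2) * (1 - 2 * Y2 + Y1 * Y2))"
  and T_t: "T auto_t = tri_red m (1, 0, (1 - Y1) * (1 - Y2) * (Y2 - Y1))"
  using T_compatible[OF compatible_inn] T_compatible[OF compatible_s] T_compatible[OF compatible_t] by simp_all

end

section \<open>Central extensions of its finite quotients\<close>

lemma locally_constant_const: "locally_constant T (\<lambda>g. c)"
  unfolding locally_constant_def
proof
  show "openin T {g \<in> topspace T. c = a}" for a by (cases "c = a") simp_all
qed

lemma locally_constant_sum: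
  assumes "finite I" "\<And>i. i \<in> I \<Longrightarrow> locally_constant T (f i)"
  shows "locally_constant T (\<lambda>g. \<Sum>i\<in>I. f i g)"
  using assms
proof (induction I rule: finite_induct)
  case empty
  show ?case using locally_constant_const[of T 0] by simp
next
  case (insert i I)
  then have "locally_constant T (\<lambda>g. f i g + (\<Sum>i\<in>I. f i g))"
    by (intro locally_constant_compose2[where k = "(+)"]) simp_all
  then show ?case using insert by simp
qed

section \<open>Relations between the generators of the witness\<close>

context free_pro_p_two
begin

lemma inn_mult:
  assumes "g \<in> carrier G" "h \<in> carrier G" shows "inn (g \<otimes> h) = inn g \<otimes>\<^bsub>Aut0 G\<^esub> inn h"
proof (rule A0_eqI)
  show "inn (g \<otimes> h) \<in> A0" by (rule inn_A0) (use assms in simp)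
  show "inn g \<otimes>\<^bsub>Aut0 G\<^esub> inn h \<in> A0" using Aut0.m_closed inn_A0 assms by simp
  fix k assume k: "k \<in> carrier G"
  show "inn (g \<otimes> h) k = (inn g \<otimes>\<^bsub>Aut0 G\<^esub> inn h) k"
    unfolding Aut0_mult_apply[OF inn_A0[OF assms(1)] inn_A0[OF assms(2)] k]
    using assms k by (simp add: inn_def word_simps)
qed

lemma inn_one: "inn \<one> = \<one>\<^bsub>Aut0 G\<^esub>"
  by (auto simp: inn_def)

lemma inn_inv: "g \<in> carrier G \<Longrightarrow> inn (inv g) = inv\<^bsub>Aut0 G\<^esub> inn g"
proof -
  assume g: "g \<in> carrier G"
  have "inn (inv g) \<otimes>\<^bsub>Aut0 G\<^esub> inn g = \<one>\<^bsub>Aut0 G\<^esub>"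
    using inn_mult[OF inv_closed[OF g] g] g inn_one by simp
  then have "inv\<^bsub>Aut0 G\<^esub> inn g = inn (inv g)"
    using inn_A0 g by (intro Aut0.inv_equality) simp_all
  then show ?thesis by (rule sym)
qed

lemma auto_inn:
  assumes n: "n \<in> A0" and g: "g \<in> carrier G"
  shows "n \<otimes>\<^bsub>Aut0 G\<^esub> inn g = inn (n g) \<otimes>\<^bsub>Aut0 G\<^esub> n"
proof -
  note nc = A0_cont_auto[OF n]
  interpret n: group_hom G G n using cont_autoD(1)[OF nc] is_group by (simp add: group_hom_def group_hom_axioms_def)
  show ?thesis
  proof (rule A0_eqI)
    show "n \<otimes>\<^bsub>Aut0 G\<^esub> inn g \<in> A0" using Aut0.m_closed inn_A0 n g by simp
    show "inn (n g) \<otimes>\<^bsub>Aut0 G\<^esub> n \<in> A0" using Aut0.m_closed inn_A0 n g by simp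
    fix k assume k: "k \<in> carrier G"
    show "(n \<otimes>\<^bsub>Aut0 G\<^esub> inn g) k = (inn (n g) \<otimes>\<^bsub>Aut0 G\<^esub> n) k"
      unfolding Aut0_mult_apply[OF n inn_A0[OF g] k] Aut0_mult_apply[OF inn_A0[OF n.hom_closed[OF g]] n k]
      using g k by (simp add: inn_def)
  qed
qed

lemma s_conjs: "auto_s (conjs k) = conjs k \<otimes> conjs k \<otimes> inv conjs (Suc k)"
proof (induction k)
  case 0
  then show ?case using auto_s(3) by simp
next
  case (Suc k)
  interpret s: group_hom G G auto_s using auto_s(1) is_group by (simp add: group_hom_def group_hom_axioms_def)
  have "auto_s (conjs (Suc k)) = y \<otimes> auto_s (conjs k) \<otimes> inv y"
    using auto_s(4) by simp
  also have "\<dots> = conjs (Suc k) \<otimes> conjs (Suc k) \<otimes> inv conjs (Suc (Suc k))"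
    using Suc by (simp add: word_simps)
  finally show ?case .
qed

lemma t_conjs: "auto_t (conjs k) =
  conjs k \<otimes> (conjs k \<otimes> conjs (Suc k) \<otimes> inv conjs k \<otimes> inv conjs (Suc k))"
proof (induction k)
  case 0
  then show ?case using auto_t(3) by simp
next
  case (Suc k)
  interpret t: group_hom G G auto_t using auto_t(1) is_group by (simp add: group_hom_def group_hom_axioms_def)
  have "auto_t (conjs (Suc k)) = y \<otimes> auto_t (conjs k) \<otimes> inv y"
    using auto_t(4) by simp
  also have "\<dots> = conjs (Suc k) \<otimes> (conjs (Suc k) \<otimes> conjs (Suc (Suc k)) \<otimes> inv conjs (Suc k) \<otimes> inv conjs (Suc (Suc k)))"
    using Suc by (simp add: word_simps)
  finally show ?case .
qed

abbreviation iota :: "nat \<Rightarrow> 'a \<Rightarrow> 'a" where "iota k \<equiv> inn (conjs k)"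

text \<open>Conjugation by \<open>auto_s\<close> turns \<open>iota k\<close> into
  \<open>inn (auto_s (conjs k))\<close>. The resulting relation is split into two identities without
  inverses, as the bare law \<open>tri_prod\<close> requires.\<close>

lemma s_iota:
  "auto_s \<otimes>\<^bsub>Aut0 G\<^esub> iota k = inn (auto_s (conjs k)) \<otimes>\<^bsub>Aut0 G\<^esub> auto_s"
  "inn (auto_s (conjs k)) \<otimes>\<^bsub>Aut0 G\<^esub> iota (Suc k) = iota k \<otimes>\<^bsub>Aut0 G\<^esub> iota k"
proof -
  show "auto_s \<otimes>\<^bsub>Aut0 G\<^esub> iota k = inn (auto_s (conjs k)) \<otimes>\<^bsub>Aut0 G\<^esub> auto_s"
    by (rule auto_inn[OF auto_s_A0 conjs_closed])
  have "auto_s (conjs k) \<otimes> conjs (Suc k) = conjs k \<otimes> conjs k"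
    unfolding s_conjs using conjs_closed[of k] conjs_closed[of "Suc k"]
    by (simp add: m_assoc del: conjs.simps)
  moreover have "auto_s (conjs k) \<in> carrier G" by (rule hom_in_carrier[OF auto_s(1) conjs_closed])
  ultimately show "inn (auto_s (conjs k)) \<otimes>\<^bsub>Aut0 G\<^esub> iota (Suc k) = iota k \<otimes>\<^bsub>Aut0 G\<^esub> iota k"
    using inn_mult[of "auto_s (conjs k)" "conjs (Suc k)"] inn_mult[of "conjs k" "conjs k"]
    by (simp del: conjs.simps Aut0_simps)
qed

lemma witness_mult: "n \<in> witness \<Longrightarrow> n' \<in> witness \<Longrightarrow> n \<otimes>\<^bsub>Aut0 G\<^esub> n' \<in> witness"
  by (rule subgroup.m_closed[OF witness_subgroup])

lemma witness_inv: "n \<in> witness \<Longrightarrow> inv\<^bsub>Aut0 G\<^esub> n \<in> witness"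
  by (rule subgroup.m_inv_closed[OF witness_subgroup])

lemma s_witness: "auto_s \<in> witness" and t_witness: "auto_t \<in> witness"
  using autos_witness by (auto simp: autos_def)

text \<open>The relations \<open>s_iota\<close> can be solved for \<open>iota (Suc k)\<close>, so
  each \<open>iota\<close> is a word in \<open>auto_s\<close> and the previous one.\<close>

lemma iota_witness: "iota k \<in> witness"
  and s_iota_witness: "inn (auto_s (conjs k)) \<in> witness"
proof -
  have cA: "iota k \<in> A0" for k by (rule inn_A0[OF conjs_closed])
  have step: "inn (auto_s (conjs k)) \<in> witness" if "iota k \<in> witness" for k
  proof -
    have sA: "inn (auto_s (conjs k)) \<in> A0" by (rule inn_A0[OF hom_in_carrier[OF auto_s(1) conjs_closed]])
    have "inn (auto_s (conjs k)) = auto_s \<otimes>\<^bsub>Aut0 G\<^esub> iota k \<otimes>\<^bsub>Aut0 G\<^esub> inv\<^bsub>Aut0 G\<^esub> auto_s"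
      unfolding s_iota(1) using sA auto_s_A0 Aut0.m_assoc[of "inn (auto_s (conjs k))" auto_s "inv\<^bsub>Aut0 G\<^esub> auto_s"]
        Aut0.r_inv[of auto_s] Aut0.r_one[of "inn (auto_s (conjs k))"] Aut0.inv_closed[of auto_s]
      by (simp del: Aut0_simps(2,3))
    then show ?thesis using witness_mult[OF witness_mult[OF s_witness that] witness_inv[OF s_witness]] by simp
  qed
  show ik: "iota k \<in> witness" for k
  proof (induction k)
    case 0
    show ?case using autos_witness by (simp add: autos_def)
  next
    case (Suc k)
    have sA: "inn (auto_s (conjs k)) \<in> A0" by (rule inn_A0[OF hom_in_carrier[OF auto_s(1) conjs_closed]])
    have "iota (Suc k) = inv\<^bsub>Aut0 G\<^esub> inn (auto_s (conjs k)) \<otimes>\<^bsub>Aut0 G\<^esub> (iota k \<otimes>\<^bsub>Aut0 G\<^esub> iota k)"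
      unfolding s_iota(2)[symmetric] using Aut0.mult_inv_cancel(2)[of "inn (auto_s (conjs k))" "iota (Suc k)"] sA cA[of "Suc k"]
      by (simp del: Aut0_simps(2,3) conjs.simps)
    then show ?case
      using witness_mult[OF witness_inv[OF step[OF Suc]] witness_mult[OF Suc Suc]] by (simp del: conjs.simps)
  qed
  show "inn (auto_s (conjs k)) \<in> witness" by (rule step[OF ik])
qed

lemma t_iota:
  "auto_t \<otimes>\<^bsub>Aut0 G\<^esub> iota k = (iota k \<otimes>\<^bsub>Aut0 G\<^esub> (iota k \<otimes>\<^bsub>Aut0 G\<^esub> iota (Suc k) \<otimes>\<^bsub>Aut0 G\<^esub>
     inv\<^bsub>Aut0 G\<^esub> iota k \<otimes>\<^bsub>Aut0 G\<^esub> inv\<^bsub>Aut0 G\<^esub> iota (Suc k))) \<otimes>\<^bsub>Aut0 G\<^esub> auto_t"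
proof -
  have c: "conjs k \<in> carrier G" "conjs (Suc k) \<in> carrier G" by (rule conjs_closed)+
  have "inn (auto_t (conjs k)) = iota k \<otimes>\<^bsub>Aut0 G\<^esub> (iota k \<otimes>\<^bsub>Aut0 G\<^esub> iota (Suc k) \<otimes>\<^bsub>Aut0 G\<^esub>
     inv\<^bsub>Aut0 G\<^esub> iota k \<otimes>\<^bsub>Aut0 G\<^esub> inv\<^bsub>Aut0 G\<^esub> iota (Suc k))"
    unfolding t_conjs using c by (simp only: inn_mult inn_inv m_closed inv_closed)
  then show ?thesis using auto_inn[OF auto_t_A0 c(1)] by (simp only:)
qed

end

context evaluation_point
begin

text \<open>The relations \<open>s_iota\<close> determine \<open>T\<close> recursively: the entry
  \<open>v\<close> at \<open>Suc k\<close> is \<open>2 - (2 - Y3)\<close> times that at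
  \<open>k\<close>, which produces the powers of \<open>Y3\<close>.\<close>

lemma T_iota: "T (iota k) = tri_red m (1, (1 - Y3) * Y3 ^ k, 0)"
proof (induction k)
  case 0
  show ?case using T_inn by simp
next
  case (Suc k)
  let ?D = "2 - Y3" and ?V = "(1 - Y3) * Y3 ^ k" and ?z = "(1 - Y1) * (1 - Y2) * (1 - 2 * Y2 + Y1 * Y2)"
  obtain d1 v1 z1 where t1: "T (inn (auto_s (conjs k))) = (d1, v1, z1)" by (metis prod_cases3)
  obtain d2 v2 z2 where t2: "T (iota (Suc k)) = (d2, v2, z2)" by (metis prod_cases3)
  have r1: "d1 mod m = d1" "v1 mod m = v1" "z1 mod m = z1"
    using T_carrier[OF s_iota_witness[of k]] by (auto simp: t1 one_units_def)
  have r2: "d2 mod m = d2" "v2 mod m = v2" "z2 mod m = z2"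
    using T_carrier[OF iota_witness[of "Suc k"]] unfolding t2 by (auto simp: one_units_def)
  have "twist_ok (int p) m (2 - Y1, 2 - Y2, 2 - Y3, 1 - 2 * Y2 + Y1 * Y2, 0, 0, 0, 0)"
    using compatible_s by (simp add: compatible_def)
  then have "?D mod int p = 1" by simp
  \<comment> \<open>Multiplying by the inverse of \<open>2 - Y3\<close> plays the part of cancelling
    \<open>T auto_s\<close>.\<close>
  then obtain e where e: "(e * ?D) mod m = 1" using one_unit_inverse[OF ctx] by metis
  have "tri_red m (tri_prod (T auto_s) (T (iota k))) = tri_red m (tri_prod (T (inn (auto_s (conjs k)))) (T auto_s))"
    using T_mult_witness[OF s_witness iota_witness[of k]] T_mult_witness[OF s_iota_witness[of k] s_witness] s_iota(1)[of k]
    by (simp only:)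
  then have "tri_red m (tri_prod (?D, 0, ?z) (1, ?V, 0)) = tri_red m (tri_prod (d1, v1, z1) (?D, 0, ?z))"
    unfolding Suc T_s t1 by (simp only: tri_prod_red)
  then have eq1: "?D mod m = (d1 * ?D) mod m" "(?D * ?V) mod m = v1 mod m" "?z mod m = (?z + z1 * ?D) mod m"
    by simp_all
  have D1: "d1 = 1"
  proof -
    have "d1 mod m = (d1 * ?D * e) mod m" using mod_mult_eq_one[OF ctx e, of d1] by (simp add: mult.commute mult.left_commute)
    also have "\<dots> = (?D * e) mod m" using eq1(1) by (metis mod_mult_left_eq)
    also have "\<dots> = 1" using e by (simp add: mult.commute)
    finally show ?thesis using r1(1) by simp
  qed
  have Z1: "z1 = 0"
  proof -
    have "(z1 * ?D) mod m = (?z + z1 * ?D - ?z) mod m" by simp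
    also have "\<dots> = (?z - ?z) mod m" using eq1(3) by (intro mod_diff_cong) simp_all
    finally have "(z1 * ?D) mod m = 0" by simp
    have "z1 mod m = (z1 * ?D * e) mod m" using mod_mult_eq_one[OF ctx e, of z1] by (simp add: mult.commute mult.left_commute)
    also have "\<dots> = 0" using \<open>(z1 * ?D) mod m = 0\<close> by (metis mod_mult_left_eq mult_zero_left mod_0)
    finally show ?thesis using r1(3) by simp
  qed
  have "tri_red m (tri_prod (T (inn (auto_s (conjs k)))) (T (iota (Suc k)))) = tri_red m (tri_prod (T (iota k)) (T (iota k)))"
    using T_mult_witness[OF s_iota_witness[of k] iota_witness[of "Suc k"]] T_mult_witness[OF iota_witness[of k] iota_witness[of k]]
      s_iota(2)[of k] by (simp only:)
  then have "tri_red m (tri_prod (1, v1, 0) (d2, v2, z2)) = tri_red m (tri_prod (1, ?V, 0) (1, ?V, 0))"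
    unfolding Suc t1 t2 D1 Z1 by (simp only: tri_prod_red)
  then have eq2: "d2 mod m = 1 mod m" "(v1 + v2) mod m = (?V + ?V) mod m" "z2 mod m = 0"
    by simp_all
  have "v2 mod m = (v1 + v2 - v1) mod m" by simp
  also have "\<dots> = (?V + ?V - ?D * ?V) mod m" using eq2(2) eq1(2) by (intro mod_diff_cong) simp_all
  also have "?V + ?V - ?D * ?V = (1 - Y3) * Y3 ^ Suc k" by (simp add: algebra_simps)
  finally show ?case unfolding t2 using r2 eq2 by simp
qed

end

text \<open>A continuous epimorphism from a free pro-p group of finite rank onto the witness.
  Nothing is assumed about its kernel, whose finite normal generation is to be refuted.\<close>

locale presented_witness = free_pro_p_two + F: top_group F for F :: "'b tgroup" +
  fixes X :: "'b set" and \<phi> :: "'b \<Rightarrow> 'a \<Rightarrow> 'a"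
  assumes free_F: "free_pro_p_on p F X" and finite_X: "finite X"
    and \<phi>_cont: "continuous_map (topo F) (topo (Aut0 G)) \<phi>"
    and \<phi>_closed: "\<And>g. g \<in> carrier F \<Longrightarrow> \<phi> g \<in> witness"
    and \<phi>_mult: "\<And>g h. g \<in> carrier F \<Longrightarrow> h \<in> carrier F \<Longrightarrow> \<phi> (g \<otimes>\<^bsub>F\<^esub> h) = \<phi> g \<otimes>\<^bsub>Aut0 G\<^esub> \<phi> h"
    and \<phi>_surj: "\<And>n. n \<in> witness \<Longrightarrow> \<exists>g \<in> carrier F. \<phi> g = n"
begin

sublocale \<phi>: group_hom F "Aut0 G" \<phi>
  by (auto simp: group_hom_def group_hom_axioms_def hom_def F.is_group Aut0.is_group \<phi>_mult
      dest!: \<phi>_closed witness_A0 simp del: Aut0_simps(2,3))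

definition lift :: "('a \<Rightarrow> 'a) \<Rightarrow> 'b" where
  "lift n = (SOME g. g \<in> carrier F \<and> \<phi> g = n)"

lemma lift: assumes "n \<in> witness" shows "lift n \<in> carrier F" "\<phi> (lift n) = n"
proof -
  have "\<exists>g. g \<in> carrier F \<and> \<phi> g = n" using \<phi>_surj[OF assms] by blast
  then have "lift n \<in> carrier F \<and> \<phi> (lift n) = n" unfolding lift_def by (rule someI_ex)
  then show "lift n \<in> carrier F" "\<phi> (lift n) = n" by auto
qed

abbreviation "tF \<equiv> lift auto_t"
abbreviation "xF k \<equiv> lift (iota k)"

lemma tF: "tF \<in> carrier F" "\<phi> tF = auto_t" by (rule lift[OF t_witness])+
lemma xF: "xF k \<in> carrier F" "\<phi> (xF k) = iota k" by (rule lift[OF iota_witness])+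

definition rel_left :: "nat \<Rightarrow> 'b" where
  "rel_left k = tF \<otimes>\<^bsub>F\<^esub> xF k"

definition rel_right :: "nat \<Rightarrow> 'b" where
  "rel_right k = (xF k \<otimes>\<^bsub>F\<^esub> (xF k \<otimes>\<^bsub>F\<^esub> xF (Suc k) \<otimes>\<^bsub>F\<^esub> inv\<^bsub>F\<^esub> xF k \<otimes>\<^bsub>F\<^esub> inv\<^bsub>F\<^esub> xF (Suc k))) \<otimes>\<^bsub>F\<^esub> tF"

text \<open>Any lifts of \<open>auto_t\<close> and of the \<open>iota k\<close> would serve: their
  entries \<open>c\<close> contribute equally to both sides and cancel in
  \<open>defect_rel\<close>.\<close>

definition rel :: "nat \<Rightarrow> 'b" where
  "rel k = rel_left k \<otimes>\<^bsub>F\<^esub> inv\<^bsub>F\<^esub> rel_right k"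

lemma rel_closed: "rel_left k \<in> carrier F" "rel_right k \<in> carrier F" "rel k \<in> carrier F"
  using tF(1) xF(1)[of k] xF(1)[of "Suc k"]
  by (simp_all add: rel_left_def rel_right_def rel_def del: conjs.simps)

lemma rel_in_kernel: "\<phi> (rel k) = \<one>\<^bsub>Aut0 G\<^esub>"
proof -
  have "\<phi> (rel_right k) = \<phi> (rel_left k)"
    unfolding rel_left_def rel_right_def
    using t_iota[of k] tF xF[of k] xF[of "Suc k"]
    by (simp only: \<phi>.hom_mult \<phi>.hom_inv F.m_closed F.inv_closed)
  then have "\<phi> (rel k) = \<phi> (rel_left k) \<otimes>\<^bsub>Aut0 G\<^esub> inv\<^bsub>Aut0 G\<^esub> \<phi> (rel_left k)"
    unfolding rel_def using rel_closed[of k] by (simp only: \<phi>.hom_mult \<phi>.hom_inv F.inv_closed)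
  also have "\<dots> = \<one>\<^bsub>Aut0 G\<^esub>" by (rule Aut0.r_inv[OF \<phi>.hom_closed[OF rel_closed(1)]])
  finally show ?thesis .
qed

end

section \<open>The lift to the central extension and its values on relators\<close>

locale cover_point = presented_witness + evaluation_point
begin

abbreviation "QG \<equiv> quad_group (int p) m"

sublocale QG: group QG by (rule group_quad[OF ctx])

fun quad_of_tri :: "tri \<Rightarrow> int \<Rightarrow> quad" where
  "quad_of_tri (d, v, z) c = (d, v, z, c)"

fun tri_of_quad :: "quad \<Rightarrow> tri" where
  "tri_of_quad (d, v, z, c) = (d, v, z)"

fun last_of_quad :: "quad \<Rightarrow> int" where
  "last_of_quad (d, v, z, c) = c"

lemma QG_mult: "g \<otimes>\<^bsub>QG\<^esub> h = quad_red m (quad_prod g h)"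
  by (simp add: quad_group_def)

lemma QG_one: "\<one>\<^bsub>QG\<^esub> = (1, 0, 0, 0)"
  by (simp add: quad_group_def)

lemma tri_of_quad_mult: "tri_of_quad (g \<otimes>\<^bsub>QG\<^esub> h) = tri_red m (tri_prod (tri_of_quad g) (tri_of_quad h))"
  by (cases g rule: prod_cases4; cases h rule: prod_cases4) (simp add: QG_mult)

text \<open>The lift of \<open>T \<circ> \<phi>\<close> from \<open>E / C\<close> to
  \<open>E\<close>. Freeness of \<open>F\<close> allows any choice of \<open>c\<close> on the basis;
  0 is taken.\<close>

definition cover :: "'b \<Rightarrow> quad" where
  "cover = (SOME h. h \<in> hom F QG \<and> locally_constant (topo F) h \<and> (\<forall>u \<in> X. h u = quad_of_tri (T (\<phi> u)) 0))"

lemma X_closed: "X \<subseteq> carrier F"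
  using free_F by (auto simp: free_pro_p_on_def top_generates_def)

lemma cover: "cover \<in> hom F QG" "locally_constant (topo F) cover"
  "\<And>u. u \<in> X \<Longrightarrow> cover u = quad_of_tri (T (\<phi> u)) 0"
proof -
  let ?Q = "\<lambda>h. h \<in> hom F QG \<and> locally_constant (topo F) h \<and> (\<forall>u \<in> X. h u = quad_of_tri (T (\<phi> u)) 0)"
  have "quad_of_tri (T (\<phi> u)) 0 \<in> carrier QG" if u: "u \<in> X" for u
  proof -
    obtain d v z where "T (\<phi> u) = (d, v, z)" by (metis prod_cases3)
    then show ?thesis
      using T_carrier[OF \<phi>_closed, of u] u X_closed m_gt_1 by (auto simp: quad_group_def)
  qed
  then have cl: "(\<lambda>u. quad_of_tri (T (\<phi> u)) 0) \<in> X \<rightarrow> carrier QG" by (rule Pi_I)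
  have card: "card (carrier QG) = p ^ (j - 1 + 3 * j)" using card_quad[OF ctx] by simp
  obtain h where "h \<in> hom F QG" "locally_constant (topo F) h" "\<And>u. u \<in> X \<Longrightarrow> h u = quad_of_tri (T (\<phi> u)) 0"
    by (rule free_pro_p_extend_finite[OF free_F prime_p group_quad[OF ctx] card cl]) (use finite_X in auto)
  then have "?Q h" by blast
  then have "\<exists>h. ?Q h" by (rule exI[where P = ?Q])
  then have "?Q cover" unfolding cover_def by (rule someI_ex)
  then show "cover \<in> hom F QG" "locally_constant (topo F) cover"
    "\<And>u. u \<in> X \<Longrightarrow> cover u = quad_of_tri (T (\<phi> u)) 0" by auto
qed

sublocale cover: group_hom F QG cover
  using cover(1) F.is_group QG.is_group by (simp add: group_hom_def group_hom_axioms_def)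

text \<open>Both sides obey \<open>tri_prod\<close> and are locally constant, so agreement on the
  basis spreads to \<open>F\<close>. Closure under inverses needs a cancellation by hand.\<close>

lemma tri_of_cover:
  assumes "g \<in> carrier F" shows "tri_of_quad (cover g) = T (\<phi> g)"
proof -
  let ?E = "{g \<in> carrier F. tri_of_quad (cover g) = T (\<phi> g)}"
  have one: "tri_of_quad (cover \<one>\<^bsub>F\<^esub>) = T (\<phi> \<one>\<^bsub>F\<^esub>)"
    unfolding cover.hom_one \<phi>.hom_one T_one QG_one by simp
  have mult: "tri_of_quad (cover (g \<otimes>\<^bsub>F\<^esub> h)) = T (\<phi> (g \<otimes>\<^bsub>F\<^esub> h))"
    if "g \<in> ?E" "h \<in> ?E" for g h
    using that T_mult_witness[OF \<phi>_closed \<phi>_closed, of g h] tri_of_quad_mult[of "cover g" "cover h"]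
    by (simp only: mem_Collect_eq cover.hom_mult \<phi>_mult)
  have inverse: "tri_of_quad (cover (inv\<^bsub>F\<^esub> g)) = T (\<phi> (inv\<^bsub>F\<^esub> g))" if g: "g \<in> ?E" for g
  proof -
    have gc: "g \<in> carrier F" "inv\<^bsub>F\<^esub> g \<in> carrier F" using g by auto
    obtain d v z where t: "T (\<phi> g) = (d, v, z)" by (metis prod_cases3)
    obtain d1 v1 z1 where t1: "tri_of_quad (cover (inv\<^bsub>F\<^esub> g)) = (d1, v1, z1)" by (metis prod_cases3)
    obtain d2 v2 z2 where t2: "T (\<phi> (inv\<^bsub>F\<^esub> g)) = (d2, v2, z2)" by (metis prod_cases3)
    have r2: "d2 mod m = d2" "v2 mod m = v2" "z2 mod m = z2"
      using T_carrier[OF \<phi>_closed[OF gc(2)]] by (auto simp: t2 one_units_def)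
    obtain c where c: "cover (inv\<^bsub>F\<^esub> g) = (d1, v1, z1, c)" using t1 by (cases "cover (inv\<^bsub>F\<^esub> g)" rule: prod_cases4) auto
    have r1: "d1 mod m = d1" "v1 mod m = v1" "z1 mod m = z1"
      using cover.hom_closed[OF gc(2)] by (auto simp: c quad_group_def one_units_def)
    have "d mod int p = 1" using T_carrier[OF \<phi>_closed[OF gc(1)]] by (auto simp: t one_units_def)
    then obtain e where e: "(e * d) mod m = 1" using one_unit_inverse[OF ctx] by metis
    have "tri_red m (tri_prod (d1, v1, z1) (d, v, z)) = (1, 0, 0)"
      using tri_of_quad_mult[of "cover (inv\<^bsub>F\<^esub> g)" "cover g"] g gc t t1 cover.hom_mult[OF gc(2,1)] cover.hom_one QG_one
        F.l_inv[OF gc(1)] by simp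
    moreover have "tri_red m (tri_prod (d2, v2, z2) (d, v, z)) = (1, 0, 0)"
      using T_mult_witness[OF \<phi>_closed[OF gc(2)] \<phi>_closed[OF gc(1)]] T_one t t2 \<phi>_mult[OF gc(2,1)] \<phi>.hom_one F.l_inv[OF gc(1)]
      by (simp del: Aut0_simps tri_prod.simps tri_red.simps)
    ultimately have eq: "(d1 * d) mod m = (d2 * d) mod m" "(v1 + d1 * v) mod m = (v2 + d2 * v) mod m"
       "(z + z1 * d) mod m = (z + z2 * d) mod m" by simp_all
    have canc: "a mod m = b mod m" if "(a * d) mod m = (b * d) mod m" for a b
    proof -
      have "(a * d * e) mod m = (b * d * e) mod m" using that by (metis mod_mult_left_eq)
      then show ?thesis
        using mod_mult_eq_one[OF ctx e, of a] mod_mult_eq_one[OF ctx e, of b] by (simp add: mult.commute mult.left_commute)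
    qed
    have "d1 = d2" using canc[OF eq(1)] r1 r2 by simp
    moreover have "v1 mod m = v2 mod m"
      using mod_diff_cong[OF eq(2), of "d1 * v" "d1 * v"] \<open>d1 = d2\<close> by simp
    moreover have "z1 mod m = z2 mod m"
    proof (rule canc)
      show "(z1 * d) mod m = (z2 * d) mod m" using mod_diff_cong[OF eq(3) refl, of z] by simp
    qed
    ultimately show ?thesis unfolding t1 t2 using r1 r2 by simp
  qed
  have "subgroup ?E F"
  proof (rule subgroup.intro)
    show "\<one>\<^bsub>F\<^esub> \<in> ?E" using one F.one_closed by blast
    show "g \<otimes>\<^bsub>F\<^esub> h \<in> ?E" if "g \<in> ?E" "h \<in> ?E" for g h
      using mult[OF that] that F.m_closed by blast
    show "inv\<^bsub>F\<^esub> g \<in> ?E" if "g \<in> ?E" for g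
      using inverse[OF that] that F.inv_closed by blast
  qed blast
  moreover have "openin (topo F) ?E"
    using locally_constant_openin[OF locally_constant_pair[OF cover(2) locally_constant_continuous[OF locally_constant_T \<phi>_cont]],
        of "\<lambda>c. tri_of_quad (fst c) = snd c"] by simp
  moreover have "X \<subseteq> ?E"
  proof
    fix u assume u: "u \<in> X"
    obtain d v z where "T (\<phi> u) = (d, v, z)" by (metis prod_cases3)
    then show "u \<in> ?E" using cover(3)[OF u] u X_closed by auto
  qed
  moreover have "top_generates F X" using free_F by (simp add: free_pro_p_on_def)
  ultimately have "?E = carrier F" by (intro F.top_generates_open_subgroup)
  then show ?thesis using assms by blast
qed

definition defect :: "'b \<Rightarrow> int" where
  "defect g = last_of_quad (cover g)"

lemma locally_constant_defect: "locally_constant (topo F) defect"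
  unfolding defect_def by (rule locally_constant_compose[OF cover(2)])

lemma cover_eq:
  assumes "g \<in> carrier F" "T (\<phi> g) = (d, v, z)" shows "cover g = (d, v, z, defect g)"
  using tri_of_cover[OF assms(1)] assms(2) by (cases "cover g" rule: prod_cases4) (simp add: defect_def)

text \<open>Such quadruples are central in \<open>QG\<close>; this is what makes
  \<open>defect\<close> additive and invariant under conjugation on the kernel.\<close>

lemma cover_kernel:
  assumes "g \<in> carrier F" "\<phi> g = \<one>\<^bsub>Aut0 G\<^esub>" shows "cover g = (1, 0, 0, defect g)"
  using cover_eq[OF assms(1)] assms(2) T_one by simp

lemma defect_mult:
  assumes "g \<in> carrier F" "\<phi> g = \<one>\<^bsub>Aut0 G\<^esub>" "h \<in> carrier F"
  shows "defect (g \<otimes>\<^bsub>F\<^esub> h) = (defect g + defect h) mod m"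
proof -
  obtain d v z c where c: "cover h = (d, v, z, c)" by (metis prod_cases4)
  have "cover (g \<otimes>\<^bsub>F\<^esub> h) = quad_red m (quad_prod (1, 0, 0, defect g) (d, v, z, c))"
    using cover.hom_mult[OF assms(1,3)] cover_kernel[OF assms(1,2)] c by (simp only: QG_mult)
  then show ?thesis unfolding defect_def using c by simp
qed

lemma defect_conj:
  assumes "g \<in> carrier F" "\<phi> g = \<one>\<^bsub>Aut0 G\<^esub>" "h \<in> carrier F"
  shows "defect (h \<otimes>\<^bsub>F\<^esub> g \<otimes>\<^bsub>F\<^esub> inv\<^bsub>F\<^esub> h) = defect g"
proof -
  obtain d v z c where c: "cover h = (d, v, z, c)" by (metis prod_cases4)
  have "cover h \<otimes>\<^bsub>QG\<^esub> cover g = cover g \<otimes>\<^bsub>QG\<^esub> cover h"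
    unfolding cover_kernel[OF assms(1,2)] c QG_mult by (simp add: add.commute)
  then have "cover h \<otimes>\<^bsub>QG\<^esub> cover g \<otimes>\<^bsub>QG\<^esub> inv\<^bsub>QG\<^esub> cover h = cover g"
    using cover.hom_closed[OF assms(1)] cover.hom_closed[OF assms(3)] by (simp add: QG.m_assoc)
  then show ?thesis
    unfolding defect_def using assms(1,3) by simp
qed

text \<open>The covers of the \<open>xF k\<close> commute, so the commutator in
  \<open>rel_right\<close> disappears. In \<open>rel_left\<close> the cover of \<open>tF\<close>
  stands before that of \<open>xF k\<close> and the product picks up \<open>z * v\<close>, which the
  opposite order does not.\<close>

lemma defect_rel: "defect (rel k) mod m = ((1 - Y1) * (1 - Y2) * (Y2 - Y1) * ((1 - Y3) * Y3 ^ k)) mod m"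
proof -
  let ?v = "(1 - Y3) * Y3 ^ k" and ?z = "(1 - Y1) * (1 - Y2) * (Y2 - Y1)"
  have xc: "xF k \<in> carrier F" "xF (Suc k) \<in> carrier F" by (rule xF)+
  have ct: "cover tF = quad_red m (1, 0, ?z, defect tF)"
    using cover_eq[OF tF(1)] T_t tF(2) quad_red_carrier[OF ctx cover.hom_closed[OF tF(1)]] by simp
  have cx: "cover (xF k) = quad_red m (1, (1 - Y3) * Y3 ^ k, 0, defect (xF k))" for k
    using cover_eq[OF xF(1)[of k]] T_iota[of k] xF(2)[of k] quad_red_carrier[OF ctx cover.hom_closed[OF xF(1)[of k]]] by simp
  have comm: "cover (xF k) \<otimes>\<^bsub>QG\<^esub> cover (xF (Suc k)) = cover (xF (Suc k)) \<otimes>\<^bsub>QG\<^esub> cover (xF k)"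
    unfolding cx[of k] cx[of "Suc k"] QG_mult quad_prod_red by (simp add: add.commute)
  have "cover (rel_right k) = (cover (xF k) \<otimes>\<^bsub>QG\<^esub> (cover (xF k) \<otimes>\<^bsub>QG\<^esub> cover (xF (Suc k)) \<otimes>\<^bsub>QG\<^esub>
      inv\<^bsub>QG\<^esub> cover (xF k) \<otimes>\<^bsub>QG\<^esub> inv\<^bsub>QG\<^esub> cover (xF (Suc k)))) \<otimes>\<^bsub>QG\<^esub> cover tF"
    unfolding rel_right_def using tF(1) xc by (simp only: cover.hom_mult cover.hom_inv F.m_closed F.inv_closed)
  also have "cover (xF k) \<otimes>\<^bsub>QG\<^esub> cover (xF (Suc k)) \<otimes>\<^bsub>QG\<^esub>
      inv\<^bsub>QG\<^esub> cover (xF k) \<otimes>\<^bsub>QG\<^esub> inv\<^bsub>QG\<^esub> cover (xF (Suc k)) = \<one>\<^bsub>QG\<^esub>"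
    unfolding comm using cover.hom_closed[OF xc(1)] cover.hom_closed[OF xc(2)]
    by (simp only: QG.m_assoc QG.r_inv QG.r_one QG.m_closed QG.inv_closed QG.mult_inv_cancel)
  finally have "cover (rel_right k) = cover (xF k) \<otimes>\<^bsub>QG\<^esub> cover tF"
    using cover.hom_closed[OF xc(1)] by (simp only: QG.r_one)
  then have right: "defect (rel_right k) = (defect (xF k) + defect tF) mod m"
    unfolding defect_def[of "rel_right k"] cx ct QG_mult quad_prod_red by simp
  have "cover (rel_left k) = cover tF \<otimes>\<^bsub>QG\<^esub> cover (xF k)"
    unfolding rel_left_def using tF(1) xc by (simp only: cover.hom_mult)
  then have left: "defect (rel_left k) = (defect tF + defect (xF k) + ?z * ?v) mod m"
    unfolding defect_def[of "rel_left k"] cx ct QG_mult quad_prod_red by simp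
  have "rel k \<otimes>\<^bsub>F\<^esub> rel_right k = rel_left k"
    unfolding rel_def using rel_closed[of k] by (simp add: F.m_assoc)
  then have "(defect (rel k) + defect (rel_right k)) mod m = defect (rel_left k)"
    using defect_mult[OF rel_closed(3) rel_in_kernel rel_closed(2), of k k] by simp
  then have "(defect (rel k) + (defect (xF k) + defect tF)) mod m = (defect tF + defect (xF k) + ?z * ?v) mod m"
    unfolding left right by (simp only: mod_add_right_eq)
  from mod_diff_cong[OF this refl, of "defect (xF k) + defect tF"] show ?thesis by simp
qed

end

section \<open>Infinitely many relators\<close>

text \<open>Pigeonhole in place of linear algebra modulo \<open>m\<close>: coefficient vectors with
  entries below \<open>q\<close> outnumber the possible values on \<open>S\<close>, and the
  difference of two that collide is the answer. Its nonzero entries are smaller than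
  \<open>q\<close> in absolute value, so they are not divisible by \<open>q\<close>.\<close>

lemma vanishing_combination:
  fixes c :: "'i \<Rightarrow> 's \<Rightarrow> int"
  assumes fin: "finite S" "finite I" and pos: "m > 0" "q > 0" and big: "nat m ^ card S < nat q ^ card I"
  obtains \<mu> i0 where "i0 \<in> I" "\<not> q dvd \<mu> i0" "\<And>s. s \<in> S \<Longrightarrow> (\<Sum>i\<in>I. \<mu> i * c i s) mod m = 0"
proof -
  let ?A = "I \<rightarrow>\<^sub>E {0..<q}" and ?B = "S \<rightarrow>\<^sub>E {0..<m}"
  let ?f = "\<lambda>\<mu>. \<lambda>s \<in> S. (\<Sum>i\<in>I. \<mu> i * c i s) mod m"
  have "?f ` ?A \<subseteq> ?B" using pos by (auto simp: PiE_def Pi_def extensional_def)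
  moreover have "card ?B < card ?A" using fin big by (simp add: card_PiE)
  moreover have "finite ?B" using fin(1) by (simp add: finite_PiE)
  ultimately have "\<not> inj_on ?f ?A" by (meson card_inj_on_le not_le)
  then obtain \<mu> \<nu> where \<mu>: "\<mu> \<in> ?A" "\<nu> \<in> ?A" "?f \<mu> = ?f \<nu>" "\<mu> \<noteq> \<nu>" by (auto simp: inj_on_def)
  have "\<exists>i\<in>I. \<mu> i \<noteq> \<nu> i"
  proof (rule ccontr)
    assume "\<not> (\<exists>i\<in>I. \<mu> i \<noteq> \<nu> i)"
    then have "\<mu> = \<nu>" by (intro PiE_ext[OF \<mu>(1,2)]) blast
    then show False using \<mu>(4) by contradiction
  qed
  then obtain i where i: "i \<in> I" "\<mu> i \<noteq> \<nu> i" by (rule bexE)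
  have "0 \<le> \<mu> i" "\<mu> i < q" "0 \<le> \<nu> i" "\<nu> i < q" using \<mu>(1,2) i(1) by (auto simp: PiE_def Pi_def)
  then have "\<not> q dvd \<mu> i - \<nu> i" using i(2) by (metis mod_eq_dvd_iff mod_pos_pos_trivial)
  moreover have "(\<Sum>i\<in>I. (\<mu> i - \<nu> i) * c i s) mod m = 0" if s: "s \<in> S" for s
  proof -
    have "(\<Sum>i\<in>I. \<mu> i * c i s) mod m = (\<Sum>i\<in>I. \<nu> i * c i s) mod m"
      using fun_cong[OF \<mu>(3), of s] s by simp
    then show ?thesis
      by (simp add: left_diff_distrib sum_subtractf mod_eq_dvd_iff flip: dvd_eq_mod_eq_0)
  qed
  ultimately show ?thesis using i(1) by (intro that[of i "\<lambda>i. \<mu> i - \<nu> i"]) auto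
qed

text \<open>A substitute for Vandermonde determinants that needs no division modulo \<open>m\<close>.\<close>

lemma moments_vanish:
  fixes w y :: "'i \<Rightarrow> int"
  assumes "finite L" "\<And>k. (\<Sum>i\<in>I. w i * y i ^ k) mod m = 0"
  shows "(\<Sum>i\<in>I. w i * (\<Prod>l\<in>L. y i - y l) * y i ^ k) mod m = 0"
  using assms(1)
proof (induction L arbitrary: k rule: finite_induct)
  case empty
  then show ?case using assms(2) by simp
next
  case (insert a L)
  let ?P = "\<lambda>i. \<Prod>l\<in>L. y i - y l"
  \<comment> \<open>A further factor \<open>y i - y a\<close> combines the moments of orders
    \<open>Suc k\<close> and \<open>k\<close>, both of which vanish by induction.\<close>
  have "(\<Sum>i\<in>I. w i * (\<Prod>l\<in>insert a L. y i - y l) * y i ^ k)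
      = (\<Sum>i\<in>I. w i * ?P i * y i ^ Suc k - y a * (w i * ?P i * y i ^ k))"
    using insert by (intro sum.cong) (simp_all add: algebra_simps)
  also have "\<dots> = (\<Sum>i\<in>I. w i * ?P i * y i ^ Suc k) - y a * (\<Sum>i\<in>I. w i * ?P i * y i ^ k)"
    by (simp add: sum_subtractf sum_distrib_left)
  finally show ?case
    using insert.IH[of "Suc k"] insert.IH[of k] by (simp add: mod_eq_0_iff_dvd del: power_Suc)
qed

text \<open>With all nodes except \<open>i0\<close> as factors, every summand other than that of
  \<open>i0\<close> contains a zero factor.\<close>

lemma node_product_vanishes:
  fixes w y :: "'i \<Rightarrow> int"
  assumes "finite I" "i0 \<in> I" "\<And>k. (\<Sum>i\<in>I. w i * y i ^ k) mod m = 0"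
  shows "m dvd w i0 * (\<Prod>l\<in>I - {i0}. y i0 - y l)"
proof -
  have "(\<Sum>i\<in>I. w i * (\<Prod>l\<in>I - {i0}. y i - y l) * y i ^ 0)
      = (\<Sum>i\<in>{i0}. w i * (\<Prod>l\<in>I - {i0}. y i - y l) * y i ^ 0)"
  proof (rule sum.mono_neutral_right)
    show "\<forall>i\<in>I - {i0}. w i * (\<Prod>l\<in>I - {i0}. y i - y l) * y i ^ 0 = 0"
    proof
      fix i assume "i \<in> I - {i0}"
      then have "(\<Prod>l\<in>I - {i0}. y i - y l) = 0" using assms(1) by (intro prod_zero) auto
      then show "w i * (\<Prod>l\<in>I - {i0}. y i - y l) * y i ^ 0 = 0" by simp
    qed
  qed (use assms in auto)
  then show ?thesis
    using moments_vanish[OF _ assms(3), of "I - {i0}" 0] assms(1) by (simp add: mod_eq_0_iff_dvd)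
qed

text \<open>
  With \<open>\<sigma> = p (i + 1)\<close>, \<open>Y\<^sub>1 = 1 - \<sigma>\<close> and \<open>Y\<^sub>2 = 2 - 1 / (1 + \<sigma>)\<close>, the quantities
  below are, up to powers of \<open>1 + \<sigma>\<close>, the factor in \<open>defect_rel\<close> and the differences of the nodes \<open>Y\<^sub>3\<close>.
\<close>

lemma point_congruences:
  fixes s B m :: int
  assumes B: "[B * (1 + s) = 1] (mod m)"
  defines "Y1 \<equiv> 1 - s" and "Y2 \<equiv> 2 - B"
  shows "[(1 + s) ^ 3 * ((1 - Y1) * (1 - Y2) * (Y2 - Y1) * (1 - Y1 * Y2)) = - 2 * s ^ 5 * (2 + s)] (mod m)"
    and "[(1 + s) * (Y1 * Y2) = 1 + s - 2 * s ^ 2] (mod m)"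
proof -
  obtain t where t: "B * (1 + s) = 1 + m * t" using B by (metis add.commute cong_iff_lin cong_sym)
  have a: "(1 + s) * (1 - Y2) = - s + m * t" using t unfolding Y2_def by algebra
  have b: "(1 + s) * (Y2 - Y1) = s * (2 + s) - m * t" using t unfolding Y2_def Y1_def by algebra
  have c: "(1 + s) * (Y1 * Y2) = 1 + s - 2 * s ^ 2 - m * (t * (1 - s))" using t unfolding Y2_def Y1_def by algebra
  have d: "(1 + s) * (1 - Y1 * Y2) = 2 * s ^ 2 + m * (t * (1 - s))" using c by algebra
  show "[(1 + s) * (Y1 * Y2) = 1 + s - 2 * s ^ 2] (mod m)"
    unfolding c by (simp add: cong_iff_dvd_diff)
  have "(1 + s) ^ 3 * ((1 - Y1) * (1 - Y2) * (Y2 - Y1) * (1 - Y1 * Y2))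
      = (1 - Y1) * ((1 + s) * (1 - Y2)) * ((1 + s) * (Y2 - Y1)) * ((1 + s) * (1 - Y1 * Y2))" by algebra
  also have "\<dots> = s * (- s + m * t) * (s * (2 + s) - m * t) * (2 * s ^ 2 + m * (t * (1 - s)))"
    unfolding a b d by (simp add: Y1_def)
  also have "[\<dots> = s * (- s) * (s * (2 + s)) * (2 * s ^ 2)] (mod m)"
    by (intro cong_mult cong_refl) (simp_all add: cong_iff_dvd_diff)
  also have "s * (- s) * (s * (2 + s)) * (2 * s ^ 2) = - 2 * s ^ 5 * (2 + s)" by algebra
  finally show "[(1 + s) ^ 3 * ((1 - Y1) * (1 - Y2) * (Y2 - Y1) * (1 - Y1 * Y2)) = - 2 * s ^ 5 * (2 + s)] (mod m)" .
qed

section \<open>Several evaluation points against finitely many relators\<close>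

context presented_witness
begin

definition kernel_F :: "'b set" where
  "kernel_F = {g \<in> carrier F. \<phi> g = \<one>\<^bsub>Aut0 G\<^esub>}"

text \<open>Hides the locale of a single evaluation point, so that many points can be combined over
  the same \<open>F\<close> and \<open>\<phi>\<close>.\<close>

lemma defect_exists:
  assumes "j > 0" "m = int p ^ j" "Y1 mod int p = 1" "Y2 mod int p = 1" "((2 - Y1) * (2 - Y2)) mod m = 1"
  obtains c where "locally_constant (topo F) c"
    "\<And>g h. g \<in> kernel_F \<Longrightarrow> h \<in> carrier F \<Longrightarrow> c (g \<otimes>\<^bsub>F\<^esub> h) = (c g + c h) mod m"
    "\<And>g h. g \<in> kernel_F \<Longrightarrow> h \<in> carrier F \<Longrightarrow> c (h \<otimes>\<^bsub>F\<^esub> g \<otimes>\<^bsub>F\<^esub> inv\<^bsub>F\<^esub> h) = c g"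
    "\<And>k. c (rel k) mod m = ((1 - Y1) * (1 - Y2) * (Y2 - Y1) * (1 - Y1 * Y2) * (Y1 * Y2) ^ k) mod m"
proof -
  interpret P: cover_point G p x y F X \<phi> j Y1 Y2 m "Y1 * Y2"
    by unfold_locales (use assms in simp_all)
  show ?thesis
    by (rule that[of P.defect])
      (use P.locally_constant_defect P.defect_mult P.defect_conj P.defect_rel in \<open>simp_all add: kernel_F_def mult.assoc\<close>)
qed

lemma rel_kernel_F: "rel k \<in> kernel_F"
  using rel_closed(3) rel_in_kernel by (simp add: kernel_F_def)

text \<open>
  With \<open>r = card S\<close> relators, \<open>r + 1\<close> evaluation points and a large modulus there is a nontrivial
  combination of the defects vanishing on \<open>S\<close>, hence on the whole kernel.
\<close>

theorem kernel_not_finitely_normally_generated: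
  assumes S: "finite S" "S \<subseteq> carrier F" shows "closed_normal_closure F S \<noteq> kernel_F"
proof
  assume R: "closed_normal_closure F S = kernel_F"
  have p1: "int p > 1" using prime_gt_1_nat[OF prime_p] by simp
  define I where "I = {..card S}"
  have finI: "finite I" and cardI: "card I = card S + 1" by (simp_all add: I_def)
  \<comment> \<open>Divisibility by \<open>p\<close> makes \<open>Y1\<close> equal to 1 modulo
    \<open>p\<close>; positivity and distinctness keep the factors of \<open>z\<close> below
    nonzero.\<close>
  define \<sigma> where "\<sigma> i = int p * (int i + 1)" for i :: nat
  have \<sigma>_pos: "\<sigma> i > 0" for i using p1 by (simp add: \<sigma>_def)
  have \<sigma>_mod: "(1 + a * \<sigma> i) mod int p = 1" for a i
    using p1 by (simp add: \<sigma>_def mult.left_commute[of a])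
  have \<sigma>_inj: "\<sigma> l \<noteq> \<sigma> i" if "l \<noteq> i" for l i using that p1 by (simp add: \<sigma>_def)
  \<comment> \<open>\<open>Y2\<close> involves an inverse modulo \<open>m\<close> and changes with
    \<open>m\<close>. After clearing denominators \<open>1 + \<sigma>\<close>, the constant of
    \<open>defect_rel\<close> times the node differences is congruent to this integer, which is
    fixed before \<open>m\<close> is chosen.\<close>
  define z where "z i = (- 2 * \<sigma> i ^ 5 * (2 + \<sigma> i)) * (\<Prod>l\<in>I - {i}. 2 * (\<sigma> l - \<sigma> i) * (\<sigma> l + \<sigma> i + \<sigma> i * \<sigma> l))" for i
  have z0: "z i \<noteq> 0" for i
  proof -
    have "\<sigma> l + \<sigma> i + \<sigma> i * \<sigma> l \<noteq> 0" for l using \<sigma>_pos[of i] \<sigma>_pos[of l] mult_pos_pos[of "\<sigma> i" "\<sigma> l"] by linarith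
    moreover have "2 + \<sigma> i \<noteq> 0" "\<sigma> i \<noteq> 0" using \<sigma>_pos[of i] by linarith+
    ultimately show ?thesis using finI \<sigma>_inj by (auto simp: z_def)
  qed
  \<comment> \<open>A crude bound on p-adic valuations: \<open>p ^ b > b\<close>, and
    \<open>b\<close> is at least every absolute value of \<open>z i\<close>.\<close>
  define b where "b = nat (\<Sum>i\<in>I. \<bar>z i\<bar>)"
  have z_not_dvd: "\<not> int p ^ b dvd z i" if i: "i \<in> I" for i
  proof
    assume "int p ^ b dvd z i"
    then have "int p ^ b \<le> \<bar>z i\<bar>" using z0 dvd_imp_le_int[of "z i" "int p ^ b"] p1 by simp
    also have "\<dots> \<le> (\<Sum>i\<in>I. \<bar>z i\<bar>)" using finI i by (intro member_le_sum) auto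
    also have "\<dots> = int b" by (simp add: b_def sum_nonneg)
    also have "b < p ^ b" using prime_gt_1_nat[OF prime_p] by (intro power_gt_expt) simp
    then have "int b < int p ^ b" by (simp flip: of_nat_power)
    finally show False by simp
  qed
  \<comment> \<open>The least exponent with \<open>(j - b) * (card S + 1) > j * card S\<close>, the
    count needed for \<open>vanishing_combination\<close> with
    \<open>q = p ^ (j - b)\<close>.\<close>
  define j where "j = b * (card S + 1) + 1"
  define m where "m = int p ^ j"
  have j0: "j > 0" and jb: "j > b" by (simp_all add: j_def)
  have prime_ip: "prime (int p)" using prime_p by simp
  have m1: "m > 1" using p1 j0 by (simp add: m_def one_less_power)
  have "\<exists>B. B \<in> one_units (int p) m \<and> (B * (1 + \<sigma> i)) mod m = 1" for i
    using one_unit_inverse[OF prime_ip j0 m_def, of "1 + \<sigma> i"] \<sigma>_mod[of 1 i] by auto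
  then obtain B where B: "\<And>i. B i \<in> one_units (int p) m" "\<And>i. (B i * (1 + \<sigma> i)) mod m = 1" by metis
  define Y1 where "Y1 i = 1 - \<sigma> i" for i
  define Y2 where "Y2 i = 2 - B i" for i
  define e where "e i = (1 - Y1 i) * (1 - Y2 i) * (Y2 i - Y1 i) * (1 - Y1 i * Y2 i)" for i
  have B_cong: "[B i * (1 + \<sigma> i) = 1] (mod m)" for i using B(2) m1 by (simp add: cong_def)
  have "\<exists>c. locally_constant (topo F) c \<and>
    (\<forall>g\<in>kernel_F. \<forall>h\<in>carrier F. c (g \<otimes>\<^bsub>F\<^esub> h) = (c g + c h) mod m) \<and>
    (\<forall>g\<in>kernel_F. \<forall>h\<in>carrier F. c (h \<otimes>\<^bsub>F\<^esub> g \<otimes>\<^bsub>F\<^esub> inv\<^bsub>F\<^esub> h) = c g) \<and>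
    (\<forall>k. c (rel k) mod m = (e i * (Y1 i * Y2 i) ^ k) mod m)" for i
  proof -
    have y1: "Y1 i mod int p = 1" using \<sigma>_mod[of "- 1" i] by (simp add: Y1_def)
    have "Y2 i mod int p = (2 - 1) mod int p"
      unfolding Y2_def using one_units_mod(1)[OF prime_ip j0 m_def B(1)[of i]] p1 by (intro mod_diff_cong) simp_all
    then have y2: "Y2 i mod int p = 1" using p1 by simp
    have y12: "((2 - Y1 i) * (2 - Y2 i)) mod m = 1" using B(2)[of i] by (simp add: Y1_def Y2_def mult.commute)
    show ?thesis
      by (rule defect_exists[OF j0 m_def y1 y2 y12]) (unfold e_def, blast)
  qed
  then obtain c where c_lc: "\<And>i. locally_constant (topo F) (c i)"
    and c_mult: "\<And>i g h. g \<in> kernel_F \<Longrightarrow> h \<in> carrier F \<Longrightarrow> c i (g \<otimes>\<^bsub>F\<^esub> h) = (c i g + c i h) mod m"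
    and c_conj: "\<And>i g h. g \<in> kernel_F \<Longrightarrow> h \<in> carrier F \<Longrightarrow> c i (h \<otimes>\<^bsub>F\<^esub> g \<otimes>\<^bsub>F\<^esub> inv\<^bsub>F\<^esub> h) = c i g"
    and c_rel: "\<And>i k. c i (rel k) mod m = (e i * (Y1 i * Y2 i) ^ k) mod m"
    by metis
  have big: "nat m ^ card S < nat (int p ^ (j - b)) ^ card I"
  proof -
    have "j * card S < (j - b) * (card S + 1)" by (simp add: j_def algebra_simps)
    then have "p ^ (j * card S) < p ^ ((j - b) * (card S + 1))"
      using prime_gt_1_nat[OF prime_p] by (rule power_strict_increasing)
    then show ?thesis unfolding m_def cardI by (simp only: power_mult nat_power_eq[OF of_nat_0_le_iff] nat_int)
  qed
  obtain \<mu> i0 where i0: "i0 \<in> I" "\<not> int p ^ (j - b) dvd \<mu> i0"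
    and \<mu>: "\<And>s. s \<in> S \<Longrightarrow> (\<Sum>i\<in>I. \<mu> i * c i s) mod m = 0"
    by (rule vanishing_combination[OF S(1) finI _ _ big, of c]) (use m1 p1 in simp_all)
  define L where "L g = (\<Sum>i\<in>I. \<mu> i * c i g)" for g
  have L_mult: "L (g \<otimes>\<^bsub>F\<^esub> h) mod m = (L g + L h) mod m" if "g \<in> kernel_F" "h \<in> carrier F" for g h
  proof -
    have "[L (g \<otimes>\<^bsub>F\<^esub> h) = (\<Sum>i\<in>I. \<mu> i * (c i g + c i h))] (mod m)"
      unfolding L_def using c_mult[OF that] by (intro cong_sum cong_mult cong_refl) (simp add: cong_def)
    then show ?thesis by (simp add: L_def cong_def distrib_left sum.distrib)
  qed
  \<comment> \<open>The vanishing set of the combined defect. It will be closed and normal in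
    \<open>F\<close> and contain \<open>S\<close>, hence be all of the kernel.\<close>
  let ?M = "{g \<in> kernel_F. L g mod m = 0}"
  have KF: "g \<in> carrier F" if "g \<in> kernel_F" for g using that by (simp add: kernel_F_def)
  have norm: "kernel_F \<lhd> F" using F.normal_closed_normal_closure[OF S(2)] unfolding R .
  note Ks = normal_imp_subgroup[OF norm]
  have oneM: "\<one>\<^bsub>F\<^esub> \<in> ?M"
  proof -
    have "L \<one>\<^bsub>F\<^esub> mod m = (L \<one>\<^bsub>F\<^esub> + L \<one>\<^bsub>F\<^esub>) mod m"
      using L_mult[OF subgroup.one_closed[OF Ks] F.one_closed] by simp
    then have "L \<one>\<^bsub>F\<^esub> mod m = 0"
      by (simp add: mod_eq_dvd_iff mod_eq_0_iff_dvd)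
    then show ?thesis using subgroup.one_closed[OF Ks] by blast
  qed
  have "subgroup ?M F"
  proof (rule subgroup.intro)
    show "?M \<subseteq> carrier F" using KF by blast
    show "g \<otimes>\<^bsub>F\<^esub> h \<in> ?M" if gh: "g \<in> ?M" "h \<in> ?M" for g h
    proof -
      have "L (g \<otimes>\<^bsub>F\<^esub> h) mod m = (L g mod m + L h mod m) mod m"
        unfolding mod_add_eq by (rule L_mult) (use KF gh in blast)+
      then show ?thesis using gh subgroup.m_closed[OF Ks] by simp
    qed
    show "inv\<^bsub>F\<^esub> g \<in> ?M" if g: "g \<in> ?M" for g
    proof -
      have gk: "g \<in> kernel_F" "g \<in> carrier F" using g KF by auto
      have "L \<one>\<^bsub>F\<^esub> mod m = (L g mod m + L (inv\<^bsub>F\<^esub> g)) mod m"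
        unfolding mod_add_left_eq using L_mult[OF gk(1) F.inv_closed[OF gk(2)]] F.r_inv[OF gk(2)] by simp
      then show ?thesis using g oneM subgroup.m_inv_closed[OF Ks gk(1)] by simp
    qed
  qed (rule oneM)
  then have "?M \<lhd> F"
  proof (rule F.normal_invI)
    fix h g assume h: "h \<in> carrier F" and g: "g \<in> ?M"
    have "L (h \<otimes>\<^bsub>F\<^esub> g \<otimes>\<^bsub>F\<^esub> inv\<^bsub>F\<^esub> h) = L g" unfolding L_def using c_conj h g by simp
    then show "h \<otimes>\<^bsub>F\<^esub> g \<otimes>\<^bsub>F\<^esub> inv\<^bsub>F\<^esub> h \<in> ?M" using normal.inv_op_closed2[OF norm h] g by simp
  qed
  moreover have "closedin (topo F) ?M"
  proof -
    have lc: "locally_constant (topo F) L"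
      unfolding L_def using finI by (intro locally_constant_sum locally_constant_compose[OF c_lc, of "\<lambda>u. \<mu> _ * u"])
    have "openin (topo F) {g \<in> topspace (topo F). L g mod m \<noteq> 0}" by (rule locally_constant_openin[OF lc])
    then have "closedin (topo F) (topspace (topo F) - {g \<in> topspace (topo F). L g mod m \<noteq> 0})" by blast
    moreover have "closedin (topo F) kernel_F" using F.closedin_closed_normal_closure[OF S(2)] unfolding R .
    ultimately have "closedin (topo F) (kernel_F \<inter> (topspace (topo F) - {g \<in> topspace (topo F). L g mod m \<noteq> 0}))"
      by (intro closedin_Int)
    moreover have "kernel_F \<inter> (topspace (topo F) - {g \<in> topspace (topo F). L g mod m \<noteq> 0}) = ?M"
      using KF by auto
    ultimately show ?thesis by simp
  qed
  moreover have "S \<subseteq> ?M"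
    using \<mu> F.subset_closed_normal_closure[of S] unfolding R L_def by blast
  ultimately have "kernel_F \<subseteq> ?M" unfolding R[symmetric] closed_normal_closure_def by blast
  then have L_rel: "L (rel k) mod m = 0" for k using rel_kernel_F by blast
  have "(\<Sum>i\<in>I. (\<mu> i * e i) * (Y1 i * Y2 i) ^ k) mod m = 0" for k
  proof -
    have "[(\<Sum>i\<in>I. (\<mu> i * e i) * (Y1 i * Y2 i) ^ k) = L (rel k)] (mod m)"
      unfolding L_def mult.assoc using c_rel by (intro cong_sum cong_mult cong_refl) (simp add: cong_def mult.assoc)
    then show ?thesis using L_rel by (simp add: cong_def)
  qed
  then have dvd: "m dvd (\<mu> i0 * e i0) * (\<Prod>l\<in>I - {i0}. Y1 i0 * Y2 i0 - Y1 l * Y2 l)"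
    using node_product_vanishes[OF finI i0(1), of "\<lambda>i. \<mu> i * e i" "\<lambda>i. Y1 i * Y2 i" m] by simp
  let ?A = "\<lambda>i. 1 + \<sigma> i"
  have "[?A i0 ^ 3 * e i0 * (\<Prod>l\<in>I - {i0}. ?A i0 * ?A l * (Y1 i0 * Y2 i0 - Y1 l * Y2 l)) = z i0] (mod m)"
    unfolding z_def
  proof (rule cong_mult[OF _ cong_prod])
    show "[?A i0 ^ 3 * e i0 = - 2 * \<sigma> i0 ^ 5 * (2 + \<sigma> i0)] (mod m)"
      using point_congruences(1)[OF B_cong[of i0]] unfolding e_def Y1_def Y2_def .
    fix l
    have pc: "[?A i * (Y1 i * Y2 i) = 1 + \<sigma> i - 2 * \<sigma> i ^ 2] (mod m)" for i
      using point_congruences(2)[OF B_cong[of i]] unfolding Y1_def Y2_def .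
    have "?A i0 * ?A l * (Y1 i0 * Y2 i0 - Y1 l * Y2 l)
        = ?A l * (?A i0 * (Y1 i0 * Y2 i0)) - ?A i0 * (?A l * (Y1 l * Y2 l))" by algebra
    also have "[\<dots> = ?A l * (1 + \<sigma> i0 - 2 * \<sigma> i0 ^ 2) - ?A i0 * (1 + \<sigma> l - 2 * \<sigma> l ^ 2)] (mod m)"
      by (intro cong_diff cong_mult cong_refl pc)
    also have "?A l * (1 + \<sigma> i0 - 2 * \<sigma> i0 ^ 2) - ?A i0 * (1 + \<sigma> l - 2 * \<sigma> l ^ 2)
        = 2 * (\<sigma> l - \<sigma> i0) * (\<sigma> l + \<sigma> i0 + \<sigma> i0 * \<sigma> l)" by algebra
    finally show "[?A i0 * ?A l * (Y1 i0 * Y2 i0 - Y1 l * Y2 l) = 2 * (\<sigma> l - \<sigma> i0) * (\<sigma> l + \<sigma> i0 + \<sigma> i0 * \<sigma> l)] (mod m)" .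
  qed
  then have cz: "[\<mu> i0 * (?A i0 ^ 3 * e i0 * (\<Prod>l\<in>I - {i0}. ?A i0 * ?A l * (Y1 i0 * Y2 i0 - Y1 l * Y2 l))) = \<mu> i0 * z i0] (mod m)"
    by (intro cong_mult cong_refl)
  have eq: "\<mu> i0 * (?A i0 ^ 3 * e i0 * (\<Prod>l\<in>I - {i0}. ?A i0 * ?A l * (Y1 i0 * Y2 i0 - Y1 l * Y2 l)))
     = (\<mu> i0 * e i0) * (\<Prod>l\<in>I - {i0}. Y1 i0 * Y2 i0 - Y1 l * Y2 l) * (?A i0 ^ 3 * (\<Prod>l\<in>I - {i0}. ?A i0 * ?A l))"
    by (simp only: prod.distrib) algebra
  have "m dvd \<mu> i0 * (?A i0 ^ 3 * e i0 * (\<Prod>l\<in>I - {i0}. ?A i0 * ?A l * (Y1 i0 * Y2 i0 - Y1 l * Y2 l)))"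
    unfolding eq by (rule dvd_mult2[OF dvd])
  then have "m dvd \<mu> i0 * z i0" using cz by (simp only: cong_def dvd_eq_mod_eq_0)
  then have "int p ^ j dvd \<mu> i0 * z i0" unfolding m_def .
  \<comment> \<open>The two exponents add up to \<open>j + 1\<close>, so one factor must be
    divisible as stated. The choice of \<open>\<mu>\<close> excludes the first case, that of
    \<open>b\<close> the second.\<close>
  then have "int p ^ (j - b) dvd \<mu> i0 \<or> int p ^ Suc b dvd z i0"
    by (rule prime_elem_power_dvd_cases) (use prime_ip jb in simp_all)
  then have "int p ^ Suc b dvd z i0" using i0(2) by blast
  moreover have "int p ^ b dvd int p ^ Suc b" by simp
  ultimately show False using z_not_dvd[OF i0(1)] dvd_trans by blast
qed

end

section \<open>Quotients of free pro-p groups, and the conclusion\<close>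

lemma topspace_quotient_topo:
  assumes "top_group F" "R \<lhd> F"
  shows "topspace (quotient_topo F R) = rcosets\<^bsub>F\<^esub> R"
proof
  interpret F: top_group F by (rule assms(1))
  note Rs = normal_imp_subgroup[OF assms(2)]
  show "topspace (quotient_topo F R) \<subseteq> rcosets\<^bsub>F\<^esub> R"
    using openin_topspace[of "quotient_topo F R"] unfolding openin_quotient_topo[OF F.is_group Rs] by blast
  have "openin (quotient_topo F R) (rcosets\<^bsub>F\<^esub> R)"
    unfolding openin_quotient_topo[OF F.is_group Rs] using F.rcosets_part_G[OF Rs] F.openin_carrier by simp
  then show "rcosets\<^bsub>F\<^esub> R \<subseteq> topspace (quotient_topo F R)" by (rule openin_subset)
qed

lemma continuous_quotient_map:
  assumes "top_group F" "R \<lhd> F"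
  shows "continuous_map (topo F) (quotient_topo F R) (\<lambda>g. R #>\<^bsub>F\<^esub> g)"
proof -
  interpret F: top_group F by (rule assms(1))
  note Rs = normal_imp_subgroup[OF assms(2)]
  have "{g \<in> carrier F. R #>\<^bsub>F\<^esub> g \<in> U} = \<Union>U" if U: "U \<subseteq> rcosets\<^bsub>F\<^esub> R" for U
  proof (intro equalityI subsetI)
    fix g assume "g \<in> {g \<in> carrier F. R #>\<^bsub>F\<^esub> g \<in> U}"
    then show "g \<in> \<Union>U" using F.rcos_self[OF _ Rs, of g] by blast
  next
    fix g assume "g \<in> \<Union>U"
    then obtain C where C: "C \<in> U" "g \<in> C" by blast
    then obtain a where a: "a \<in> carrier F" "C = R #>\<^bsub>F\<^esub> a" using U by (auto simp: RCOSETS_def)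
    have "g \<in> carrier F" using F.r_coset_subset_G[OF subgroup.subset[OF Rs] a(1)] C(2) a(2) by blast
    moreover have "R #>\<^bsub>F\<^esub> g = C" using F.repr_independence[OF _ a(1) Rs, of g] C(2) a(2) by simp
    ultimately show "g \<in> {g \<in> carrier F. R #>\<^bsub>F\<^esub> g \<in> U}" using C(1) by simp
  qed
  then show ?thesis
    unfolding continuous_map_def topspace_quotient_topo[OF assms] openin_quotient_topo[OF F.is_group Rs]
    using F.rcosetsI[OF subgroup.subset[OF Rs]] by simp
qed

context free_pro_p_two
begin

lemma witness_not_fin_presented: "\<not> fin_presented_pro_p p (tsub (Aut0 G) witness)"
proof
  let ?W = "tsub (Aut0 G) witness"
  assume "fin_presented_pro_p p ?W"
  then obtain F :: "nat set tgroup" and X S where F: "finite X" "free_pro_p_on p F X" "finite S" "S \<subseteq> carrier F"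
      "tg_isomorphic ?W (tquot F (closed_normal_closure F S))"
    unfolding fin_presented_pro_p_def by blast
  define R where "R = closed_normal_closure F S"
  have "topological_group F"
    using F(2) by (simp add: free_pro_p_on_def pro_p_group_def profinite_group_def)
  then have Ft: "top_group F" by (rule top_groupI)
  interpret F: top_group F by (rule Ft)
  have Rn: "R \<lhd> F" unfolding R_def by (rule F.normal_closed_normal_closure[OF F(4)])
  note Rs = normal_imp_subgroup[OF Rn]
  obtain \<theta> where \<theta>: "\<theta> \<in> iso ?W (tquot F R)" "homeomorphic_map (topo ?W) (quotient_topo F R) \<theta>"
    using F(5) unfolding tg_isomorphic_def R_def[symmetric] by auto
  obtain \<psi> where \<psi>: "homeomorphic_maps (topo ?W) (quotient_topo F R) \<theta> \<psi>"
    using \<theta>(2) by (auto simp: homeomorphic_map_maps)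
  have tsW: "topspace (topo ?W) = witness"
    using witness_A0 topspace_Aut0 by (auto simp del: Aut0_simps)
  have tsQ: "topspace (quotient_topo F R) = rcosets\<^bsub>F\<^esub> R" by (rule topspace_quotient_topo[OF Ft Rn])
  have \<psi>_cont: "continuous_map (quotient_topo F R) (topo ?W) \<psi>" using \<psi> by (simp add: homeomorphic_maps_def)
  have \<psi>_in: "\<psi> C \<in> witness" if "C \<in> rcosets\<^bsub>F\<^esub> R" for C
    using continuous_map_image_subset_topspace[OF \<psi>_cont] that unfolding tsW tsQ by blast
  have \<theta>\<psi>: "\<theta> (\<psi> C) = C" if "C \<in> rcosets\<^bsub>F\<^esub> R" for C
    using \<psi> that tsQ by (simp add: homeomorphic_maps_def)
  have \<psi>\<theta>: "\<psi> (\<theta> n) = n" if "n \<in> witness" for n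
    using \<psi> that tsW by (simp add: homeomorphic_maps_def)
  have \<theta>_in: "\<theta> n \<in> rcosets\<^bsub>F\<^esub> R" if "n \<in> witness" for n
    using \<theta>(1) that by (auto simp: iso_def hom_def)
  have \<theta>_mult: "\<theta> (n \<otimes>\<^bsub>Aut0 G\<^esub> n') = \<theta> n <#>\<^bsub>F\<^esub> \<theta> n'" if "n \<in> witness" "n' \<in> witness" for n n'
    using \<theta>(1) that by (simp add: iso_def hom_def del: Aut0_simps)
  \<comment> \<open>The projection to the quotient followed by the inverse of the given isomorphism;
    its kernel is \<open>R\<close>, the closed normal closure of \<open>S\<close>.\<close>
  define \<phi> where "\<phi> g = \<psi> (R #>\<^bsub>F\<^esub> g)" for g
  have Rg: "R #>\<^bsub>F\<^esub> g \<in> rcosets\<^bsub>F\<^esub> R" if "g \<in> carrier F" for g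
    by (rule F.rcosetsI[OF subgroup.subset[OF Rs] that])
  have "continuous_map (topo F) (topo ?W) (\<psi> \<circ> (\<lambda>g. R #>\<^bsub>F\<^esub> g))"
    by (rule continuous_map_compose[OF continuous_quotient_map[OF Ft Rn] \<psi>_cont])
  then have "continuous_map (topo F) (topo ?W) \<phi>"
    by (rule continuous_map_eq) (simp add: \<phi>_def)
  then have cont: "continuous_map (topo F) (topo (Aut0 G)) \<phi>"
    unfolding tsub_simps(4) by (rule continuous_map_into_fulltopology)
  have mult: "\<phi> (g \<otimes>\<^bsub>F\<^esub> h) = \<phi> g \<otimes>\<^bsub>Aut0 G\<^esub> \<phi> h" if gh: "g \<in> carrier F" "h \<in> carrier F" for g h
  proof -
    have in_w: "\<phi> g \<in> witness" "\<phi> h \<in> witness" unfolding \<phi>_def using \<psi>_in Rg gh by blast+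
    have "\<theta> (\<phi> g \<otimes>\<^bsub>Aut0 G\<^esub> \<phi> h) = (R #>\<^bsub>F\<^esub> g) <#>\<^bsub>F\<^esub> (R #>\<^bsub>F\<^esub> h)"
      using \<theta>_mult[OF in_w] \<theta>\<psi>[OF Rg[OF gh(1)]] \<theta>\<psi>[OF Rg[OF gh(2)]] by (simp only: \<phi>_def)
    also have "\<dots> = R #>\<^bsub>F\<^esub> (g \<otimes>\<^bsub>F\<^esub> h)" by (rule normal.rcos_sum[OF Rn gh])
    finally show ?thesis using \<psi>\<theta>[OF witness_mult[OF in_w]] by (simp only: \<phi>_def)
  qed
  have surj: "\<exists>g \<in> carrier F. \<phi> g = n" if n: "n \<in> witness" for n
  proof -
    obtain g where "g \<in> carrier F" "\<theta> n = R #>\<^bsub>F\<^esub> g" using \<theta>_in[OF n] by (auto simp: RCOSETS_def)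
    then show ?thesis using \<psi>\<theta>[OF n] by (auto simp: \<phi>_def)
  qed
  interpret P: presented_witness G p x y F X \<phi>
    by unfold_locales (use F cont mult surj \<psi>_in Rg in \<open>simp_all add: \<phi>_def\<close>)
  have "g \<in> R \<longleftrightarrow> g \<in> P.kernel_F" for g
  proof (cases "g \<in> carrier F")
    case True
    have R1: "R #>\<^bsub>F\<^esub> \<one>\<^bsub>F\<^esub> = R" by (rule F.coset_mult_one[OF subgroup.subset[OF Rs]])
    have "g \<in> R \<longleftrightarrow> R #>\<^bsub>F\<^esub> g = R #>\<^bsub>F\<^esub> \<one>\<^bsub>F\<^esub>"
      unfolding R1 using F.coset_join1[OF _ True Rs] F.coset_join2[OF True Rs] by blast
    also have "\<dots> \<longleftrightarrow> \<phi> g = \<phi> \<one>\<^bsub>F\<^esub>"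
      unfolding \<phi>_def using \<theta>\<psi>[OF Rg[OF True]] \<theta>\<psi>[OF Rg[OF F.one_closed]] by metis
    also have "\<dots> \<longleftrightarrow> g \<in> P.kernel_F" using True by (simp only: P.kernel_F_def P.\<phi>.hom_one mem_Collect_eq simp_thms)
    finally show ?thesis .
  next
    case False
    then show ?thesis using subgroup.mem_carrier[OF Rs] by (auto simp: P.kernel_F_def)
  qed
  then have "R = P.kernel_F" by blast
  then show False using P.kernel_not_finitely_normally_generated[OF F(3,4)] unfolding R_def by simp
qed

lemma Aut0_incoherent: "incoherent_pro_p p (Aut0 G)"
proof -
  have W: "closed_subgroup witness (Aut0 G)"
    unfolding closed_subgroup_def using witness_subgroup by (simp add: witness_def)
  \<comment> \<open>Finite generation is required inside the subgroup as a group of its own.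
    Inverses there and in \<open>Aut0 G\<close> coincide, so the abstract subgroups generated by
    \<open>autos\<close> do as well.\<close>
  have "generate (tsub (Aut0 G) witness) autos = generate (Aut0 G) autos"
  proof -
    have eq: "inv\<^bsub>tsub (Aut0 G) witness\<^esub> n = inv\<^bsub>Aut0 G\<^esub> n" if "n \<in> witness" for n
    proof -
      have "inv\<^bsub>tsub (Aut0 G) witness\<^esub> n = inv\<^bsub>(Aut0 G)\<lparr>carrier := witness\<rparr>\<^esub> n"
        by (simp add: m_inv_def)
      then show ?thesis using Aut0.m_inv_consistent[OF witness_subgroup that] by simp
    qed
    show ?thesis
    proof (intro equalityI subsetI)
      fix n assume "n \<in> generate (tsub (Aut0 G) witness) autos"
      then show "n \<in> generate (Aut0 G) autos"
      proof (induction rule: generate.induct)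
        case (inv h)
        then show ?case using eq autos_witness generate.inv[of h autos "Aut0 G"] by auto
      qed (simp_all only: tsub_simps generate.one generate.incl generate.eng)
    next
      fix n assume "n \<in> generate (Aut0 G) autos"
      then show "n \<in> generate (tsub (Aut0 G) witness) autos"
      proof (induction rule: generate.induct)
        case one
        then show ?case using generate.one[of "tsub (Aut0 G) witness" autos] by (simp only: tsub_simps)
      next
        case (incl h)
        then show ?case by (rule generate.incl)
      next
        case (inv h)
        then show ?case using eq autos_witness generate.inv[of h autos "tsub (Aut0 G) witness"] by auto
      next
        case (eng h1 h2)
        then show ?case using generate.eng[of h1 "tsub (Aut0 G) witness" autos h2] by (simp only: tsub_simps)
      qed
    qed
  qed
  then have "top_generates (tsub (Aut0 G) witness) autos"
    unfolding top_generates_def tsub_simps closure_of_subtopology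
    using autos_witness closure_of_subset[of "generate (Aut0 G) autos" "topo (Aut0 G)"]
      Aut0.generate_incl[of autos] autos_A0 topspace_Aut0
    by (simp add: witness_def[symmetric] Int_absorb1 Int_absorb2 closure_of_subtopology del: Aut0_simps(4))
  moreover have "finite autos" by (simp add: autos_def)
  ultimately have "top_fin_gen (tsub (Aut0 G) witness)" by (auto simp only: top_fin_gen_def)
  with W witness_not_fin_presented have "\<not> coherent_pro_p p (Aut0 G)"
    unfolding coherent_pro_p_def by meson
  then show ?thesis using pro_p_Aut0 by (simp add: incoherent_pro_p_def)
qed

end

theorem corollary1p5:
  fixes p :: nat and K :: "'a tgroup"
  assumes "prime p"
    and "free_pro_p p K"
    and "min_gens K = 2"
    and "\<exists>H. closed_subgroup H (Out K) \<and> free_pro_p p (tsub (Out K) H) \<and>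
             \<not> procyclic (tsub (Out K) H)"
  shows "incoherent_pro_p p (Aut0 K)"
proof -
  obtain X where X: "free_pro_p_on p K X" using assms(2) by (auto simp: free_pro_p_def)
  obtain x y where xy: "X = {x, y}" "x \<noteq> y" using free_pro_p_rank_two[OF X assms(1,3)] .
  have pro_p: "pro_p_group p K" using X by (simp add: free_pro_p_on_def)
  then have "topological_group K" by (simp add: pro_p_group_def profinite_group_def)
  then interpret top_group K by (rule top_groupI)
  interpret free_pro_p_two K p x y
    by unfold_locales (use assms(1) pro_p X xy in simp_all)
  show ?thesis by (rule Aut0_incoherent)
qed

end
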